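(* Let $\mathbb{F}$ be an algebraically closed field of characteristic $2$, let $n\geq 6$ with $n\equiv 2\pmod 4$, and let $G\leq W:=\mathsf{S}_{n/2}\wr\mathsf{S}_2\leq\mathsf{S}_n$. Then $D^{(n-1,1)}{\downarrow}_G$ is irreducible if and only if both of the following conditions hold: (i) $G$ is transitive on $\{1,2,\dots,n\}$; (ii) if $B=\mathsf{S}_{n/2}\times\mathsf{S}_{n/2}$ is the base subgroup of $W$, then the projection of $G\cap B$ onto each factor $\mathsf{S}_{n/2}$ of $B$ induces a $2$-transitive subgroup of $\mathsf{S}_{n/2}$ over which $D^{(n/2-1,1)}$ is irreducible, and the restrictions of the two modules $D^{(n/2-1,1)}\boxtimes \mathbf{1}_{\mathsf{S}_{n/2}}$ and $\mathbf{1}_{\mathsf{S}_{n/2}}\boxtimes D^{(n/2-1,1)}$ to $G\cap B$ are non-isomorphic.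
   Context: $\mathsf{S}_m$ is the symmetric group on $m$ letters. For a $2$-regular partition $\lambda$ of $m$ (no two equal nonzero parts), $D^\lambda$ denotes James' irreducible $\mathbb{F}\mathsf{S}_m$-module, the simple head of the Specht module $S^\lambda$; in particular $D^{(m-1,1)}$ is the heart of the natural permutation module of degree $m$ (of dimension $m-2$ if $m$ is even, $m-1$ if $m$ is odd, in characteristic $2$). $W=\mathsf{S}_{n/2}\wr\mathsf{S}_2$ is the stabilizer in $\mathsf{S}_n$ of the partition of $\{1,\dots,n\}$ into the two blocks $\{1,\dots,n/2\}$ and $\{n/2+1,\dots,n\}$. $\mathbf{1}_H$ is the trivial $\mathbb{F}H$-module and $\boxtimes$ is the outer tensor product. *)

theory Defs
  imports "HOL-Algebra.Sym_Groups" "HOL-Algebra.Algebraic_Closure_Type"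
begin

section \<open>Representations of groups over a field\<close>

text \<open>The coefficient field is a type \<open>'f :: field\<close>, viewed as a ring record. An \<open>FG\<close>-module is
  a module record over it together with an action map. The record fields \<^const>\<open>monoid.mult\<close> and
  \<^const>\<open>one\<close> that \<^typ>\<open>('a, 'b) module\<close> inherits from \<^typ>\<open>'b ring\<close> are irrelevant for
  \<^const>\<open>module\<close> and are left \<^const>\<open>undefined\<close> throughout.\<close>

abbreviation coeff_ring :: "'f::field ring"
  where "coeff_ring \<equiv> ring_of_type_algebra"

record ('f, 'v, 'g) fg_module = "('f, 'v) module" +
  act :: "'g \<Rightarrow> 'v \<Rightarrow> 'v"

locale rep = G?: group G + V?: module coeff_ring V
  for G :: "('g, 'x) monoid_scheme" (structure) and V :: "('f::field, 'v, 'g) fg_module" (structure) +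
  assumes act_closed: "g \<in> carrier G \<Longrightarrow> x \<in> carrier V \<Longrightarrow> act V g x \<in> carrier V"
    and act_add: "g \<in> carrier G \<Longrightarrow> x \<in> carrier V \<Longrightarrow> y \<in> carrier V \<Longrightarrow>
      act V g (x \<oplus>\<^bsub>V\<^esub> y) = act V g x \<oplus>\<^bsub>V\<^esub> act V g y"
    and act_smult: "g \<in> carrier G \<Longrightarrow> x \<in> carrier V \<Longrightarrow>
      act V g (c \<odot>\<^bsub>V\<^esub> x) = c \<odot>\<^bsub>V\<^esub> act V g x"
    and act_one: "x \<in> carrier V \<Longrightarrow> act V \<one>\<^bsub>G\<^esub> x = x"
    and act_mult: "g \<in> carrier G \<Longrightarrow> h \<in> carrier G \<Longrightarrow> x \<in> carrier V \<Longrightarrow>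
      act V (g \<otimes>\<^bsub>G\<^esub> h) x = act V g (act V h x)"

definition subrep :: "('g, 'x) monoid_scheme \<Rightarrow> 'v set \<Rightarrow> ('f::field, 'v, 'g) fg_module \<Rightarrow> bool"
  where "subrep G U V \<longleftrightarrow>
    submodule U coeff_ring V \<and> (\<forall>g\<in>carrier G. \<forall>x\<in>U. act V g x \<in> U)"

text \<open>The restriction of \<open>V\<close> to a subgroup \<open>H\<close> of \<open>G\<close> is \<open>V\<close> itself, considered over
  \<open>G\<lparr>carrier := H\<rparr>\<close>.\<close>

definition irreducible_rep :: "('g, 'x) monoid_scheme \<Rightarrow> ('f::field, 'v, 'g) fg_module \<Rightarrow> bool"
  where "irreducible_rep G V \<longleftrightarrow>
    rep G V \<and> carrier V \<noteq> {\<zero>\<^bsub>V\<^esub>} \<and>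
    (\<forall>U. subrep G U V \<longrightarrow> U = {\<zero>\<^bsub>V\<^esub>} \<or> U = carrier V)"

definition isomorphic_rep :: "('g, 'x) monoid_scheme \<Rightarrow>
    ('f::field, 'v, 'g) fg_module \<Rightarrow> ('f, 'w, 'g) fg_module \<Rightarrow> bool"
  where "isomorphic_rep G V W \<longleftrightarrow>
    (\<exists>\<phi>. \<phi> \<in> iso (add_monoid V) (add_monoid W) \<and>
      (\<forall>c. \<forall>x\<in>carrier V. \<phi> (c \<odot>\<^bsub>V\<^esub> x) = c \<odot>\<^bsub>W\<^esub> \<phi> x) \<and>
      (\<forall>g\<in>carrier G. \<forall>x\<in>carrier V. \<phi> (act V g x) = act W g (\<phi> x)))"

definition quot_rep :: "('f::field, 'v, 'g) fg_module \<Rightarrow> 'v set \<Rightarrow> ('f, 'v set, 'g) fg_module"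
  where "quot_rep V U =
    \<lparr>carrier = a_rcosets\<^bsub>V\<^esub> U, monoid.mult = undefined, one = undefined, ring.zero = U, add = set_add V,
     module.smult = (\<lambda>c A. \<Union>x\<in>A. U +>\<^bsub>V\<^esub> (c \<odot>\<^bsub>V\<^esub> x)),
     act = (\<lambda>g A. \<Union>x\<in>A. U +>\<^bsub>V\<^esub> act V g x)\<rparr>"

definition maximal_subrep :: "('g, 'x) monoid_scheme \<Rightarrow> 'v set \<Rightarrow> ('f::field, 'v, 'g) fg_module \<Rightarrow> bool"
  where "maximal_subrep G U V \<longleftrightarrow>
    subrep G U V \<and> U \<noteq> carrier V \<and>
    (\<forall>U'. subrep G U' V \<longrightarrow> U \<subseteq> U' \<longrightarrow> U' = U \<or> U' = carrier V)"

definition radical :: "('g, 'x) monoid_scheme \<Rightarrow> ('f::field, 'v, 'g) fg_module \<Rightarrow> 'v set"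
  where "radical G V = carrier V \<inter> \<Inter>{U. maximal_subrep G U V}"

definition head :: "('g, 'x) monoid_scheme \<Rightarrow> ('f::field, 'v, 'g) fg_module \<Rightarrow> ('f, 'v set, 'g) fg_module"
  where "head G V = quot_rep V (radical G V)"

definition trivial_rep :: "('f::field, 'f, 'g) fg_module"
  where "trivial_rep =
    \<lparr>carrier = UNIV, monoid.mult = undefined, one = undefined, ring.zero = 0, add = (+), module.smult = (*),
     act = (\<lambda>g x. x)\<rparr>"

text \<open>The permutation module on a set \<open>S\<close> with action \<open>a\<close>: the vector space with basis \<open>S\<close>, i.e. the
  finitely supported functions on \<open>S\<close>, where \<open>g\<close> maps the basis vector of \<open>x\<close> to that of \<open>a g x\<close>.\<close>

definition basis_vec :: "'x \<Rightarrow> 'x \<Rightarrow> 'f::field"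
  where "basis_vec x = (\<lambda>y. if y = x then 1 else 0)"

definition perm_rep :: "'x set \<Rightarrow> ('g \<Rightarrow> 'x \<Rightarrow> 'x) \<Rightarrow> ('f::field, 'x \<Rightarrow> 'f, 'g) fg_module"
  where "perm_rep S a =
    \<lparr>carrier = {f. finite {x. f x \<noteq> 0} \<and> {x. f x \<noteq> 0} \<subseteq> S}, monoid.mult = undefined, one = undefined,
     ring.zero = (\<lambda>x. 0), add = (\<lambda>f f' x. f x + f' x), module.smult = (\<lambda>c f x. c * f x),
     act = (\<lambda>g f y. \<Sum>x | f x \<noteq> 0 \<and> a g x = y. f x)\<rparr>"

definition lin_span :: "('f::field, 'v, 'g) fg_module \<Rightarrow> 'v set \<Rightarrow> 'v set"
  where "lin_span V A = (\<lambda>U. submodule U coeff_ring V) hull A"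

text \<open>The outer tensor product of an \<open>FG\<close>-module and an \<open>FH\<close>-module, a module for \<open>G \<times>\<times> H\<close>:
  the vector space with basis \<open>V \<times> W\<close> modulo the bilinearity relations.\<close>

definition bilinear_rels :: "('f::field, 'v, 'g) fg_module \<Rightarrow> ('f, 'w, 'h) fg_module \<Rightarrow> ('v \<times> 'w \<Rightarrow> 'f) set"
  where "bilinear_rels V W =
    {\<lambda>z. basis_vec (v \<oplus>\<^bsub>V\<^esub> v', w) z - basis_vec (v, w) z - basis_vec (v', w) z | v v' w.
      v \<in> carrier V \<and> v' \<in> carrier V \<and> w \<in> carrier W} \<union>
    {\<lambda>z. basis_vec (v, w \<oplus>\<^bsub>W\<^esub> w') z - basis_vec (v, w) z - basis_vec (v, w') z | v w w'.
      v \<in> carrier V \<and> w \<in> carrier W \<and> w' \<in> carrier W} \<union>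
    {\<lambda>z. basis_vec (c \<odot>\<^bsub>V\<^esub> v, w) z - c * basis_vec (v, w) z | c v w.
      v \<in> carrier V \<and> w \<in> carrier W} \<union>
    {\<lambda>z. basis_vec (v, c \<odot>\<^bsub>W\<^esub> w) z - c * basis_vec (v, w) z | c v w.
      v \<in> carrier V \<and> w \<in> carrier W}"

definition outer_tensor :: "('f::field, 'v, 'g) fg_module \<Rightarrow> ('f, 'w, 'h) fg_module \<Rightarrow>
    ('f, ('v \<times> 'w \<Rightarrow> 'f) set, 'g \<times> 'h) fg_module"  (infixr \<open>\<boxtimes>\<close> 75)
  where "V \<boxtimes> W =
    (let F = perm_rep (carrier V \<times> carrier W) (\<lambda>(g, h) (v, w). (act V g v, act W h w))
     in quot_rep F (lin_span F (bilinear_rels V W)))"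


section \<open>Specht modules and James' modules\<close>

text \<open>A partition of \<open>m\<close> is a weakly decreasing list of positive numbers with sum \<open>m\<close>. The letters
  are \<open>1, \<dots>, m\<close>; rows and columns of diagrams are numbered from \<open>0\<close>. A tableau only matters through
  its values on the diagram, and a tabloid is represented by the list of its rows as sets.
  James' \<open>D\<^sup>\<mu>\<close> is the head of the Specht module of \<open>\<mu>\<close>, a simple module if \<open>\<mu>\<close> is \<open>p\<close>-regular for
  \<open>p\<close> the characteristic of the coefficient field.\<close>

definition diagram :: "nat list \<Rightarrow> (nat \<times> nat) set"
  where "diagram \<mu> = {(i, j). i < length \<mu> \<and> j < \<mu> ! i}"

definition tableau :: "nat list \<Rightarrow> (nat \<times> nat \<Rightarrow> nat) \<Rightarrow> bool"
  where "tableau \<mu> t \<longleftrightarrow> bij_betw t (diagram \<mu>) {1..sum_list \<mu>}"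

definition tabloid :: "nat list \<Rightarrow> (nat \<times> nat \<Rightarrow> nat) \<Rightarrow> nat set list"
  where "tabloid \<mu> t = map (\<lambda>i. {t (i, j) | j. (i, j) \<in> diagram \<mu>}) [0..<length \<mu>]"

definition tabloid_module :: "nat list \<Rightarrow> ('f::field, nat set list \<Rightarrow> 'f, nat \<Rightarrow> nat) fg_module"
  where "tabloid_module \<mu> = perm_rep {tabloid \<mu> t | t. tableau \<mu> t} (\<lambda>\<sigma>. map ((`) \<sigma>))"

definition column_stabilizer :: "nat list \<Rightarrow> (nat \<times> nat \<Rightarrow> nat) \<Rightarrow> (nat \<Rightarrow> nat) set"
  where "column_stabilizer \<mu> t =
    {\<pi>. \<pi> permutes {1..sum_list \<mu>} \<and>
        (\<forall>j. \<pi> ` {t (i, j) | i. (i, j) \<in> diagram \<mu>} = {t (i, j) | i. (i, j) \<in> diagram \<mu>})}"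

definition polytabloid :: "nat list \<Rightarrow> (nat \<times> nat \<Rightarrow> nat) \<Rightarrow> nat set list \<Rightarrow> 'f::field"
  where "polytabloid \<mu> t =
    (\<lambda>T. \<Sum>\<pi>\<in>column_stabilizer \<mu> t. of_int (sign \<pi>) * basis_vec (tabloid \<mu> (\<pi> \<circ> t)) T)"

definition specht :: "nat list \<Rightarrow> ('f::field, nat set list \<Rightarrow> 'f, nat \<Rightarrow> nat) fg_module"
  where "specht \<mu> = (tabloid_module \<mu>)
    \<lparr>carrier := lin_span (tabloid_module \<mu> :: ('f, _, nat \<Rightarrow> nat) fg_module)
                  {polytabloid \<mu> t | t. tableau \<mu> t}\<rparr>"

definition james_D :: "nat list \<Rightarrow> ('f::field, (nat set list \<Rightarrow> 'f) set, nat \<Rightarrow> nat) fg_module"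
  where "james_D \<mu> = head (sym_group (sum_list \<mu>)) (specht \<mu>)"


section \<open>Permutation groups and the imprimitive wreath product\<close>

definition transitive_on :: "(nat \<Rightarrow> nat) set \<Rightarrow> nat set \<Rightarrow> bool"
  where "transitive_on H \<Omega> \<longleftrightarrow> (\<forall>x\<in>\<Omega>. \<forall>y\<in>\<Omega>. \<exists>h\<in>H. h x = y)"

definition two_transitive_on :: "(nat \<Rightarrow> nat) set \<Rightarrow> nat set \<Rightarrow> bool"
  where "two_transitive_on H \<Omega> \<longleftrightarrow>
    (\<forall>x\<in>\<Omega>. \<forall>x'\<in>\<Omega>. \<forall>y\<in>\<Omega>. \<forall>y'\<in>\<Omega>. x \<noteq> x' \<longrightarrow> y \<noteq> y' \<longrightarrow> (\<exists>h\<in>H. h x = y \<and> h x' = y'))"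

text \<open>The wreath product of the symmetric groups of degrees \<open>m\<close> and \<open>2\<close>, as the stabilizer in the
  symmetric group of degree \<open>2 * m\<close> of the partition into the blocks \<open>{1..m}\<close> and \<open>{m+1..2*m}\<close>.\<close>

definition wreath_S2 :: "nat \<Rightarrow> (nat \<Rightarrow> nat) set"
  where "wreath_S2 m =
    {p \<in> carrier (sym_group (2 * m)). (`) p ` {{1..m}, {m+1..2*m}} = {{1..m}, {m+1..2*m}}}"

definition base_subgroup :: "nat \<Rightarrow> (nat \<Rightarrow> nat) set"
  where "base_subgroup m =
    {p \<in> carrier (sym_group (2 * m)). p ` {1..m} = {1..m} \<and> p ` {m+1..2*m} = {m+1..2*m}}"

text \<open>The isomorphism from the base subgroup onto the direct product of two symmetric groups of
  degree \<open>m\<close>; a letter \<open>m + i\<close> of the second block is identified with \<open>i\<close>.\<close>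

definition base_factors :: "nat \<Rightarrow> (nat \<Rightarrow> nat) \<Rightarrow> (nat \<Rightarrow> nat) \<times> (nat \<Rightarrow> nat)"
  where "base_factors m p =
    (\<lambda>i. if i \<in> {1..m} then p i else i, \<lambda>i. if i \<in> {1..m} then p (m + i) - m else i)"

end

theory Submission
  imports Defs "HOL-Library.Function_Algebras"
begin

text \<open>
  Write \<open>n = 2m\<close> with \<open>m\<close> odd. Over \<open>W\<close> the module \<open>D\<^bsup>(n-1,1)\<^esup>\<close> is the space \<open>E\<close> of functions whose sums
  over both blocks vanish: since \<open>m\<close> is odd, subtracting a constant function makes both block sums of
  a zero-sum function zero. Over the base group \<open>E\<close> is the direct sum of the zero-sum functions on
  the two blocks, and each summand is \<open>D\<^bsup>(m-1,1)\<^esup>\<close> of the corresponding factor. If a swap of the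
  blocks exists and the summands are simple and non-isomorphic over \<open>G \<inter> B\<close>, then they are the only
  proper nonzero submodules over \<open>G \<inter> B\<close>, and neither is invariant under the swap. Conversely, the
  submodule induced from a submodule of one block shows that the blocks are simple, and an
  isomorphism between them could be rescaled, by Schur's lemma and a square root, so that its
  graph becomes \<open>G\<close>-invariant. Simplicity of the zero-sum module forces 2-transitivity because the
  adjacency operator of an orbital acts on it as a scalar.
\<close>

section \<open>Transport of modules along linear bijections\<close>

text \<open>Every \<open>james_D\<close> is a quotient of a space of functions on tabloids, and the
  statement involves several groups: \<open>G\<close>, the two projections of its base part, and
  their joint image in a direct product. All modules are therefore carried to spaces of functions on
  letters, where irreducibility depends only on the set of operators. The radical of the Specht
  module of shape (k, 1) consists of the zero-sum functions that are constant on the letters. It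
  vanishes when k + 1 = m is odd, and for n = 2m it is exactly what must be divided out to reach
  \<open>E\<close>. Characteristic 2 makes the two block sums of a zero-sum function agree, so that
  one constant corrects both blocks, and m is 1 in the field, so that this constant is the block sum
  itself. Transitivity of a projection has to precede 2-transitivity: it makes the column sums of
  the adjacency matrix of an orbital equal, and this is how the operator is seen to preserve the
  zero-sum space. A swap of the blocks may fail to be an involution; what is available is that its
  square preserves both blocks.\<close>

lemma coeff_ring_simps [simp]:
  "carrier (coeff_ring :: 'f::field ring) = UNIV"
  "x \<otimes>\<^bsub>(coeff_ring :: 'f ring)\<^esub> y = x * y"
  "x \<oplus>\<^bsub>(coeff_ring :: 'f ring)\<^esub> y = x + y"
  "\<one>\<^bsub>(coeff_ring :: 'f ring)\<^esub> = 1"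
  "\<zero>\<^bsub>(coeff_ring :: 'f ring)\<^esub> = 0"
  by (simp_all add: ring_of_type_algebra_def)

text \<open>\<open>submodule\<close> also asks for additive inverses; these are the multiples by
  -1.\<close>

lemma submodule_iff:
  fixes V :: "('f::field, 'v, 'z) module_scheme"
  assumes "module coeff_ring V"
  shows "submodule U coeff_ring V \<longleftrightarrow> U \<subseteq> carrier V \<and> \<zero>\<^bsub>V\<^esub> \<in> U \<and>
    (\<forall>x\<in>U. \<forall>y\<in>U. x \<oplus>\<^bsub>V\<^esub> y \<in> U) \<and> (\<forall>c. \<forall>x\<in>U. c \<odot>\<^bsub>V\<^esub> x \<in> U)"
proof -
  interpret module coeff_ring V by fact
  show ?thesis
  proof (intro iffI conjI ballI allI)
    assume U: "submodule U coeff_ring V"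
    interpret U: submodule U coeff_ring V by fact
    show "U \<subseteq> carrier V" using U.subset by simp
    show "\<zero>\<^bsub>V\<^esub> \<in> U" using U.one_closed by simp
    show "x \<oplus>\<^bsub>V\<^esub> y \<in> U" if "x \<in> U" "y \<in> U" for x y using U.m_closed[OF that] by simp
    show "c \<odot>\<^bsub>V\<^esub> x \<in> U" if "x \<in> U" for c x using that by simp
  next
    assume U: "U \<subseteq> carrier V \<and> \<zero>\<^bsub>V\<^esub> \<in> U \<and>
      (\<forall>x\<in>U. \<forall>y\<in>U. x \<oplus>\<^bsub>V\<^esub> y \<in> U) \<and> (\<forall>c. \<forall>x\<in>U. c \<odot>\<^bsub>V\<^esub> x \<in> U)"
    have "\<ominus>\<^bsub>V\<^esub> x \<in> U" if "x \<in> U" for x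
    proof -
      have x: "x \<in> carrier V" using that U by auto
      have "(\<ominus>\<^bsub>coeff_ring\<^esub> (1::'f)) \<odot>\<^bsub>V\<^esub> x = \<ominus>\<^bsub>V\<^esub> x"
        using smult_l_minus[of 1 x] smult_one[of x] x by simp
      then show ?thesis using U that by metis
    qed
    with U show "submodule U coeff_ring V" by (intro submoduleI) auto
  qed
qed

lemma linear_map_zero:
  fixes V :: "('f::field, 'v, 'y) module_scheme" and W :: "('f, 'w, 'z) module_scheme"
  assumes "module coeff_ring V" "module coeff_ring W"
    and "\<And>x. x \<in> carrier V \<Longrightarrow> \<phi> x \<in> carrier W"
    and "\<And>c x. x \<in> carrier V \<Longrightarrow> \<phi> (c \<odot>\<^bsub>V\<^esub> x) = c \<odot>\<^bsub>W\<^esub> \<phi> x"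
  shows "\<phi> \<zero>\<^bsub>V\<^esub> = \<zero>\<^bsub>W\<^esub>"
proof -
  interpret V: module coeff_ring V by fact
  interpret W: module coeff_ring W by fact
  have "\<phi> (0 \<odot>\<^bsub>V\<^esub> \<zero>\<^bsub>V\<^esub>) = 0 \<odot>\<^bsub>W\<^esub> \<phi> \<zero>\<^bsub>V\<^esub>" using assms(4) V.zero_closed by blast
  then show ?thesis using V.smult_l_null[of "\<zero>\<^bsub>V\<^esub>"] W.smult_l_null[of "\<phi> \<zero>\<^bsub>V\<^esub>"] assms(3) by simp
qed

text \<open>Kept free of the action, so that the two modules may belong to different groups.\<close>

definition linear_bij :: "('f::field, 'v, 'g) fg_module \<Rightarrow> ('f, 'w, 'h) fg_module \<Rightarrow> ('v \<Rightarrow> 'w) \<Rightarrow> bool"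
  where "linear_bij V W \<phi> \<longleftrightarrow> bij_betw \<phi> (carrier V) (carrier W) \<and>
    (\<forall>x\<in>carrier V. \<forall>y\<in>carrier V. \<phi> (x \<oplus>\<^bsub>V\<^esub> y) = \<phi> x \<oplus>\<^bsub>W\<^esub> \<phi> y) \<and>
    (\<forall>c. \<forall>x\<in>carrier V. \<phi> (c \<odot>\<^bsub>V\<^esub> x) = c \<odot>\<^bsub>W\<^esub> \<phi> x)"

lemma linear_bijD:
  assumes "linear_bij V W \<phi>"
  shows "bij_betw \<phi> (carrier V) (carrier W)"
    and "x \<in> carrier V \<Longrightarrow> y \<in> carrier V \<Longrightarrow> \<phi> (x \<oplus>\<^bsub>V\<^esub> y) = \<phi> x \<oplus>\<^bsub>W\<^esub> \<phi> y"
    and "x \<in> carrier V \<Longrightarrow> \<phi> (c \<odot>\<^bsub>V\<^esub> x) = c \<odot>\<^bsub>W\<^esub> \<phi> x"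
    and "x \<in> carrier V \<Longrightarrow> \<phi> x \<in> carrier W"
    and "\<phi> x = \<phi> y \<Longrightarrow> x \<in> carrier V \<Longrightarrow> y \<in> carrier V \<Longrightarrow> x = y"
  using assms by (auto simp: linear_bij_def bij_betw_def inj_on_def)

lemma linear_bij_inv:
  assumes \<phi>: "linear_bij V W \<phi>"
    and add: "\<And>x y. x \<in> carrier V \<Longrightarrow> y \<in> carrier V \<Longrightarrow> x \<oplus>\<^bsub>V\<^esub> y \<in> carrier V"
    and smult: "\<And>c x. x \<in> carrier V \<Longrightarrow> c \<odot>\<^bsub>V\<^esub> x \<in> carrier V"
  obtains \<psi> where "linear_bij W V \<psi>" "\<And>x. x \<in> carrier V \<Longrightarrow> \<psi> (\<phi> x) = x" "\<And>y. y \<in> carrier W \<Longrightarrow> \<phi> (\<psi> y) = y"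
proof
  define \<psi> where "\<psi> = inv_into (carrier V) \<phi>"
  show left: "\<psi> (\<phi> x) = x" if "x \<in> carrier V" for x
    using linear_bijD(1)[OF \<phi>] that unfolding \<psi>_def bij_betw_def by simp
  show right: "\<phi> (\<psi> y) = y" if "y \<in> carrier W" for y
    using linear_bijD(1)[OF \<phi>] that unfolding \<psi>_def bij_betw_def by (auto intro: f_inv_into_f)
  have bij: "bij_betw \<psi> (carrier W) (carrier V)"
    unfolding \<psi>_def by (rule bij_betw_inv_into[OF linear_bijD(1)[OF \<phi>]])
  then have im: "\<psi> y \<in> carrier V" if "y \<in> carrier W" for y using that by (auto simp: bij_betw_def)
  show "linear_bij W V \<psi>"
    unfolding linear_bij_def
  proof (intro conjI bij ballI allI)
    show "\<psi> (x \<oplus>\<^bsub>W\<^esub> y) = \<psi> x \<oplus>\<^bsub>V\<^esub> \<psi> y" if "x \<in> carrier W" "y \<in> carrier W" for x y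
      using left[OF add[OF im im], OF that] linear_bijD(2)[OF \<phi> im im, OF that] right that by simp
    show "\<psi> (c \<odot>\<^bsub>W\<^esub> x) = c \<odot>\<^bsub>V\<^esub> \<psi> x" if "x \<in> carrier W" for c x
      using left[OF smult[OF im[OF that]], of c] linear_bijD(3)[OF \<phi> im[OF that], of c] right that by simp
  qed
qed

text \<open>The groups of the two modules may differ: only the sets of operators have to correspond.\<close>

lemma irreducible_rep_image:
  fixes V :: "('f::field, 'v, 'g) fg_module" and W :: "('f, 'w, 'h) fg_module"
  assumes V: "irreducible_rep G V" and W: "rep H W" and \<phi>: "linear_bij V W \<phi>"
    and act: "\<And>g. g \<in> carrier G \<Longrightarrow> \<exists>h\<in>carrier H. \<forall>x\<in>carrier V. \<phi> (act V g x) = act W h (\<phi> x)"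
  shows "irreducible_rep H W"
proof -
  note bij = linear_bijD(1)[OF \<phi>] and add = linear_bijD(2)[OF \<phi>] and smult = linear_bijD(3)[OF \<phi>]
    and im = linear_bijD(4)[OF \<phi>]
  interpret V: rep G V using V by (simp add: irreducible_rep_def)
  interpret W: rep H W by fact
  have zero: "\<phi> \<zero>\<^bsub>V\<^esub> = \<zero>\<^bsub>W\<^esub>"
    using linear_map_zero[OF V.module_axioms W.module_axioms] im smult by blast
  have ne: "carrier W \<noteq> {\<zero>\<^bsub>W\<^esub>}"
  proof
    assume "carrier W = {\<zero>\<^bsub>W\<^esub>}"
    then have "\<phi> ` carrier V = \<phi> ` {\<zero>\<^bsub>V\<^esub>}" using bij zero by (simp add: bij_betw_def)
    then have "carrier V = {\<zero>\<^bsub>V\<^esub>}"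
      using bij V.M.zero_closed by (subst (asm) inj_on_image_eq_iff[of \<phi> "carrier V"]) (auto simp: bij_betw_def)
    then show False using V by (simp add: irreducible_rep_def)
  qed
  have "U = {\<zero>\<^bsub>W\<^esub>} \<or> U = carrier W" if U: "subrep H U W" for U
  proof -
    \<comment> \<open>The preimage of \<open>U\<close> is stable because each \<open>g\<close> acts
      on \<open>V\<close> in the way some \<open>h\<close> acts on \<open>W\<close>.\<close>
    define U' where "U' = {x \<in> carrier V. \<phi> x \<in> U}"
    have U1: "U \<subseteq> carrier W" "\<zero>\<^bsub>W\<^esub> \<in> U" "\<And>x y. x \<in> U \<Longrightarrow> y \<in> U \<Longrightarrow> x \<oplus>\<^bsub>W\<^esub> y \<in> U"
      "\<And>c x. x \<in> U \<Longrightarrow> c \<odot>\<^bsub>W\<^esub> x \<in> U" "\<And>h x. h \<in> carrier H \<Longrightarrow> x \<in> U \<Longrightarrow> act W h x \<in> U"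
      using U unfolding subrep_def submodule_iff[OF W.module_axioms] by auto
    have "act V g x \<in> U'" if g: "g \<in> carrier G" and "x \<in> U'" for g x
    proof -
      have x: "x \<in> carrier V" "\<phi> x \<in> U" using that(2) by (auto simp: U'_def)
      obtain h where h: "h \<in> carrier H" "\<forall>x\<in>carrier V. \<phi> (act V g x) = act W h (\<phi> x)"
        by (rule bexE[OF act[OF g]])
      have "\<phi> (act V g x) \<in> U" using h x U1(5)[OF h(1) x(2)] by simp
      then show ?thesis using V.act_closed[OF g x(1)] by (simp add: U'_def)
    qed
    then have "subrep G U' V"
      unfolding subrep_def submodule_iff[OF V.module_axioms]
      using U1(2,3,4) zero add smult by (auto simp: U'_def)
    then have "U' = {\<zero>\<^bsub>V\<^esub>} \<or> U' = carrier V" using V by (simp add: irreducible_rep_def)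
    moreover have "\<phi> ` U' = U"
    proof
      show "\<phi> ` U' \<subseteq> U" by (auto simp: U'_def)
      show "U \<subseteq> \<phi> ` U'"
      proof
        fix y assume y: "y \<in> U"
        then have "y \<in> \<phi> ` carrier V" using U1(1) bij by (auto simp: bij_betw_def)
        then obtain x where "x \<in> carrier V" "y = \<phi> x" by (elim imageE)
        then show "y \<in> \<phi> ` U'" using y by (simp add: U'_def)
      qed
    qed
    moreover have "\<phi> ` carrier V = carrier W" using bij by (simp add: bij_betw_def)
    ultimately show ?thesis using zero by auto
  qed
  then show ?thesis using W ne by (simp add: irreducible_rep_def)
qed

lemma irreducible_rep_cong:
  fixes V :: "('f::field, 'v, 'g) fg_module" and W :: "('f, 'w, 'h) fg_module"
  assumes V: "rep G V" and W: "rep H W" and \<phi>: "linear_bij V W \<phi>"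
    and act: "\<And>g. g \<in> carrier G \<Longrightarrow> \<exists>h\<in>carrier H. \<forall>x\<in>carrier V. \<phi> (act V g x) = act W h (\<phi> x)"
    and act': "\<And>h. h \<in> carrier H \<Longrightarrow> \<exists>g\<in>carrier G. \<forall>x\<in>carrier V. \<phi> (act V g x) = act W h (\<phi> x)"
  shows "irreducible_rep G V \<longleftrightarrow> irreducible_rep H W"
proof
  assume "irreducible_rep G V"
  then show "irreducible_rep H W" using irreducible_rep_image[OF _ W \<phi> act] by blast
next
  interpret V: rep G V by fact
  obtain \<psi> where \<psi>: "linear_bij W V \<psi>" "\<And>x. x \<in> carrier V \<Longrightarrow> \<psi> (\<phi> x) = x" "\<And>y. y \<in> carrier W \<Longrightarrow> \<phi> (\<psi> y) = y"
    by (rule linear_bij_inv[OF \<phi> V.M.add.m_closed V.smult_closed]) auto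
  assume "irreducible_rep H W"
  then show "irreducible_rep G V"
  proof (rule irreducible_rep_image[OF _ V \<psi>(1)])
    fix h assume h: "h \<in> carrier H"
    obtain g where g: "g \<in> carrier G" "\<forall>x\<in>carrier V. \<phi> (act V g x) = act W h (\<phi> x)"
      by (rule bexE[OF act'[OF h]])
    have "\<psi> (act W h x) = act V g (\<psi> x)" if "x \<in> carrier W" for x
    proof -
      have x: "\<psi> x \<in> carrier V" by (rule linear_bijD(4)[OF \<psi>(1) that])
      show ?thesis using bspec[OF g(2) x] \<psi>(3)[OF that] \<psi>(2)[OF V.act_closed[OF g(1) x]] by simp
    qed
    then show "\<exists>g\<in>carrier G. \<forall>x\<in>carrier W. \<psi> (act W h x) = act V g (\<psi> x)"
      by (intro bexI[OF _ g(1)] ballI)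
  qed
qed

lemma isomorphic_repI:
  assumes "linear_bij V W \<phi>"
    and "\<And>g x. g \<in> carrier G \<Longrightarrow> x \<in> carrier V \<Longrightarrow> \<phi> (act V g x) = act W g (\<phi> x)"
  shows "isomorphic_rep G V W"
  unfolding isomorphic_rep_def
  by (rule exI[of _ \<phi>]) (use assms in \<open>auto simp: linear_bij_def iso_def hom_def bij_betw_def\<close>)

lemma isomorphic_repE:
  assumes "isomorphic_rep G V W"
  obtains \<phi> where "linear_bij V W \<phi>"
    and "\<And>g x. g \<in> carrier G \<Longrightarrow> x \<in> carrier V \<Longrightarrow> \<phi> (act V g x) = act W g (\<phi> x)"
  using assms unfolding isomorphic_rep_def iso_def hom_def linear_bij_def by auto

lemma isomorphic_rep_trans:
  assumes "isomorphic_rep G U V" "isomorphic_rep G V W"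
  shows "isomorphic_rep G U W"
proof -
  obtain \<phi> where \<phi>: "linear_bij U V \<phi>"
    "\<And>g x. g \<in> carrier G \<Longrightarrow> x \<in> carrier U \<Longrightarrow> \<phi> (act U g x) = act V g (\<phi> x)"
    using assms(1) by (rule isomorphic_repE) blast
  obtain \<psi> where \<psi>: "linear_bij V W \<psi>"
    "\<And>g x. g \<in> carrier G \<Longrightarrow> x \<in> carrier V \<Longrightarrow> \<psi> (act V g x) = act W g (\<psi> x)"
    using assms(2) by (rule isomorphic_repE) blast
  have "linear_bij U W (\<psi> \<circ> \<phi>)"
    using bij_betw_trans[OF linear_bijD(1)[OF \<phi>(1)] linear_bijD(1)[OF \<psi>(1)]]
      linear_bijD(2-4)[OF \<phi>(1)] linear_bijD(2-4)[OF \<psi>(1)] by (simp add: linear_bij_def)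
  then show ?thesis
    by (rule isomorphic_repI) (simp add: \<phi>(2) \<psi>(2) linear_bijD(4)[OF \<phi>(1)])
qed

text \<open>What it takes to invert an isomorphism. The tensor products below are shown to satisfy
  these closure conditions and nothing more, and that suffices for comparing them up to
  isomorphism.\<close>

definition closed_rep :: "('g, 'x) monoid_scheme \<Rightarrow> ('f::field, 'v, 'g) fg_module \<Rightarrow> bool"
  where "closed_rep G V \<longleftrightarrow> \<zero>\<^bsub>V\<^esub> \<in> carrier V \<and>
    (\<forall>x\<in>carrier V. \<forall>y\<in>carrier V. x \<oplus>\<^bsub>V\<^esub> y \<in> carrier V) \<and>
    (\<forall>c. \<forall>x\<in>carrier V. c \<odot>\<^bsub>V\<^esub> x \<in> carrier V) \<and>
    (\<forall>g\<in>carrier G. \<forall>x\<in>carrier V. act V g x \<in> carrier V)"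

lemma isomorphic_rep_sym:
  assumes V: "closed_rep G V" and iso: "isomorphic_rep G V W"
  shows "isomorphic_rep G W V"
proof -
  obtain \<phi> where \<phi>: "linear_bij V W \<phi>"
    and act: "\<And>g x. g \<in> carrier G \<Longrightarrow> x \<in> carrier V \<Longrightarrow> \<phi> (act V g x) = act W g (\<phi> x)"
    using iso by (rule isomorphic_repE) blast
  obtain \<psi> where \<psi>: "linear_bij W V \<psi>" "\<And>x. x \<in> carrier V \<Longrightarrow> \<psi> (\<phi> x) = x" "\<And>y. y \<in> carrier W \<Longrightarrow> \<phi> (\<psi> y) = y"
    using V by (auto simp: closed_rep_def intro: linear_bij_inv[OF \<phi>])
  show ?thesis
  proof (rule isomorphic_repI[OF \<psi>(1)])
    fix g x assume "g \<in> carrier G" "x \<in> carrier W"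
    then show "\<psi> (act W g x) = act V g (\<psi> x)"
      using act[of g "\<psi> x"] \<psi>(2)[of "act V g (\<psi> x)"] \<psi>(3)[of x] linear_bijD(4)[OF \<psi>(1), of x] V
      by (simp add: closed_rep_def)
  qed
qed

text \<open>Module axioms are equations or ask for inverses, so an injective map that respects all
  operations pulls them back from \<open>W\<close>. Assumption \<open>z2\<close> puts the zero of
  \<open>V\<close> over the zero of \<open>W\<close>: its image is idempotent under
  addition.\<close>

lemma rep_pullback:
  fixes V :: "('f::field, 'v, 'g) fg_module" and W :: "('f, 'w, 'g) fg_module"
  assumes V: "closed_rep G V" and z2: "\<zero>\<^bsub>V\<^esub> \<oplus>\<^bsub>V\<^esub> \<zero>\<^bsub>V\<^esub> = \<zero>\<^bsub>V\<^esub>"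
    and W: "rep G W" and iso: "isomorphic_rep G V W"
  shows "rep G V"
proof -
  interpret W: rep G W by fact
  obtain \<phi> where \<phi>: "linear_bij V W \<phi>"
    and act: "\<And>g x. g \<in> carrier G \<Longrightarrow> x \<in> carrier V \<Longrightarrow> \<phi> (act V g x) = act W g (\<phi> x)"
    using iso by (rule isomorphic_repE) blast
  note bij = linear_bijD(1)[OF \<phi>] and add = linear_bijD(2)[OF \<phi>] and smult = linear_bijD(3)[OF \<phi>]
    and im = linear_bijD(4)[OF \<phi>] and eqI = linear_bijD(5)[OF \<phi>]
  have cl: "\<zero>\<^bsub>V\<^esub> \<in> carrier V" "\<And>x y. x \<in> carrier V \<Longrightarrow> y \<in> carrier V \<Longrightarrow> x \<oplus>\<^bsub>V\<^esub> y \<in> carrier V"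
    "\<And>c x. x \<in> carrier V \<Longrightarrow> c \<odot>\<^bsub>V\<^esub> x \<in> carrier V"
    "\<And>g x. g \<in> carrier G \<Longrightarrow> x \<in> carrier V \<Longrightarrow> act V g x \<in> carrier V"
    using V unfolding closed_rep_def by auto
  have zero: "\<phi> \<zero>\<^bsub>V\<^esub> = \<zero>\<^bsub>W\<^esub>"
    using add[of "\<zero>\<^bsub>V\<^esub>" "\<zero>\<^bsub>V\<^esub>"] z2 cl(1) im W.M.add.r_cancel_one' by metis
  show ?thesis
  proof (intro rep.intro rep_axioms.intro W.is_group moduleI abelian_groupI)
    show "cring (coeff_ring :: 'f ring)" by blast
    fix x assume x: "x \<in> carrier V"
    show "\<zero>\<^bsub>V\<^esub> \<oplus>\<^bsub>V\<^esub> x = x"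
      by (rule eqI) (use x cl add zero im in auto)
    obtain y where y: "y \<in> carrier V" "\<phi> y = \<ominus>\<^bsub>W\<^esub> \<phi> x"
      using bij W.M.a_inv_closed[OF im[OF x]] unfolding bij_betw_def by (metis imageE)
    show "\<exists>y\<in>carrier V. y \<oplus>\<^bsub>V\<^esub> x = \<zero>\<^bsub>V\<^esub>"
      by (rule bexI[OF _ y(1)], rule eqI) (use x y cl add zero im W.M.l_neg in auto)
    show "\<one>\<^bsub>coeff_ring\<^esub> \<odot>\<^bsub>V\<^esub> x = x"
      by (rule eqI) (use x cl smult im W.smult_one in auto)
    show "act V \<one>\<^bsub>G\<^esub> x = x"
      by (rule eqI) (use x cl act im W.act_one in auto)
    show "act V (g \<otimes>\<^bsub>G\<^esub> h) x = act V g (act V h x)" if "g \<in> carrier G" "h \<in> carrier G" for g h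
      by (rule eqI) (use x that cl act im W.act_mult in auto)
    show "act V g (c \<odot>\<^bsub>V\<^esub> x) = c \<odot>\<^bsub>V\<^esub> act V g x" if "g \<in> carrier G" for g c
      by (rule eqI) (use x that cl act smult im W.act_smult in auto)
    show "(a \<oplus>\<^bsub>coeff_ring\<^esub> b) \<odot>\<^bsub>V\<^esub> x = a \<odot>\<^bsub>V\<^esub> x \<oplus>\<^bsub>V\<^esub> b \<odot>\<^bsub>V\<^esub> x" for a b
      using W.smult_l_distr[of a b "\<phi> x"]
      by (intro eqI) (use x cl add smult im in auto)
    show "(a \<otimes>\<^bsub>coeff_ring\<^esub> b) \<odot>\<^bsub>V\<^esub> x = a \<odot>\<^bsub>V\<^esub> (b \<odot>\<^bsub>V\<^esub> x)" for a b
      using W.smult_assoc1[of a b "\<phi> x"]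
      by (intro eqI) (use x cl smult im in auto)
    fix y assume y: "y \<in> carrier V"
    show "x \<oplus>\<^bsub>V\<^esub> y = y \<oplus>\<^bsub>V\<^esub> x"
      by (rule eqI) (use x y cl add im W.M.a_comm in auto)
    show "a \<odot>\<^bsub>V\<^esub> (x \<oplus>\<^bsub>V\<^esub> y) = a \<odot>\<^bsub>V\<^esub> x \<oplus>\<^bsub>V\<^esub> a \<odot>\<^bsub>V\<^esub> y" for a
      by (rule eqI) (use x y cl add smult im W.smult_r_distr in auto)
    show "act V g (x \<oplus>\<^bsub>V\<^esub> y) = act V g x \<oplus>\<^bsub>V\<^esub> act V g y" if "g \<in> carrier G" for g
      by (rule eqI) (use x y that cl add act im W.act_add in auto)
    fix z assume z: "z \<in> carrier V"
    show "x \<oplus>\<^bsub>V\<^esub> y \<oplus>\<^bsub>V\<^esub> z = x \<oplus>\<^bsub>V\<^esub> (y \<oplus>\<^bsub>V\<^esub> z)"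
      by (rule eqI) (use x y z cl add im W.M.a_assoc in auto)
  qed (use cl in auto)
qed

text \<open>The first isomorphism theorem. Cosets of \<open>U\<close> are the fibres of
  \<open>\<theta>\<close>, so the unions in \<open>quot_rep\<close> collapse to a single coset and
  every operation can be computed on representatives. The first two conclusions are the hypotheses
  under which \<open>rep_pullback\<close> applies to the quotient.\<close>

lemma quot_rep_cong:
  fixes V :: "('f::field, 'v, 'g) fg_module" and W :: "('f, 'w, 'g) fg_module"
  assumes V: "module coeff_ring V" and W: "module coeff_ring W"
    and surj: "\<theta> ` carrier V = carrier W"
    and add: "\<And>x y. x \<in> carrier V \<Longrightarrow> y \<in> carrier V \<Longrightarrow> \<theta> (x \<oplus>\<^bsub>V\<^esub> y) = \<theta> x \<oplus>\<^bsub>W\<^esub> \<theta> y"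
    and smult: "\<And>c x. x \<in> carrier V \<Longrightarrow> \<theta> (c \<odot>\<^bsub>V\<^esub> x) = c \<odot>\<^bsub>W\<^esub> \<theta> x"
    and closed: "\<And>g x. g \<in> carrier G \<Longrightarrow> x \<in> carrier V \<Longrightarrow> act V g x \<in> carrier V"
    and act: "\<And>g x. g \<in> carrier G \<Longrightarrow> x \<in> carrier V \<Longrightarrow> \<theta> (act V g x) = act W g (\<theta> x)"
    and U: "U = {x \<in> carrier V. \<theta> x = \<zero>\<^bsub>W\<^esub>}"
  shows "closed_rep G (quot_rep V U)" (is ?closed)
    and "\<zero>\<^bsub>quot_rep V U\<^esub> \<oplus>\<^bsub>quot_rep V U\<^esub> \<zero>\<^bsub>quot_rep V U\<^esub> = \<zero>\<^bsub>quot_rep V U\<^esub>" (is ?zero)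
    and "isomorphic_rep G (quot_rep V U) W" (is ?iso)
proof -
  interpret V: module coeff_ring V by fact
  interpret W: module coeff_ring W by fact
  have im: "\<theta> x \<in> carrier W" if "x \<in> carrier V" for x using surj that by auto
  have zero: "\<theta> \<zero>\<^bsub>V\<^esub> = \<zero>\<^bsub>W\<^esub>" using linear_map_zero[OF V W im smult] by blast
  have diff: "\<theta> (y \<oplus>\<^bsub>V\<^esub> \<ominus>\<^bsub>V\<^esub> x) = \<zero>\<^bsub>W\<^esub> \<longleftrightarrow> \<theta> y = \<theta> x" if xy: "x \<in> carrier V" "y \<in> carrier V" for x y
  proof -
    have "\<theta> (y \<oplus>\<^bsub>V\<^esub> \<ominus>\<^bsub>V\<^esub> x) \<oplus>\<^bsub>W\<^esub> \<theta> x = \<theta> y"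
      using add[of "y \<oplus>\<^bsub>V\<^esub> \<ominus>\<^bsub>V\<^esub> x" x] xy by (simp add: V.M.a_assoc V.M.l_neg)
    moreover have "\<theta> (y \<oplus>\<^bsub>V\<^esub> \<ominus>\<^bsub>V\<^esub> x) \<in> carrier W" using xy im by simp
    ultimately show ?thesis using xy im W.M.add.r_cancel_one' W.M.l_zero by metis
  qed
  have coset: "U +>\<^bsub>V\<^esub> x = {y \<in> carrier V. \<theta> y = \<theta> x}" if x: "x \<in> carrier V" for x
  proof -
    have "y \<in> (\<lambda>u. u \<oplus>\<^bsub>V\<^esub> x) ` U" if y: "y \<in> carrier V" "\<theta> y = \<theta> x" for y
    proof (rule image_eqI[of _ _ "y \<oplus>\<^bsub>V\<^esub> \<ominus>\<^bsub>V\<^esub> x"])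
      show "y = y \<oplus>\<^bsub>V\<^esub> \<ominus>\<^bsub>V\<^esub> x \<oplus>\<^bsub>V\<^esub> x" using x y by (simp add: V.M.a_assoc V.M.l_neg)
      show "y \<oplus>\<^bsub>V\<^esub> \<ominus>\<^bsub>V\<^esub> x \<in> U" using x y diff U by auto
    qed
    then show ?thesis using x add im U unfolding a_r_coset_def' by auto
  qed
  have carr: "carrier (quot_rep V U) = (\<lambda>x. U +>\<^bsub>V\<^esub> x) ` carrier V"
    by (auto simp: quot_rep_def A_RCOSETS_def')
  have qzero: "\<zero>\<^bsub>quot_rep V U\<^esub> = U +>\<^bsub>V\<^esub> \<zero>\<^bsub>V\<^esub>"
    using coset[of "\<zero>\<^bsub>V\<^esub>"] zero U by (auto simp: quot_rep_def)
  have qadd: "(U +>\<^bsub>V\<^esub> x) \<oplus>\<^bsub>quot_rep V U\<^esub> (U +>\<^bsub>V\<^esub> y) = U +>\<^bsub>V\<^esub> (x \<oplus>\<^bsub>V\<^esub> y)"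
    if xy: "x \<in> carrier V" "y \<in> carrier V" for x y
  proof -
    \<comment> \<open>The set sum of two fibres fills the whole fibre of \<open>x + y\<close>,
      because z = (z - y) + y with z - y in the fibre of x.\<close>
    have "z \<in> (\<Union>h\<in>{u \<in> carrier V. \<theta> u = \<theta> x}. \<Union>k\<in>{u \<in> carrier V. \<theta> u = \<theta> y}. {h \<oplus>\<^bsub>V\<^esub> k})"
      if z: "z \<in> carrier V" "\<theta> z = \<theta> (x \<oplus>\<^bsub>V\<^esub> y)" for z
    proof -
      have "z \<oplus>\<^bsub>V\<^esub> \<ominus>\<^bsub>V\<^esub> y \<oplus>\<^bsub>V\<^esub> y = z" using xy z by (simp add: V.M.a_assoc V.M.l_neg)
      moreover have "\<theta> (z \<oplus>\<^bsub>V\<^esub> \<ominus>\<^bsub>V\<^esub> y) = \<theta> x"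
      proof -
        have "\<theta> (z \<oplus>\<^bsub>V\<^esub> \<ominus>\<^bsub>V\<^esub> y) \<oplus>\<^bsub>W\<^esub> \<theta> y = \<theta> x \<oplus>\<^bsub>W\<^esub> \<theta> y"
          using add[of "z \<oplus>\<^bsub>V\<^esub> \<ominus>\<^bsub>V\<^esub> y" y] add[of x y] xy z \<open>z \<oplus>\<^bsub>V\<^esub> \<ominus>\<^bsub>V\<^esub> y \<oplus>\<^bsub>V\<^esub> y = z\<close> by simp
        then show ?thesis using W.M.add.right_cancel im xy z by simp
      qed
      ultimately show ?thesis using xy z
        by (intro UN_I[of "z \<oplus>\<^bsub>V\<^esub> \<ominus>\<^bsub>V\<^esub> y"] UN_I[of y]) auto
    qed
    then have "set_add V (U +>\<^bsub>V\<^esub> x) (U +>\<^bsub>V\<^esub> y) = U +>\<^bsub>V\<^esub> (x \<oplus>\<^bsub>V\<^esub> y)"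
      unfolding coset[OF xy(1)] coset[OF xy(2)] coset[OF V.M.add.m_closed[OF xy]] set_add_def'
      using add xy by auto
    then show ?thesis by (simp add: quot_rep_def)
  qed
  have qsmult: "c \<odot>\<^bsub>quot_rep V U\<^esub> (U +>\<^bsub>V\<^esub> x) = U +>\<^bsub>V\<^esub> (c \<odot>\<^bsub>V\<^esub> x)" if x: "x \<in> carrier V" for c x
  proof -
    have "U +>\<^bsub>V\<^esub> (c \<odot>\<^bsub>V\<^esub> y) = U +>\<^bsub>V\<^esub> (c \<odot>\<^bsub>V\<^esub> x)" if "y \<in> U +>\<^bsub>V\<^esub> x" for y
      using that x smult by (simp add: coset)
    moreover have "x \<in> U +>\<^bsub>V\<^esub> x" using x by (simp add: coset)
    ultimately have "(\<Union>y\<in>U +>\<^bsub>V\<^esub> x. U +>\<^bsub>V\<^esub> (c \<odot>\<^bsub>V\<^esub> y)) = U +>\<^bsub>V\<^esub> (c \<odot>\<^bsub>V\<^esub> x)" by blast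
    then show ?thesis by (simp add: quot_rep_def)
  qed
  have qact: "act (quot_rep V U) g (U +>\<^bsub>V\<^esub> x) = U +>\<^bsub>V\<^esub> act V g x"
    if g: "g \<in> carrier G" and x: "x \<in> carrier V" for g x
  proof -
    have "U +>\<^bsub>V\<^esub> act V g y = U +>\<^bsub>V\<^esub> act V g x" if "y \<in> U +>\<^bsub>V\<^esub> x" for y
      using that x act[OF g] closed[OF g] by (simp add: coset)
    moreover have "x \<in> U +>\<^bsub>V\<^esub> x" using x by (simp add: coset)
    ultimately have "(\<Union>y\<in>U +>\<^bsub>V\<^esub> x. U +>\<^bsub>V\<^esub> act V g y) = U +>\<^bsub>V\<^esub> act V g x" by blast
    then show ?thesis by (simp add: quot_rep_def)
  qed
  \<comment> \<open>The choice is harmless, since \<open>\<theta>\<close> is constant on each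
    coset.\<close>
  define \<phi> where "\<phi> A = \<theta> (SOME x. x \<in> A)" for A
  have phi: "\<phi> (U +>\<^bsub>V\<^esub> x) = \<theta> x" if x: "x \<in> carrier V" for x
  proof -
    have "(SOME y. y \<in> U +>\<^bsub>V\<^esub> x) \<in> U +>\<^bsub>V\<^esub> x" by (rule someI[of _ x]) (use x in \<open>simp add: coset\<close>)
    then show ?thesis using x unfolding \<phi>_def by (simp add: coset)
  qed
  show ?closed
    unfolding closed_rep_def carr qzero by (auto simp: qadd qsmult qact closed)
  show ?zero unfolding qzero using qadd by simp
  show ?iso
  proof (rule isomorphic_repI[of _ _ \<phi>])
    have "inj_on \<phi> ((\<lambda>x. U +>\<^bsub>V\<^esub> x) ` carrier V)"
      using phi by (auto simp: inj_on_def coset)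
    moreover have "\<phi> ` (\<lambda>x. U +>\<^bsub>V\<^esub> x) ` carrier V = carrier W"
      using phi surj by (auto simp: image_image)
    ultimately show "linear_bij (quot_rep V U) W \<phi>"
      using qadd qsmult phi add smult by (auto simp: linear_bij_def bij_betw_def carr)
  qed (use qact phi act closed in \<open>auto simp: carr\<close>)
qed

section \<open>Modules of functions\<close>

definition fscale :: "'f::field \<Rightarrow> ('x \<Rightarrow> 'f) \<Rightarrow> 'x \<Rightarrow> 'f"
  where "fscale c f = (\<lambda>x. c * f x)"

lemma fscale_apply [simp]: "fscale c f x = c * f x"
  by (simp add: fscale_def)

global_interpretation fv: vector_space fscale
  by unfold_locales (auto simp: fun_eq_iff algebra_simps)

lemma sum_fun_apply: "(\<Sum>i\<in>A. F i) x = (\<Sum>i\<in>A. F i x)"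
  for F :: "'i \<Rightarrow> 'x \<Rightarrow> 'f::comm_monoid_add"
  by (induction A rule: infinite_finite_induct) auto

text \<open>The normal form to which all modules are brought: pointwise operations on a set of
  functions, so that only the carrier and the action vary.\<close>

definition frep :: "('x \<Rightarrow> 'f::field) set \<Rightarrow> ('g \<Rightarrow> ('x \<Rightarrow> 'f) \<Rightarrow> 'x \<Rightarrow> 'f) \<Rightarrow> ('f, 'x \<Rightarrow> 'f, 'g) fg_module"
  where "frep C a = \<lparr>carrier = C, monoid.mult = undefined, one = undefined, ring.zero = 0, add = (+),
    module.smult = fscale, act = a\<rparr>"

lemma frep_simps [simp]:
  "carrier (frep C a) = C" "\<zero>\<^bsub>frep C a\<^esub> = 0" "f \<oplus>\<^bsub>frep C a\<^esub> h = f + h"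
  "c \<odot>\<^bsub>frep C a\<^esub> f = fscale c f" "act (frep C a) = a"
  by (simp_all add: frep_def)

lemma module_frep:
  fixes C :: "('x \<Rightarrow> 'f::field) set"
  shows "fv.subspace C \<Longrightarrow> module coeff_ring (frep C a)"
proof (intro moduleI abelian_groupI)
  show "cring (coeff_ring :: 'f ring)" by blast
  fix f assume C: "fv.subspace C" and f: "f \<in> carrier (frep C a)"
  show "\<exists>h\<in>carrier (frep C a). h \<oplus>\<^bsub>frep C a\<^esub> f = \<zero>\<^bsub>frep C a\<^esub>"
    using C f by (intro bexI[of _ "- f"]) (auto intro: fv.subspace_neg)
qed (auto simp: fv.subspace_def algebra_simps fv.scale_left_distrib fv.scale_right_distrib)

lemma submodule_frep:
  "fv.subspace C \<Longrightarrow> submodule U coeff_ring (frep C a) \<longleftrightarrow> U \<subseteq> C \<and> fv.subspace U"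
  by (subst submodule_iff[OF module_frep]) (auto simp: fv.subspace_def)

lemma rep_frep:
  assumes "group G" "fv.subspace C"
    and "\<And>g f. g \<in> carrier G \<Longrightarrow> f \<in> C \<Longrightarrow> a g f \<in> C"
    and "\<And>g f h. g \<in> carrier G \<Longrightarrow> a g (f + h) = a g f + a g h"
    and "\<And>g c f. g \<in> carrier G \<Longrightarrow> a g (fscale c f) = fscale c (a g f)"
    and "\<And>f. a \<one>\<^bsub>G\<^esub> f = f"
    and "\<And>g h f. g \<in> carrier G \<Longrightarrow> h \<in> carrier G \<Longrightarrow> a (g \<otimes>\<^bsub>G\<^esub> h) f = a g (a h f)"
  shows "rep G (frep C a)"
  using assms by (intro rep.intro rep_axioms.intro module_frep) auto

lemma subrep_frep:
  assumes "fv.subspace C"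
  shows "subrep G U (frep C a) \<longleftrightarrow>
    U \<subseteq> C \<and> fv.subspace U \<and> (\<forall>g\<in>carrier G. \<forall>f\<in>U. a g f \<in> U)"
  by (auto simp: subrep_def submodule_frep[OF assms])

lemma irreducible_rep_frep:
  assumes "rep G (frep C a)" "fv.subspace C"
  shows "irreducible_rep G (frep C a) \<longleftrightarrow> C \<noteq> {0} \<and>
    (\<forall>U. U \<subseteq> C \<longrightarrow> fv.subspace U \<longrightarrow> (\<forall>g\<in>carrier G. \<forall>f\<in>U. a g f \<in> U) \<longrightarrow> U = {0} \<or> U = C)"
  using assms by (auto simp: irreducible_rep_def subrep_frep)

section \<open>Permutations acting on functions, and zero-sum functions\<close>

definition pact :: "(nat \<Rightarrow> nat) \<Rightarrow> (nat \<Rightarrow> 'f::field) \<Rightarrow> nat \<Rightarrow> 'f"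
  where "pact p f = f \<circ> inv' p"

lemma pact_add: "pact p (f + h) = pact p f + pact p h"
  and pact_scale: "pact p (fscale c f) = fscale c (pact p f)"
  and pact_zero [simp]: "pact p 0 = 0"
  and pact_id [simp]: "pact id f = f"
  by (auto simp: pact_def fun_eq_iff)

lemma pact_diff: "pact p (f - h) = pact p f - pact p h"
  by (auto simp: pact_def fun_eq_iff)

lemma pact_comp: "bij p \<Longrightarrow> bij q \<Longrightarrow> pact (p \<circ> q) f = pact p (pact q f)"
  by (simp add: pact_def o_inv_distrib o_assoc)

lemma pact_apply: "bij p \<Longrightarrow> pact p f (p x) = f x"
  by (simp add: pact_def bij_is_inj)

lemma sum_pact:
  assumes "bij p"
  shows "sum (pact p f) (p ` A) = sum f A"
  using assms by (subst sum.reindex) (auto simp: pact_apply inj_on_def bij_def inj_def)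

definition zero_sum :: "nat set \<Rightarrow> (nat \<Rightarrow> 'f::field) set"
  where "zero_sum A = {f. (\<forall>x. x \<notin> A \<longrightarrow> f x = 0) \<and> sum f A = 0}"

lemma subspace_zero_sum: "fv.subspace (zero_sum A)"
  by (auto simp: fv.subspace_def zero_sum_def sum.distrib sum_distrib_left[symmetric])

lemma zero_sum_pact:
  assumes p: "bij p" and f: "f \<in> zero_sum A"
  shows "pact p f \<in> zero_sum (p ` A)"
proof -
  have "pact p f x = 0" if "x \<notin> p ` A" for x
  proof -
    obtain y where "x = p y" using p by (metis bij_pointE)
    then show ?thesis using that f by (auto simp: pact_apply[OF p] zero_sum_def)
  qed
  then show ?thesis using f by (auto simp: zero_sum_def sum_pact[OF p])
qed

lemma basis_vec_apply: "basis_vec x y = (if y = x then 1 else 0)"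
  by (simp add: basis_vec_def)

lemma pact_basis_vec: "bij p \<Longrightarrow> pact p (basis_vec x) = basis_vec (p x)"
  by (rule ext) (auto simp: pact_def basis_vec_def bij_is_inj bij_is_surj surj_f_inv_f)

lemma basis_diff_in_zero_sum:
  assumes "finite A" "x \<in> A" "y \<in> A"
  shows "basis_vec x - basis_vec y \<in> zero_sum A"
  using assms by (auto simp: zero_sum_def basis_vec_def sum_subtractf)

text \<open>The terms with \<open>basis_vec y\<close> add up to \<open>sum f A\<close> times that
  vector, which is zero, so they can be inserted into the basis expansion of \<open>f\<close> for
  free.\<close>

lemma zero_sum_expand:
  assumes A: "finite A" "y \<in> A" and f: "f \<in> zero_sum A"
  shows "f = (\<Sum>x\<in>A. fscale (f x) (basis_vec x - basis_vec y))"
proof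
  fix z
  have "(\<Sum>x\<in>A. fscale (f x) (basis_vec x - basis_vec y)) z =
      (\<Sum>x\<in>A. f x * basis_vec x z) - (\<Sum>x\<in>A. f x) * basis_vec y z"
    by (simp add: sum_fun_apply algebra_simps sum_subtractf sum_distrib_left sum_distrib_right)
  also have "(\<Sum>x\<in>A. f x) * basis_vec y z = 0" using f by (simp add: zero_sum_def)
  also have "(\<Sum>x\<in>A. f x * basis_vec x z) = (\<Sum>x\<in>A. if x = z then f z else 0)"
    by (intro sum.cong) (auto simp: basis_vec_def)
  also have "\<dots> - 0 = f z" using A f by (simp add: zero_sum_def)
  finally show "f z = (\<Sum>x\<in>A. fscale (f x) (basis_vec x - basis_vec y)) z" by (rule sym)
qed

lemma zero_sum_subset_iff:
  assumes A: "finite A" and U: "fv.subspace U"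
  shows "zero_sum A \<subseteq> U \<longleftrightarrow> (\<forall>x\<in>A. \<forall>y\<in>A. basis_vec x - basis_vec y \<in> U)"
proof
  assume "\<forall>x\<in>A. \<forall>y\<in>A. basis_vec x - basis_vec y \<in> U"
  then have "f \<in> U" if f: "f \<in> zero_sum A" for f
  proof (cases "A = {}")
    case True
    then have "f = 0" using f by (auto simp: zero_sum_def)
    then show ?thesis using U by (simp add: fv.subspace_0)
  next
    case False
    then obtain y where y: "y \<in> A" by blast
    assume *: "\<forall>x\<in>A. \<forall>y\<in>A. basis_vec x - basis_vec y \<in> U"
    have "(\<Sum>x\<in>A. fscale (f x) (basis_vec x - basis_vec y)) \<in> U"
      using * y U by (intro fv.subspace_sum fv.subspace_scale) auto
    then show ?thesis using zero_sum_expand[OF A y f] by simp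
  qed
  then show "zero_sum A \<subseteq> U" by blast
qed (use basis_diff_in_zero_sum[OF A] in blast)

lemma zero_sum_ne: "finite A \<Longrightarrow> x \<in> A \<Longrightarrow> y \<in> A \<Longrightarrow> x \<noteq> y \<Longrightarrow> zero_sum A \<noteq> ({0} :: (nat \<Rightarrow> 'f::field) set)"
proof
  assume *: "finite A" "x \<in> A" "y \<in> A" "x \<noteq> y" "zero_sum A = ({0} :: (nat \<Rightarrow> 'f) set)"
  then have "basis_vec x - basis_vec y = (0 :: nat \<Rightarrow> 'f)" using basis_diff_in_zero_sum by blast
  then have "(basis_vec x - basis_vec y) x = (0 :: 'f)" by (metis zero_fun_apply)
  then show False using * by (simp add: basis_vec_def)
qed

text \<open>First i is moved to x; then the place k to which j has been carried is exchanged with y.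
  The second transposition leaves x alone, because x differs from both y and k.\<close>

lemma permutes_pair:
  assumes "i \<in> A" "j \<in> A" "i \<noteq> j" "x \<in> A" "y \<in> A" "x \<noteq> y"
  shows "\<exists>p. p permutes A \<and> p i = x \<and> p j = y"
proof -
  define k where "k = Transposition.transpose x i j"
  define p where "p = Transposition.transpose y k \<circ> Transposition.transpose x i"
  have k: "k \<in> A" "k \<noteq> x" using assms by (auto simp: k_def transpose_def)
  have "p permutes A" unfolding p_def
    using k assms by (intro permutes_compose permutes_swap_id) auto
  moreover have "p i = x" "p j = y" using k assms by (auto simp: p_def k_def[symmetric])
  ultimately show ?thesis by blast
qed

text \<open>A transposition \<open>(i j)\<close> moves \<open>f\<close> by a multiple of \<open>e\<^sub>i - e\<^sub>j\<close>.\<close>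

lemma sym_invariant_subspace:
  fixes U :: "(nat \<Rightarrow> 'f::field) set"
  assumes A: "finite A" and U: "fv.subspace U" "U \<subseteq> zero_sum A"
    and inv: "\<And>p f. p permutes A \<Longrightarrow> f \<in> U \<Longrightarrow> pact p f \<in> U"
    and f: "f \<in> U" "i \<in> A" "j \<in> A" "f i \<noteq> f j"
  shows "U = zero_sum A"
proof -
  let ?t = "Transposition.transpose i j"
  have t: "?t permutes A" using f by (simp add: permutes_swap_id)
  have "pact ?t f - f = fscale (f j - f i) (basis_vec i - basis_vec j)"
    using f by (auto simp: pact_def fun_eq_iff basis_vec_def transpose_def)
  moreover have "pact ?t f - f \<in> U" using inv[OF t f(1)] f(1) U by (simp add: fv.subspace_diff)
  ultimately have "fscale (inverse (f j - f i)) (fscale (f j - f i) (basis_vec i - basis_vec j)) \<in> U"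
    using U by (simp add: fv.subspace_scale del: fv.scale_scale)
  then have ij: "basis_vec i - basis_vec j \<in> U" using f(4) by simp
  \<comment> \<open>A permutation with two prescribed values spreads the single difference for (i,
    j) to all pairs, and the differences span the zero-sum space.\<close>
  have "basis_vec x - basis_vec y \<in> U" if xy: "x \<in> A" "y \<in> A" for x y
  proof (cases "x = y")
    case True
    then show ?thesis using U by (simp add: fv.subspace_0)
  next
    case False
    have "i \<noteq> j" using f by auto
    then obtain p where p: "p permutes A" "p i = x" "p j = y"
      using permutes_pair f xy False by metis
    then have "pact p (basis_vec i - basis_vec j) = (basis_vec x - basis_vec y :: nat \<Rightarrow> 'f)"
      using permutes_bij[OF p(1)] by (simp add: pact_diff pact_basis_vec)
    then show ?thesis using inv[OF p(1) ij] by simp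
  qed
  then show ?thesis using U zero_sum_subset_iff[OF A U(1)] by blast
qed

section \<open>Permutation modules and linear spans as function spaces\<close>

lemma perm_rep_frep:
  "(perm_rep S a :: ('a::field, 'x \<Rightarrow> 'a, 'g) fg_module) = frep {f. finite {x. f x \<noteq> 0} \<and> {x. f x \<noteq> 0} \<subseteq> S} (\<lambda>g f y. \<Sum>x | f x \<noteq> 0 \<and> a g x = y. f x)"
proof -
  have "(+) = (\<lambda>f h (x :: 'x). f x + h x :: 'a)" "0 = (\<lambda>x :: 'x. 0 :: 'a)"
    "fscale = (\<lambda>c f (x :: 'x). c * f x :: 'a)"
    by (intro ext, simp)+
  then show ?thesis by (simp only: perm_rep_def frep_def)
qed

lemma subspace_fin_supp:
  "fv.subspace {f :: 'x \<Rightarrow> 'f::field. finite {x. f x \<noteq> 0} \<and> {x. f x \<noteq> 0} \<subseteq> S}"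
proof -
  have "finite {x. f x + h x \<noteq> 0}" if "finite {x. f x \<noteq> 0}" "finite {x. h x \<noteq> 0}" for f h :: "'x \<Rightarrow> 'f"
    by (rule finite_subset[of _ "{x. f x \<noteq> 0} \<union> {x. h x \<noteq> 0}"]) (use that in auto)
  moreover have "finite {x. c * f x \<noteq> 0}" if "finite {x. f x \<noteq> 0}" for c and f :: "'x \<Rightarrow> 'f"
    by (rule finite_subset[OF _ that]) auto
  moreover have "x \<in> S" if "{x. f x \<noteq> 0} \<subseteq> S" "{x. h x \<noteq> 0} \<subseteq> S" "f x + h x \<noteq> 0"
    for f h :: "'x \<Rightarrow> 'f" and x using that by (cases "f x = 0") auto
  ultimately show ?thesis by (simp add: fv.subspace_def subset_iff) blast
qed

lemma lin_span_frep:
  assumes "fv.subspace C" "A \<subseteq> C"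
  shows "lin_span (frep C a) A = fv.span A"
proof -
  have "fv.span A \<subseteq> C" using assms by (simp add: fv.span_minimal)
  then show ?thesis
    unfolding lin_span_def hull_def submodule_frep[OF assms(1)]
    using fv.span_superset[of A] fv.span_minimal[of A] fv.subspace_span[of A] by blast
qed

section \<open>Specht modules of hook shape (k, 1)\<close>

lemma rep_pact:
  assumes G: "subgroup G (sym_group n)" and C: "fv.subspace C"
    and inv: "\<And>g f. g \<in> G \<Longrightarrow> f \<in> C \<Longrightarrow> pact g f \<in> C"
  shows "rep ((sym_group n)\<lparr>carrier := G\<rparr>) (frep C pact)"
proof (rule rep_frep)
  show "group ((sym_group n)\<lparr>carrier := G\<rparr>)"
    using group.subgroup_imp_group[OF sym_group_is_group G] .
  have bij: "bij g" if "g \<in> G" for g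
    using subgroup.subset[OF G] that by (auto simp: sym_group_def permutes_bij)
  show "pact (g \<otimes>\<^bsub>(sym_group n)\<lparr>carrier := G\<rparr>\<^esub> h) f = pact g (pact h f)"
    if "g \<in> carrier ((sym_group n)\<lparr>carrier := G\<rparr>)" "h \<in> carrier ((sym_group n)\<lparr>carrier := G\<rparr>)" for g h f
    using that bij by (simp add: sym_group_def pact_comp)
  show "pact \<one>\<^bsub>(sym_group n)\<lparr>carrier := G\<rparr>\<^esub> f = f" for f
    by (simp add: sym_group_def)
qed (use C inv in \<open>auto simp: pact_add pact_scale\<close>)

section \<open>Tabloids, tableaux and polytabloids of shape (k, 1)\<close>

definition std_tabloid :: "nat \<Rightarrow> nat \<Rightarrow> nat set list"
  where "std_tabloid n x = [{1..n} - {x}, {x}]"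

lemma inj_std_tabloid: "inj (std_tabloid n)"
  by (auto simp: inj_def std_tabloid_def)

lemma diagram_hook: "diagram [k, Suc 0] = insert (Suc 0, 0) ((\<lambda>j. (0, j)) ` {..<k})"
  by (auto simp: diagram_def less_Suc_eq nth_Cons split: nat.splits)

lemma tabloid_hook:
  assumes t: "tableau [k, Suc 0] t"
  shows "tabloid [k, Suc 0] t = std_tabloid (Suc k) (t (Suc 0, 0))"
proof -
  have inj: "inj_on t (diagram [k, Suc 0])" and im: "t ` diagram [k, Suc 0] = {1..Suc k}"
    using t by (auto simp: tableau_def bij_betw_def)
  have 1: "{t (0, j) | j. (0, j) \<in> diagram [k, Suc 0]} = {1..Suc k} - {t (Suc 0, 0)}"
    unfolding im[symmetric] using inj by (auto simp: diagram_hook inj_on_def)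
  have 2: "{t (Suc 0, j) | j. (Suc 0, j) \<in> diagram [k, Suc 0]} = {t (Suc 0, 0)}"
    by (auto simp: diagram_hook)
  show ?thesis using 1 2 by (simp add: tabloid_def std_tabloid_def)
qed

text \<open>Any bijection from the diagram to the letters will do after composition with a
  permutation that corrects the two prescribed entries.\<close>

lemma tableau_exists:
  assumes k: "k \<ge> 1" and ab: "a \<in> {1..Suc k}" "b \<in> {1..Suc k}" "a \<noteq> b"
  shows "\<exists>t. tableau [k, Suc 0] t \<and> t (0, 0) = a \<and> t (Suc 0, 0) = b"
proof -
  have "finite (diagram [k, Suc 0])" by (simp add: diagram_hook)
  moreover have "card (diagram [k, Suc 0]) = card {1..Suc k}"
    by (simp only: diagram_hook) (subst card_insert_disjoint; auto simp: card_image inj_on_def)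
  ultimately obtain t where t: "bij_betw t (diagram [k, Suc 0]) {1..Suc k}"
    by (metis finite_same_card_bij finite_atLeastAtMost)
  have d: "(0, 0) \<in> diagram [k, Suc 0]" "(Suc 0, 0) \<in> diagram [k, Suc 0]" using k by (auto simp: diagram_hook)
  have "t (0, 0) \<noteq> t (Suc 0, 0)" using t d by (auto simp: bij_betw_def inj_on_def)
  moreover have "t (0, 0) \<in> {1..Suc k}" "t (Suc 0, 0) \<in> {1..Suc k}"
    using t d by (auto simp only: bij_betw_def)
  ultimately obtain p where p: "p permutes {1..Suc k}" "p (t (0, 0)) = a" "p (t (Suc 0, 0)) = b"
    using permutes_pair ab by metis
  have "tableau [k, Suc 0] (p \<circ> t)"
    using bij_betw_trans[OF t permutes_imp_bij[OF p(1)]] by (simp add: tableau_def)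
  then show ?thesis using p by (intro exI[of _ "p \<circ> t"]) simp
qed

text \<open>Column 0 is the only one with two cells. Every other nonempty column has a single cell,
  so its letter is fixed, and the permutation is determined by what it does on the two letters of
  column 0.\<close>

lemma column_stabilizer_hook:
  assumes k: "k \<ge> 1" and t: "tableau [k, Suc 0] t"
  shows "column_stabilizer [k, Suc 0] t = {id, Transposition.transpose (t (0, 0)) (t (Suc 0, 0))}"
proof -
  define a where "a = t (0, 0)"
  define b where "b = t (Suc 0, 0)"
  have inj: "inj_on t (diagram [k, Suc 0])" and im: "t ` diagram [k, Suc 0] = {1..Suc k}"
    using t by (auto simp: tableau_def bij_betw_def)
  have d: "(0, 0) \<in> diagram [k, Suc 0]" "(Suc 0, 0) \<in> diagram [k, Suc 0]" using k by (auto simp: diagram_hook)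
  have ab: "a \<in> {1..Suc k}" "b \<in> {1..Suc k}" using d im unfolding a_def b_def by blast+
  have ne: "a \<noteq> b" using inj d by (auto simp: a_def b_def inj_on_def)
  have col0: "{t (i, 0) | i. (i, 0) \<in> diagram [k, Suc 0]} = {a, b}"
    using k by (auto simp: diagram_hook a_def b_def)
  have colj: "{t (i, j) | i. (i, j) \<in> diagram [k, Suc 0]} = (if j < k then {t (0, j)} else {})" if "j \<noteq> 0" for j
    using that by (auto simp: diagram_hook)
  have rest: "x \<in> {1..Suc k} \<and> x \<noteq> a \<and> x \<noteq> b \<longleftrightarrow> (\<exists>j. j \<noteq> 0 \<and> j < k \<and> x = t (0, j))" for x
  proof
    assume x: "x \<in> {1..Suc k} \<and> x \<noteq> a \<and> x \<noteq> b"
    then obtain z where "z \<in> diagram [k, Suc 0]" "x = t z" using im by blast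
    then show "\<exists>j. j \<noteq> 0 \<and> j < k \<and> x = t (0, j)"
      using x by (auto simp: diagram_hook a_def b_def) (metis gr0I)
  next
    assume "\<exists>j. j \<noteq> 0 \<and> j < k \<and> x = t (0, j)"
    then obtain j where j: "j \<noteq> 0" "j < k" "x = t (0, j)" by blast
    have "(0, j) \<in> diagram [k, Suc 0]" using j by (simp add: diagram_hook)
    then show "x \<in> {1..Suc k} \<and> x \<noteq> a \<and> x \<noteq> b"
      using j im inj d by (auto simp: a_def b_def dest: inj_onD)
  qed
  have stab: "\<pi> \<in> column_stabilizer [k, Suc 0] t \<longleftrightarrow>
      \<pi> permutes {1..Suc k} \<and> \<pi> ` {a, b} = {a, b} \<and> (\<forall>x\<in>{1..Suc k}. x \<noteq> a \<longrightarrow> x \<noteq> b \<longrightarrow> \<pi> x = x)" for \<pi>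
  proof -
    have split0: "(\<forall>j. P j) \<longleftrightarrow> P 0 \<and> (\<forall>j. j \<noteq> 0 \<longrightarrow> P j)" for P :: "nat \<Rightarrow> bool"
      by metis
    have "(\<forall>j. \<pi> ` {t (i, j) | i. (i, j) \<in> diagram [k, Suc 0]} = {t (i, j) | i. (i, j) \<in> diagram [k, Suc 0]}) \<longleftrightarrow>
      \<pi> ` {a, b} = {a, b} \<and> (\<forall>j. j \<noteq> 0 \<longrightarrow> j < k \<longrightarrow> \<pi> (t (0, j)) = t (0, j))"
      (is "(\<forall>j. ?P j) \<longleftrightarrow> _")
    proof -
      have "(\<forall>j. ?P j) \<longleftrightarrow> ?P 0 \<and> (\<forall>j. j \<noteq> 0 \<longrightarrow> ?P j)"
        by (rule split0)
      also have "?P 0 \<longleftrightarrow> \<pi> ` {a, b} = {a, b}" by (simp only: col0)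
      also have "(\<forall>j. j \<noteq> 0 \<longrightarrow> ?P j) \<longleftrightarrow> (\<forall>j. j \<noteq> 0 \<longrightarrow> j < k \<longrightarrow> \<pi> (t (0, j)) = t (0, j))"
        by (auto simp: colj)
      finally show ?thesis .
    qed
    also have "(\<forall>j. j \<noteq> 0 \<longrightarrow> j < k \<longrightarrow> \<pi> (t (0, j)) = t (0, j)) \<longleftrightarrow>
        (\<forall>x\<in>{1..Suc k}. x \<noteq> a \<longrightarrow> x \<noteq> b \<longrightarrow> \<pi> x = x)" using rest by metis
    finally show ?thesis by (simp add: column_stabilizer_def)
  qed
  show ?thesis
    unfolding a_def[symmetric] b_def[symmetric]
  proof (intro equalityI subsetI)
    fix \<pi> assume "\<pi> \<in> column_stabilizer [k, Suc 0] t"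
    then have \<pi>: "\<pi> permutes {1..Suc k}" "\<pi> ` {a, b} = {a, b}"
      "\<And>x. x \<noteq> a \<Longrightarrow> x \<noteq> b \<Longrightarrow> \<pi> x = x" unfolding stab by (auto simp: permutes_def)
    have "\<pi> a = a \<and> \<pi> b = b \<or> \<pi> a = b \<and> \<pi> b = a" using \<pi>(2) ne by (auto simp: doubleton_eq_iff)
    then have "\<pi> = id \<or> \<pi> = Transposition.transpose a b"
      unfolding fun_eq_iff transpose_def id_apply using \<pi>(3) by metis
    then show "\<pi> \<in> {id, Transposition.transpose a b}" by simp
  next
    fix \<pi> assume "\<pi> \<in> {id, Transposition.transpose a b}"
    then show "\<pi> \<in> column_stabilizer [k, Suc 0] t"
      unfolding stab using ab by (auto simp: permutes_swap_id permutes_id)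
  qed
qed

text \<open>The column stabilizer contributes the identity with sign 1 and a transposition with sign
  -1, the latter putting the corner letter into the second row.\<close>

lemma polytabloid_hook:
  assumes k: "k \<ge> 1" and t: "tableau [k, Suc 0] t"
  shows "polytabloid [k, Suc 0] t =
    basis_vec (std_tabloid (Suc k) (t (Suc 0, 0))) - (basis_vec (std_tabloid (Suc k) (t (0, 0))) :: _ \<Rightarrow> 'f::field)"
proof -
  let ?a = "t (0, 0)" and ?b = "t (Suc 0, 0)"
  let ?\<tau> = "Transposition.transpose ?a ?b"
  have d: "(0, 0) \<in> diagram [k, Suc 0]" "(Suc 0, 0) \<in> diagram [k, Suc 0]" using k by (auto simp: diagram_hook)
  have ne: "?a \<noteq> ?b" and ab: "?a \<in> {1..Suc k}" "?b \<in> {1..Suc k}"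
    using t d by (auto simp only: tableau_def bij_betw_def inj_on_def) auto
  have "?\<tau> permutes {1..Suc k}" using ab by (intro permutes_swap_id)
  then have "tableau [k, Suc 0] (?\<tau> \<circ> t)"
    using t bij_betw_trans permutes_imp_bij by (fastforce simp: tableau_def)
  then have tab: "tabloid [k, Suc 0] (?\<tau> \<circ> t) = std_tabloid (Suc k) ?a"
    by (subst tabloid_hook) auto
  have "id \<noteq> ?\<tau>" using ne by (metis id_apply transpose_apply_first)
  then show ?thesis
    using ne by (simp add: polytabloid_def column_stabilizer_hook[OF k t] fun_eq_iff
      tab tabloid_hook[OF t] sign_swap_id)
qed

definition tabloid_act :: "(nat \<Rightarrow> nat) \<Rightarrow> (nat set list \<Rightarrow> 'f::field) \<Rightarrow> nat set list \<Rightarrow> 'f"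
  where "tabloid_act p f T = (\<Sum>S | f S \<noteq> 0 \<and> map ((`) p) S = T. f S)"

text \<open>The differences with \<open>x = y\<close> are zero, so this is the span of the
  polytabloids without a side condition on the generators.\<close>

definition specht_space :: "nat \<Rightarrow> (nat set list \<Rightarrow> 'f::field) set"
  where "specht_space n =
    fv.span {basis_vec (std_tabloid n x) - basis_vec (std_tabloid n y) | x y. x \<in> {1..n} \<and> y \<in> {1..n}}"

lemma subspace_specht_space: "fv.subspace (specht_space n)"
  by (simp add: specht_space_def)

lemma specht_hook:
  assumes k: "k \<ge> 1"
  shows "specht [k, Suc 0] = (frep (specht_space (Suc k)) tabloid_act :: ('f::field, _, _) fg_module)"
proof -
  let ?B = "\<lambda>x. basis_vec (std_tabloid (Suc k) x) :: _ \<Rightarrow> 'f"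
  have d: "(0, 0) \<in> diagram [k, Suc 0]" "(Suc 0, 0) \<in> diagram [k, Suc 0]" using k by (auto simp: diagram_hook)
  have tabs: "{tabloid [k, Suc 0] t | t. tableau [k, Suc 0] t} \<supseteq> std_tabloid (Suc k) ` {1..Suc k}"
  proof
    fix T assume "T \<in> std_tabloid (Suc k) ` {1..Suc k}"
    then obtain x where x: "x \<in> {1..Suc k}" "T = std_tabloid (Suc k) x" by blast
    \<comment> \<open>\<open>tableau_exists\<close> prescribes two entries, so a second letter for
      the corner is required; it exists because k is positive.\<close>
    obtain y where "y \<in> {1..Suc k}" "y \<noteq> x"
      using k x by (cases "x = 1") force+
    then obtain t where "tableau [k, Suc 0] t" "t (Suc 0, 0) = x"
      using tableau_exists[OF k _ x(1)] by metis
    moreover from this have "T = tabloid [k, Suc 0] t" using tabloid_hook[of k t] x by simp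
    ultimately show "T \<in> {tabloid [k, Suc 0] t | t. tableau [k, Suc 0] t}" by blast
  qed
  let ?P = "{polytabloid [k, Suc 0] t :: _ \<Rightarrow> 'f | t. tableau [k, Suc 0] t}"
  have poly: "?P = {?B x - ?B y | x y. x \<in> {1..Suc k} \<and> y \<in> {1..Suc k} \<and> x \<noteq> y}"
  proof (intro equalityI subsetI)
    fix f assume "f \<in> ?P"
    then obtain t where t: "tableau [k, Suc 0] t" "f = polytabloid [k, Suc 0] t" by blast
    have "t (Suc 0, 0) \<noteq> t (0, 0)" "t (0, 0) \<in> {1..Suc k}" "t (Suc 0, 0) \<in> {1..Suc k}"
      using t d by (auto simp only: tableau_def bij_betw_def inj_on_def) auto
    moreover have "f = ?B (t (Suc 0, 0)) - ?B (t (0, 0))" using t polytabloid_hook[OF k, of t] by simp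
    ultimately show "f \<in> {?B x - ?B y | x y. x \<in> {1..Suc k} \<and> y \<in> {1..Suc k} \<and> x \<noteq> y}" by blast
  next
    fix f assume "f \<in> {?B x - ?B y | x y. x \<in> {1..Suc k} \<and> y \<in> {1..Suc k} \<and> x \<noteq> y}"
    then obtain x y where xy: "x \<in> {1..Suc k}" "y \<in> {1..Suc k}" "y \<noteq> x" "f = ?B x - ?B y" by blast
    obtain t where t: "tableau [k, Suc 0] t" "t (0, 0) = y" "t (Suc 0, 0) = x"
      using tableau_exists[OF k xy(2,1,3)] by auto
    then have "f = polytabloid [k, Suc 0] t" unfolding polytabloid_hook[OF k t(1)] using xy by simp
    then show "f \<in> ?P" using t by blast
  qed
  let ?S = "{tabloid [k, Suc 0] t | t. tableau [k, Suc 0] t}"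
  let ?C = "{f :: _ \<Rightarrow> 'f. finite {x. f x \<noteq> 0} \<and> {x. f x \<noteq> 0} \<subseteq> ?S}"
  have BC: "?B x \<in> ?C" if "x \<in> {1..Suc k}" for x
  proof -
    have "std_tabloid (Suc k) x \<in> ?S" using tabs that by blast
    moreover have "{y. ?B x y \<noteq> 0} = {std_tabloid (Suc k) x}" by (auto simp: basis_vec_def)
    ultimately show ?thesis by simp
  qed
  have tm: "tabloid_module [k, Suc 0] = (frep ?C tabloid_act :: ('f, _, _) fg_module)"
    by (simp add: tabloid_module_def perm_rep_frep tabloid_act_def[abs_def])
  have "lin_span (tabloid_module [k, Suc 0] :: ('f, _, nat \<Rightarrow> nat) fg_module) ?P
      = fv.span {?B x - ?B y | x y. x \<in> {1..Suc k} \<and> y \<in> {1..Suc k} \<and> x \<noteq> y}"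
    unfolding tm poly
  proof (rule lin_span_frep[OF subspace_fin_supp], rule subsetI)
    fix f assume "f \<in> {?B x - ?B y | x y. x \<in> {1..Suc k} \<and> y \<in> {1..Suc k} \<and> x \<noteq> y}"
    then obtain x y where xy: "x \<in> {1..Suc k}" "y \<in> {1..Suc k}" "f = ?B x - ?B y" by blast
    show "f \<in> ?C"
      unfolding xy(3) by (rule fv.subspace_diff[OF subspace_fin_supp BC[OF xy(1)] BC[OF xy(2)]])
  qed
  also have "\<dots> = specht_space (Suc k)"
    unfolding specht_space_def
  proof (intro equalityI fv.span_minimal fv.subspace_span subsetI)
    fix f assume "f \<in> {?B x - ?B y | x y. x \<in> {1..Suc k} \<and> y \<in> {1..Suc k}}"
    then obtain x y where xy: "x \<in> {1..Suc k}" "y \<in> {1..Suc k}" "f = ?B x - ?B y" by blast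
    show "f \<in> fv.span {?B x - ?B y | x y. x \<in> {1..Suc k} \<and> y \<in> {1..Suc k} \<and> x \<noteq> y}"
    proof (cases "x = y")
      case True
      then show ?thesis using xy by (simp add: fv.span_zero)
    next
      case False
      then show ?thesis using xy by (intro fv.span_base) blast
    qed
  qed (rule fv.span_base, blast)
  finally show ?thesis unfolding specht_def tm by (simp add: frep_def)
qed

section \<open>Coordinates on the Specht module: tabloids replaced by their second-row
  letter\<close>

definition letters :: "nat \<Rightarrow> (nat set list \<Rightarrow> 'f::field) \<Rightarrow> nat \<Rightarrow> 'f"
  where "letters n f x = (if x \<in> {1..n} then f (std_tabloid n x) else 0)"

lemma letters_add: "letters n (f + h) = letters n f + letters n h"
  and letters_diff: "letters n (f - h) = letters n f - letters n h"
  and letters_scale: "letters n (fscale c f) = fscale c (letters n f)"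
  and letters_zero [simp]: "letters n 0 = 0"
  by (auto simp: letters_def fun_eq_iff)

lemma letters_basis_vec: "x \<in> {1..n} \<Longrightarrow> letters n (basis_vec (std_tabloid n x)) = basis_vec x"
  by (auto simp: letters_def basis_vec_def fun_eq_iff inj_eq[OF inj_std_tabloid])

text \<open>\<open>letters\<close> forgets all values off the standard tabloids; on this space it is
  injective.\<close>

definition on_std :: "nat \<Rightarrow> (nat set list \<Rightarrow> 'f::field) set"
  where "on_std n = {f. \<forall>T. T \<notin> std_tabloid n ` {1..n} \<longrightarrow> f T = 0}"

lemma on_stdE:
  assumes "f \<in> on_std n" "f T \<noteq> 0"
  obtains x where "x \<in> {1..n}" "T = std_tabloid n x"
  using assms unfolding on_std_def by blast

lemma subspace_on_std: "fv.subspace (on_std n)"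
  by (auto simp: fv.subspace_def on_std_def)

lemma specht_space_on_std: "specht_space n \<subseteq> on_std n"
  unfolding specht_space_def
  by (rule fv.span_minimal[OF _ subspace_on_std]) (auto simp: on_std_def basis_vec_def)

lemma inj_letters: "f \<in> on_std n \<Longrightarrow> h \<in> on_std n \<Longrightarrow> letters n f = letters n h \<Longrightarrow> f = h"
proof
  fix T assume fh: "f \<in> on_std n" "h \<in> on_std n" "letters n f = letters n h"
  show "f T = h T"
  proof (cases "T \<in> std_tabloid n ` {1..n}")
    case True
    then obtain x where "x \<in> {1..n}" "T = std_tabloid n x" by blast
    then show ?thesis using fun_cong[OF fh(3), of x] by (simp add: letters_def)
  qed (use fh in \<open>auto simp: on_std_def\<close>)
qed

text \<open>Generators go to generators: a difference of tabloids becomes a difference of basis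
  vectors, and these span the zero-sum functions.\<close>

lemma letters_image: "letters n ` specht_space n = (zero_sum {1..n} :: (nat \<Rightarrow> 'f::field) set)"
proof
  have "fv.subspace (letters n -` (zero_sum {1..n} :: (nat \<Rightarrow> 'f) set))"
    using subspace_zero_sum[of "{1..n}"]
    by (auto simp: fv.subspace_def letters_add letters_scale)
  moreover have "letters n (basis_vec (std_tabloid n x) - basis_vec (std_tabloid n y)) \<in> (zero_sum {1..n} :: (nat \<Rightarrow> 'f) set)"
    if "x \<in> {1..n}" "y \<in> {1..n}" for x y
    using that basis_diff_in_zero_sum[of "{1..n}" x y] by (simp add: letters_diff letters_basis_vec)
  ultimately have "specht_space n \<subseteq> letters n -` (zero_sum {1..n} :: (nat \<Rightarrow> 'f) set)"
    unfolding specht_space_def by (intro fv.span_minimal) auto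
  then show "letters n ` specht_space n \<subseteq> (zero_sum {1..n} :: (nat \<Rightarrow> 'f) set)" by blast
  have sub: "fv.subspace (letters n ` (specht_space n :: (_ \<Rightarrow> 'f) set))"
    unfolding fv.subspace_def
  proof (intro conjI ballI allI)
    have sp: "fv.subspace (specht_space n :: (_ \<Rightarrow> 'f) set)" by (rule subspace_specht_space)
    show "0 \<in> letters n ` (specht_space n :: (_ \<Rightarrow> 'f) set)"
      using sp by (intro image_eqI[of _ _ 0]) (auto simp: fv.subspace_def)
    show "f + h \<in> letters n ` specht_space n"
      if "f \<in> letters n ` specht_space n" "h \<in> letters n ` specht_space n" for f h :: "nat \<Rightarrow> 'f"
      using that sp by (auto simp: fv.subspace_def letters_add[symmetric])
    show "fscale c f \<in> letters n ` specht_space n"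
      if "f \<in> letters n ` specht_space n" for c and f :: "nat \<Rightarrow> 'f"
      using that sp by (auto simp: fv.subspace_def letters_scale[symmetric])
  qed
  have "basis_vec x - basis_vec y \<in> letters n ` (specht_space n :: (_ \<Rightarrow> 'f) set)"
    if "x \<in> {1..n}" "y \<in> {1..n}" for x y
  proof (rule image_eqI)
    show "basis_vec x - basis_vec y = letters n (basis_vec (std_tabloid n x) - basis_vec (std_tabloid n y))"
      using that by (simp add: letters_diff letters_basis_vec)
    show "basis_vec (std_tabloid n x) - basis_vec (std_tabloid n y) \<in> specht_space n"
      unfolding specht_space_def using that by (intro fv.span_base) blast
  qed
  then show "zero_sum {1..n} \<subseteq> letters n ` (specht_space n :: (_ \<Rightarrow> 'f) set)"
    using zero_sum_subset_iff[OF _ sub] by blast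
qed

lemma map_image_std_tabloid:
  assumes p: "p permutes {1..n}"
  shows "map ((`) p) (std_tabloid n x) = std_tabloid n (p x)"
  using permutes_image[OF p] permutes_inj[OF p] by (simp add: std_tabloid_def image_set_diff)

lemma letters_act:
  assumes p: "p permutes {1..n}" and f: "f \<in> on_std n"
  shows "letters n (tabloid_act p f) = pact p (letters n f)"
proof
  fix x
  show "letters n (tabloid_act p f) x = pact p (letters n f) x"
  proof (cases "x \<in> {1..n}")
    case False
    then have "inv' p x = x" using p permutes_inv permutes_not_in by metis
    with False show ?thesis by (auto simp: letters_def pact_def)
  next
    case True
    let ?y = "inv' p x"
    have y: "?y \<in> {1..n}" using True permutes_in_image[OF permutes_inv[OF p]] by metis
    \<comment> \<open>Within the support of \<open>f\<close>, the only candidate that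
      \<open>p\<close> carries to the tabloid of x is the tabloid of the preimage of x.\<close>
    have "{S. f S \<noteq> 0 \<and> map ((`) p) S = std_tabloid n x} = {S. f S \<noteq> 0 \<and> S = std_tabloid n ?y}"
    proof -
      have "map ((`) p) S = std_tabloid n x \<longleftrightarrow> S = std_tabloid n ?y" if fS: "f S \<noteq> 0" for S
      proof -
        obtain z where z: "z \<in> {1..n}" "S = std_tabloid n z" using on_stdE[OF f fS] .
        have "map ((`) p) S = std_tabloid n x \<longleftrightarrow> p z = x"
          unfolding z map_image_std_tabloid[OF p] inj_eq[OF inj_std_tabloid] ..
        also have "\<dots> \<longleftrightarrow> z = ?y" using permutes_inv_eq[OF p] by metis
        finally show ?thesis unfolding z inj_eq[OF inj_std_tabloid] .
      qed
      then show ?thesis by blast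
    qed
    then have "tabloid_act p f (std_tabloid n x) = (\<Sum>S | f S \<noteq> 0 \<and> S = std_tabloid n ?y. f S)"
      by (simp add: tabloid_act_def)
    \<comment> \<open>If the value at this tabloid is zero, the sum is empty and the equation still
      holds.\<close>
    also have "\<dots> = f (std_tabloid n ?y)" by (cases "f (std_tabloid n ?y) = 0") (auto simp: conj_commute cong: conj_cong)
    finally show ?thesis using True y by (simp add: letters_def pact_def)
  qed
qed

lemma tabloid_act_on_std:
  assumes p: "p permutes {1..n}" and f: "f \<in> on_std n"
  shows "tabloid_act p f \<in> on_std n"
proof -
  have "tabloid_act p f T = 0" if T: "T \<notin> std_tabloid n ` {1..n}" for T
  proof -
    have "{S. f S \<noteq> 0 \<and> map ((`) p) S = T} = {}"
    proof (rule ccontr)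
      assume "{S. f S \<noteq> 0 \<and> map ((`) p) S = T} \<noteq> {}"
      then obtain S where S: "f S \<noteq> 0" "map ((`) p) S = T" by blast
      then obtain z where "z \<in> {1..n}" "S = std_tabloid n z" using on_stdE[OF f] by metis
      then have "T = std_tabloid n (p z)" "p z \<in> {1..n}"
        using S map_image_std_tabloid[OF p] permutes_in_image[OF p] by auto
      then show False using T by blast
    qed
    then show ?thesis unfolding tabloid_act_def by (simp only: sum.empty)
  qed
  then show ?thesis by (simp add: on_std_def)
qed

text \<open>Invariance is read off on the side of letters, where a permutation visibly preserves
  zero sums, and is carried back by injectivity of \<open>letters\<close>.\<close>

lemma tabloid_act_specht_space:
  assumes p: "p permutes {1..n}" and f: "f \<in> specht_space n"
  shows "tabloid_act p f \<in> specht_space n"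
proof -
  have fo: "f \<in> on_std n" using f specht_space_on_std by blast
  have "letters n f \<in> zero_sum {1..n}" using f letters_image by blast
  then have "pact p (letters n f) \<in> zero_sum {1..n}"
    using zero_sum_pact[OF permutes_bij[OF p]] permutes_image[OF p] by metis
  then have "letters n (tabloid_act p f) \<in> letters n ` specht_space n"
    unfolding letters_act[OF p fo] letters_image .
  then obtain h where h: "h \<in> specht_space n" "letters n (tabloid_act p f) = letters n h" by blast
  then have "tabloid_act p f = h"
    using inj_letters tabloid_act_on_std[OF p fo] specht_space_on_std by blast
  with h show ?thesis by simp
qed

text \<open>The right-hand side is the unique maximal submodule: a submodule with an element that is
  not constant on letters contains every difference of basis vectors, by
  \<open>sym_invariant_subspace\<close>, and hence is everything.\<close>

lemma james_radical:
  assumes k: "k \<ge> 2"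
  shows "radical (sym_group (Suc k)) (frep (specht_space (Suc k)) tabloid_act :: ('f::field, _, _) fg_module) =
    {f \<in> specht_space (Suc k). \<forall>i\<in>{1..Suc k}. \<forall>j\<in>{1..Suc k}. letters (Suc k) f i = letters (Suc k) f j}"
    (is "radical ?G ?V = ?K")
proof -
  let ?n = "Suc k"
  let ?S = "specht_space ?n :: (_ \<Rightarrow> 'f) set"
  have inj: "f = h" if "f \<in> ?S" "h \<in> ?S" "letters ?n f = letters ?n h" for f h
    using that inj_letters specht_space_on_std by blast
  have act: "letters ?n (tabloid_act p f) = pact p (letters ?n f)" if "p permutes {1..?n}" "f \<in> ?S" for p f
    using that letters_act specht_space_on_std by blast
  have srep: "subrep ?G U ?V \<longleftrightarrow> U \<subseteq> ?S \<and> fv.subspace U \<and>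
    (\<forall>p. p permutes {1..?n} \<longrightarrow> (\<forall>f\<in>U. tabloid_act p f \<in> U))" for U
    by (subst subrep_frep[OF subspace_specht_space]) (simp add: sym_group_def)
  have K: "subrep ?G ?K ?V"
    unfolding srep
  proof (intro conjI allI impI ballI)
    show "fv.subspace ?K"
    proof -
      have "fv.subspace {f :: _ \<Rightarrow> 'f. letters ?n f i = letters ?n f j}" for i j
        by (simp add: fv.subspace_def letters_add letters_scale)
      then have "fv.subspace (?S \<inter> (\<Inter>i\<in>{1..?n}. \<Inter>j\<in>{1..?n}. {f. letters ?n f i = letters ?n f j}))"
        by (intro fv.subspace_inter fv.subspace_Inter subspace_specht_space) (auto intro!: fv.subspace_Inter)
      moreover have "?S \<inter> (\<Inter>i\<in>{1..?n}. \<Inter>j\<in>{1..?n}. {f. letters ?n f i = letters ?n f j}) =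
          ?K" by blast
      ultimately show ?thesis by simp
    qed
    fix p f assume p: "p permutes {1..?n}" and f: "f \<in> ?K"
    have "inv' p i \<in> {1..?n}" if "i \<in> {1..?n}" for i
      using that permutes_in_image[OF permutes_inv[OF p]] by metis
    then have "letters ?n (tabloid_act p f) i = letters ?n (tabloid_act p f) j"
      if "i \<in> {1..?n}" "j \<in> {1..?n}" for i j
      using f p that unfolding act[OF p conjunct1[OF f[unfolded mem_Collect_eq]]] pact_def comp_apply by blast
    then show "tabloid_act p f \<in> ?K"
      using f tabloid_act_specht_space[OF p, of f] by blast
  qed auto
  have ne: "?K \<noteq> ?S"
  proof
    assume eq: "?K = ?S"
    \<comment> \<open>In characteristic 2 this function takes equal values at 1 and 2, so it has to
      be compared with a third letter, which exists because k is at least 2.\<close>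
    have "basis_vec 1 - basis_vec 2 \<in> letters ?n ` ?S"
      unfolding letters_image using k by (intro basis_diff_in_zero_sum) auto
    then obtain f where f: "f \<in> ?S" "letters ?n f = basis_vec 1 - basis_vec 2" by (metis imageE)
    then have "letters ?n f 1 = letters ?n f 3" using eq k by fastforce
    then show False by (simp add: f basis_vec_def)
  qed
  have max: "U \<subseteq> ?K" if U: "subrep ?G U ?V" "U \<noteq> ?S" for U
  proof (rule ccontr)
    assume "\<not> U \<subseteq> ?K"
    then obtain f i j where f: "f \<in> U" "i \<in> {1..?n}" "j \<in> {1..?n}" "letters ?n f i \<noteq> letters ?n f j"
      using U(1) unfolding srep by blast
    have US: "U \<subseteq> ?S" and Usub: "fv.subspace U" and Uinv: "\<And>p f. p permutes {1..?n} \<Longrightarrow> f \<in> U \<Longrightarrow> tabloid_act p f \<in> U"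
      using U(1) unfolding srep by auto
    have "letters ?n ` U = zero_sum {1..?n}"
    proof (rule sym_invariant_subspace)
      show "fv.subspace (letters ?n ` U)"
        using Usub by (auto simp: fv.subspace_def letters_add[symmetric] letters_scale[symmetric] image_iff
          intro: bexI[of _ 0])
      show "letters ?n ` U \<subseteq> zero_sum {1..?n}" using US letters_image by blast
      show "pact p h \<in> letters ?n ` U" if p: "p permutes {1..?n}" and h: "h \<in> letters ?n ` U" for p h
      proof -
        obtain u where u: "u \<in> U" "h = letters ?n u" using h by blast
        then have "pact p h = letters ?n (tabloid_act p u)" using act[OF p] US by auto
        then show ?thesis using Uinv[OF p u(1)] by blast
      qed
    qed (use f in auto)
    then have "letters ?n ` ?S \<subseteq> letters ?n ` U" by (simp add: letters_image)
    moreover have "f \<in> U" if f: "f \<in> ?S" "letters ?n f \<in> letters ?n ` U" for f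
    proof -
      obtain u where u: "u \<in> U" "letters ?n f = letters ?n u" using f(2) by (rule imageE)
      then have "f = u" using inj[OF f(1)] US by blast
      with u show ?thesis by simp
    qed
    ultimately have "?S \<subseteq> U" by blast
    then show False using U(2) US by (metis subset_antisym)
  qed
  have "maximal_subrep ?G U ?V \<longleftrightarrow> U = ?K" for U
  proof
    assume U: "maximal_subrep ?G U ?V"
    then have "subrep ?G U ?V" "U \<noteq> ?S" unfolding maximal_subrep_def by auto
    then have UK: "U \<subseteq> ?K" using max by blast
    have "U' = U \<or> U' = ?S" if "subrep ?G U' ?V" "U \<subseteq> U'" for U'
      using U that by (simp add: maximal_subrep_def)
    from this[OF K UK] ne show "U = ?K" by blast
  next
    assume "U = ?K"
    then show "maximal_subrep ?G U ?V"
      unfolding maximal_subrep_def using K ne max by (simp, metis subset_antisym)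
  qed
  then show ?thesis unfolding radical_def by auto
qed

text \<open>Common form of the two identifications made later: \<open>\<theta>\<close> is the
  identity in odd degree and the subtraction of a block sum in even degree. The assumption on its
  kernel says that it is the radical, which is computed over the full symmetric group, whereas
  equivariance is asked for elements of \<open>G\<close> alone.\<close>

lemma james_D_hook:
  assumes k: "k \<ge> 2" and G: "subgroup G (sym_group (Suc k))"
    and C: "fv.subspace C" and inv: "\<And>g f. g \<in> G \<Longrightarrow> f \<in> C \<Longrightarrow> pact g f \<in> C"
    and add: "\<And>f h. \<theta> (f + h) = \<theta> f + \<theta> h" and scale: "\<And>c f. \<theta> (fscale c f) = fscale c (\<theta> f)"
    and im: "\<theta> ` zero_sum {1..Suc k} = C"
    and ker: "\<And>f. f \<in> zero_sum {1..Suc k} \<Longrightarrow> \<theta> f = 0 \<longleftrightarrow> (\<forall>i\<in>{1..Suc k}. \<forall>j\<in>{1..Suc k}. f i = f j)"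
    and act: "\<And>g f. g \<in> G \<Longrightarrow> f \<in> zero_sum {1..Suc k} \<Longrightarrow> \<theta> (pact g f) = pact g (\<theta> f)"
  defines "D \<equiv> (james_D [k, 1] :: ('f::field, _, _) fg_module)"
    and "H \<equiv> (sym_group (Suc k))\<lparr>carrier := G\<rparr>"
  shows "rep H (frep C pact)" and "isomorphic_rep H D (frep C pact)"
    and "rep H D" and "closed_rep H D"
proof -
  let ?n = "Suc k"
  let ?S = "specht_space ?n :: (_ \<Rightarrow> 'f) set"
  let ?K = "{f \<in> ?S. \<forall>i\<in>{1..?n}. \<forall>j\<in>{1..?n}. letters ?n f i = letters ?n f j}"
  let ?V = "frep ?S tabloid_act"
  have perm: "g permutes {1..?n}" if "g \<in> G" for g
    using subgroup.subset[OF G] that by (auto simp: sym_group_def)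
  have ls: "letters ?n f \<in> zero_sum {1..?n}" if "f \<in> ?S" for f using that letters_image by blast
  show R: "rep H (frep C pact)" unfolding H_def using rep_pact[OF G C inv] .
  have "k \<ge> 1" using k by simp
  then have "specht [k, 1] = ?V" by (simp add: specht_hook)
  then have D: "D = quot_rep ?V ?K"
    unfolding D_def james_D_def head_def using james_radical[OF k, where 'f = 'f] by simp
  note q = quot_rep_cong[where \<theta> = "\<lambda>f. \<theta> (letters ?n f)" and V = ?V and W = "frep C pact" and G = H
      and U = "?K",
      OF module_frep[OF subspace_specht_space] module_frep[OF C], folded D]
  have surj: "(\<lambda>f. \<theta> (letters ?n f)) ` carrier ?V = carrier (frep C pact)"
    using im unfolding letters_image[symmetric] by (simp add: image_image)
  have closed: "act ?V g x \<in> carrier ?V" if "g \<in> carrier H" "x \<in> carrier ?V" for g x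
    using that perm by (simp add: H_def tabloid_act_specht_space)
  have act': "\<theta> (letters ?n (act ?V g x)) = act (frep C pact) g (\<theta> (letters ?n x))"
    if "g \<in> carrier H" "x \<in> carrier ?V" for g x
  proof -
    have "g \<in> G" "x \<in> ?S" using that by (auto simp: H_def)
    moreover from this have "x \<in> on_std ?n" using specht_space_on_std by blast
    ultimately show ?thesis using letters_act[OF perm, of g x] act ls by simp
  qed
  have K: "?K =
      {x \<in> carrier ?V. \<theta> (letters ?n x) = \<zero>\<^bsub>frep C pact\<^esub>}"
    using ker ls by auto
  show cl: "closed_rep H D"
    by (rule q(1)) (use surj closed act' K add scale in \<open>simp_all add: letters_add letters_scale\<close>)
  have z: "\<zero>\<^bsub>D\<^esub> \<oplus>\<^bsub>D\<^esub> \<zero>\<^bsub>D\<^esub> = \<zero>\<^bsub>D\<^esub>"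
    by (rule q(2)[unfolded D[symmetric]]) (use surj closed act' K add scale in \<open>simp_all add: letters_add letters_scale\<close>)
  show iso: "isomorphic_rep H D (frep C pact)"
    by (rule q(3)) (use surj closed act' K add scale in \<open>simp_all add: letters_add letters_scale\<close>)
  show "rep H D" by (rule rep_pullback[OF cl z R iso])
qed

section \<open>Outer tensor products with the trivial module\<close>

text \<open>A section \<open>s\<close> of \<open>e\<close> that is linear modulo the relations makes every element of the
  free module congruent to a basis vector \<open>s v\<close>, so the kernel is spanned by the relations.\<close>

lemma free_module_quotient:
  fixes e :: "'x \<Rightarrow> 'y \<Rightarrow> 'f::field" and R :: "('x \<Rightarrow> 'f) set"
  assumes C: "fv.subspace C" and e: "\<And>x. x \<in> I \<Longrightarrow> e x \<in> C"
    and s: "\<And>v. v \<in> C \<Longrightarrow> s v \<in> I" "\<And>v. v \<in> C \<Longrightarrow> e (s v) = v"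
    and R: "\<And>r. r \<in> R \<Longrightarrow> finite {x. r x \<noteq> 0} \<and> {x. r x \<noteq> 0} \<subseteq> I"
      "\<And>r. r \<in> R \<Longrightarrow> (\<Sum>x | r x \<noteq> 0. fscale (r x) (e x)) = 0"
    and red: "\<And>x. x \<in> I \<Longrightarrow> basis_vec x - basis_vec (s (e x)) \<in> fv.span R"
    and addr: "\<And>v w. v \<in> C \<Longrightarrow> w \<in> C \<Longrightarrow>
      basis_vec (s (v + w)) - basis_vec (s v) - basis_vec (s w) \<in> fv.span R"
    and scr: "\<And>c v. v \<in> C \<Longrightarrow> basis_vec (s (fscale c v)) - fscale c (basis_vec (s v)) \<in> fv.span R"
    and a: "\<And>g x. g \<in> carrier G \<Longrightarrow> x \<in> I \<Longrightarrow> a g x \<in> I"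
      "\<And>g x. g \<in> carrier G \<Longrightarrow> x \<in> I \<Longrightarrow> e (a g x) = b g (e x)"
    and b: "\<And>g v w. g \<in> carrier G \<Longrightarrow> b g (v + w) = b g v + b g w"
      "\<And>g c v. g \<in> carrier G \<Longrightarrow> b g (fscale c v) = fscale c (b g v)"
  defines "F \<equiv> perm_rep I a"
  defines "Q \<equiv> quot_rep F (lin_span F R)"
  shows "closed_rep G Q" and "isomorphic_rep G Q (frep C b)"
proof -
  define S where "S = {f :: 'x \<Rightarrow> 'f. finite {x. f x \<noteq> 0} \<and> {x. f x \<noteq> 0} \<subseteq> I}"
  define p where "p = (\<lambda>g (f :: 'x \<Rightarrow> 'f) y. \<Sum>x | f x \<noteq> 0 \<and> a g x = y. f x)"
  have F: "F = frep S p" unfolding F_def perm_rep_frep S_def p_def ..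
  have S: "fv.subspace S" unfolding S_def by (rule subspace_fin_supp)
  define \<theta> where "\<theta> f = (\<Sum>x | f x \<noteq> 0. fscale (f x) (e x))" for f
  \<comment> \<open>Summing over any finite superset of the support lets \<open>f\<close>,
    \<open>h\<close> and \<open>f + h\<close> share one index set.\<close>
  have theta: "\<theta> f = (\<Sum>x\<in>A. fscale (f x) (e x))" if "finite A" "{x. f x \<noteq> 0} \<subseteq> A" for f A
    unfolding \<theta>_def using that by (intro sum.mono_neutral_left) auto
  have add: "\<theta> (f + h) = \<theta> f + \<theta> h" if "f \<in> S" "h \<in> S" for f h
  proof -
    let ?A = "{x. f x \<noteq> 0} \<union> {x. h x \<noteq> 0}"
    have "finite ?A" using that by (auto simp: S_def)
    then have "\<theta> (f + h) = (\<Sum>x\<in>?A. fscale ((f + h) x) (e x))"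
      "\<theta> f = (\<Sum>x\<in>?A. fscale (f x) (e x))" "\<theta> h = (\<Sum>x\<in>?A. fscale (h x) (e x))"
      by (intro theta; auto)+
    then show ?thesis by (simp add: fv.scale_left_distrib sum.distrib)
  qed
  have scale: "\<theta> (fscale c f) = fscale c (\<theta> f)" if "f \<in> S" for c f
  proof -
    have "\<theta> (fscale c f) = (\<Sum>x | f x \<noteq> 0. fscale (fscale c f x) (e x))"
      using that by (intro theta) (auto simp: S_def)
    then show ?thesis by (simp add: \<theta>_def fv.scale_sum_right)
  qed
  have basis: "basis_vec x \<in> S" "\<theta> (basis_vec x) = e x" if "x \<in> I" for x
  proof -
    have "{y. (basis_vec x y :: 'f) \<noteq> 0} = {x}" by (auto simp: basis_vec_def)
    then show "basis_vec x \<in> S" "\<theta> (basis_vec x) = e x"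
      using that by (simp_all add: S_def \<theta>_def) (simp add: basis_vec_def)
  qed
  have thC: "\<theta> f \<in> C" if "f \<in> S" for f
    unfolding \<theta>_def using that e by (intro fv.subspace_sum[OF C] fv.subspace_scale[OF C]) (auto simp: S_def)
  have b0: "b g 0 = 0" if "g \<in> carrier G" for g using b(2)[OF that, of 0 0] by simp
  have bsum: "b g (\<Sum>x\<in>A. h x) = (\<Sum>x\<in>A. b g (h x))" if "g \<in> carrier G" for g A and h :: "'x \<Rightarrow> 'y \<Rightarrow> 'f"
    by (induction A rule: infinite_finite_induct) (simp_all only: sum.infinite sum.empty sum.insert b(1)[OF that] b0[OF that] not_False_eq_True)
  have pS: "p g f \<in> S" and pth: "\<theta> (p g f) = b g (\<theta> f)" if g: "g \<in> carrier G" and f: "f \<in> S" for g f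
  proof -
    let ?A = "{x. f x \<noteq> 0}"
    have A: "finite ?A" "?A \<subseteq> I" using f by (auto simp: S_def)
    have sub: "{y. p g f y \<noteq> 0} \<subseteq> a g ` ?A"
    proof
      fix y assume "y \<in> {y. p g f y \<noteq> 0}"
      then have "(\<Sum>x | f x \<noteq> 0 \<and> a g x = y. f x) \<noteq> 0" by (simp add: p_def)
      then have "{x. f x \<noteq> 0 \<and> a g x = y} \<noteq> {}" by (metis sum.empty)
      then show "y \<in> a g ` ?A" by blast
    qed
    then show "p g f \<in> S"
      using A a(1)[OF g] finite_subset[OF sub] unfolding S_def by blast
    \<comment> \<open>Basis elements with the same image under \<open>a g\<close> are collected
      fibre by fibre, so the argument does not rest on injectivity of \<open>a g\<close>.\<close>
    have "\<theta> (p g f) = (\<Sum>y\<in>a g ` ?A. fscale (p g f y) (e y))"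
      using A sub by (intro theta) auto
    also have "\<dots> = (\<Sum>y\<in>a g ` ?A. \<Sum>x\<in>{x \<in> ?A. a g x = y}. fscale (f x) (e (a g x)))"
      by (intro sum.cong refl) (simp add: p_def fv.scale_sum_left)
    also have "\<dots> = (\<Sum>x\<in>?A. fscale (f x) (e (a g x)))"
      using sum.image_gen[OF A(1), of "\<lambda>x. fscale (f x) (e (a g x))" "a g"] by simp
    also have "\<dots> = (\<Sum>x\<in>?A. b g (fscale (f x) (e x)))"
      using A a(2)[OF g] by (intro sum.cong refl) (auto simp: b(2)[OF g])
    finally show "\<theta> (p g f) = b g (\<theta> f)" by (simp add: \<theta>_def bsum[OF g])
  qed
  have norm: "(\<Sum>x\<in>A. fscale (f x) (basis_vec x)) - basis_vec (s (\<Sum>x\<in>A. fscale (f x) (e x))) \<in> fv.span R"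
    if "finite A" "A \<subseteq> I" for A f
    using that
  proof (induction A rule: finite_induct)
    case empty
    \<comment> \<open>Scaling by 0 in \<open>scr\<close> turns the relation into the basis vector of
      \<open>s 0\<close> alone.\<close>
    have "basis_vec (s 0) \<in> fv.span R"
      using scr[of 0 0] fv.subspace_0[OF C] by simp
    then show ?case unfolding sum.empty diff_0 by (rule fv.span_neg)
  next
    case (insert x A)
    define c where "c = f x"
    define v where "v = e x"
    define w where "w = (\<Sum>x\<in>A. fscale (f x) (e x))"
    define r where "r = (\<Sum>x\<in>A. fscale (f x) (basis_vec x))"
    have v: "v \<in> C" "fscale c v \<in> C" unfolding v_def using insert e C by (auto intro: fv.subspace_scale)
    have w: "w \<in> C"
      unfolding w_def using insert e by (intro fv.subspace_sum[OF C] fv.subspace_scale[OF C]) auto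
    \<comment> \<open>Replace x by \<open>s v\<close>, absorb the scalar c, replace the remaining
      sum by \<open>s w\<close> through the induction hypothesis, and merge the two basis vectors
      into one.\<close>
    have "fscale c (basis_vec x - basis_vec (s v)) - (basis_vec (s (fscale c v)) - fscale c (basis_vec (s v)))
        + (r - basis_vec (s w)) - (basis_vec (s (fscale c v + w)) - basis_vec (s (fscale c v)) - basis_vec (s w)) \<in> fv.span R"
    proof (intro fv.span_diff[OF fv.span_add[OF fv.span_diff[OF fv.span_scale]]])
      show "basis_vec x - basis_vec (s v) \<in> fv.span R" unfolding v_def by (rule red) (use insert in blast)
      show "basis_vec (s (fscale c v)) - fscale c (basis_vec (s v)) \<in> fv.span R" by (rule scr[OF v(1)])
      show "r - basis_vec (s w) \<in> fv.span R" unfolding r_def w_def by (rule insert.IH) (use insert in blast)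
      show "basis_vec (s (fscale c v + w)) - basis_vec (s (fscale c v)) - basis_vec (s w) \<in> fv.span R"
        by (rule addr[OF v(2) w])
    qed
    also have "fscale c (basis_vec x - basis_vec (s v)) - (basis_vec (s (fscale c v)) - fscale c (basis_vec (s v)))
        + (r - basis_vec (s w)) - (basis_vec (s (fscale c v + w)) - basis_vec (s (fscale c v)) - basis_vec (s w))
      = fscale c (basis_vec x) + r - basis_vec (s (fscale c v + w))"
      by (simp add: fv.scale_right_diff_distrib)
    finally show ?case
      unfolding c_def v_def w_def r_def sum.insert[OF insert.hyps] .
  qed
  have RS: "R \<subseteq> S" using R(1) unfolding S_def by blast
  have span: "lin_span F R = fv.span R" unfolding F by (rule lin_span_frep[OF S RS])
  have ker: "lin_span F R = {f \<in> carrier F. \<theta> f = \<zero>\<^bsub>frep C b\<^esub>}"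
    unfolding span unfolding F frep_simps
  proof (intro equalityI subsetI)
    have "fv.subspace {f \<in> S. \<theta> f = 0}"
      using S by (auto simp: fv.subspace_def add scale) (simp add: \<theta>_def)
    moreover have "R \<subseteq> {f \<in> S. \<theta> f = 0}" using RS R(2) by (auto simp: \<theta>_def)
    ultimately have "fv.span R \<subseteq> {f \<in> S. \<theta> f = 0}" by (intro fv.span_minimal)
    then show "f \<in> {f \<in> S. \<theta> f = 0}" if "f \<in> fv.span R" for f using that by blast
    show "f \<in> fv.span R" if "f \<in> {f \<in> S. \<theta> f = 0}" for f
    proof -
      have f: "finite {x. f x \<noteq> 0}" "{x. f x \<noteq> 0} \<subseteq> I" "\<theta> f = 0" using that by (auto simp: S_def)
      have "(\<Sum>x | f x \<noteq> 0. fscale (f x) (basis_vec x)) = f"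
      proof
        fix y
        have "(\<Sum>x | f x \<noteq> 0. fscale (f x) (basis_vec x)) y = (\<Sum>x | f x \<noteq> 0. if x = y then f y else 0)"
          unfolding sum_fun_apply by (intro sum.cong) (auto simp: basis_vec_def)
        then show "(\<Sum>x | f x \<noteq> 0. fscale (f x) (basis_vec x)) y = f y" using f by simp
      qed
      \<comment> \<open>An element of the kernel is congruent to \<open>s 0\<close>, which is itself
        congruent to zero.\<close>
      then have "f - basis_vec (s 0) \<in> fv.span R" using norm[OF f(1,2), of f] f(3) by (simp add: \<theta>_def)
      moreover have "- basis_vec (s 0) \<in> fv.span R" using norm[of "{}"] by simp
      ultimately show ?thesis using fv.span_diff by fastforce
    qed
  qed
  have surj: "\<theta> ` carrier F = carrier (frep C b)"
  proof
    show "\<theta> ` carrier F \<subseteq> carrier (frep C b)" using thC by (auto simp: F)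
    show "carrier (frep C b) \<subseteq> \<theta> ` carrier F"
    proof
      fix v assume "v \<in> carrier (frep C b)"
      then have "v = \<theta> (basis_vec (s v))" "basis_vec (s v) \<in> carrier F"
        using basis[OF s(1)] s(2) by (auto simp: F)
      then show "v \<in> \<theta> ` carrier F" by (rule image_eqI)
    qed
  qed
  note q = quot_rep_cong[where \<theta> = \<theta> and V = F and W = "frep C b" and G = G and U = "lin_span F R",
      folded Q_def]
  have mF: "module coeff_ring F" unfolding F by (rule module_frep[OF S])
  show "closed_rep G Q"
    by (rule q(1)[OF mF module_frep[OF C] surj]) (use ker in \<open>simp_all add: F add scale pS pth\<close>)
  show "isomorphic_rep G Q (frep C b)"
    by (rule q(3)[OF mF module_frep[OF C] surj]) (use ker in \<open>simp_all add: F add scale pS pth\<close>)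
qed

section \<open>Bilinearity relations and tensoring with the trivial module\<close>

lemma fin_supp_basis: "x \<in> I \<Longrightarrow> basis_vec x \<in> {f :: _ \<Rightarrow> 'f::field. finite {x. f x \<noteq> 0} \<and> {x. f x \<noteq> 0} \<subseteq> I}"
proof -
  assume "x \<in> I"
  moreover have "{y. (basis_vec x y :: 'f) \<noteq> 0} = {x}" by (auto simp: basis_vec_def)
  ultimately show "(basis_vec x :: _ \<Rightarrow> 'f) \<in> {f. finite {x. f x \<noteq> 0} \<and> {x. f x \<noteq> 0} \<subseteq> I}" by simp
qed

text \<open>Evaluates the linear extension of \<open>e\<close> on the two shapes of bilinearity
  relations. The basis vectors in a relation may coincide, so all sums run over the set of indices
  and each basis vector is evaluated there separately.\<close>

lemma free_sum_linear:
  fixes e :: "'x \<Rightarrow> 'y \<Rightarrow> 'f::field"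
  shows "r = basis_vec x - basis_vec y - basis_vec w \<Longrightarrow>
      (\<Sum>z | r z \<noteq> 0. fscale (r z) (e z)) = e x - e y - e w"
    and "r = basis_vec x - fscale c (basis_vec y) \<Longrightarrow>
      (\<Sum>z | r z \<noteq> 0. fscale (r z) (e z)) = e x - fscale c (e y)"
proof -
  have single: "(\<Sum>z\<in>A. fscale (basis_vec x z) (e z)) = e x" if "x \<in> A" "finite A" for A x
  proof -
    have "(\<Sum>z\<in>A. fscale (basis_vec x z) (e z)) = (\<Sum>z\<in>A. if z = x then e x else 0)"
      by (intro sum.cong) (auto simp: basis_vec_def)
    then show ?thesis using that by simp
  qed
  have supp: "(\<Sum>z | r z \<noteq> 0. fscale (r z) (e z)) = (\<Sum>z\<in>A. fscale (r z) (e z))"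
    if "finite A" "\<And>z. z \<notin> A \<Longrightarrow> r z = 0" for A r
    using that by (intro sum.mono_neutral_left) auto
  show "(\<Sum>z | r z \<noteq> 0. fscale (r z) (e z)) = e x - e y - e w"
    if r: "r = basis_vec x - basis_vec y - basis_vec w"
  proof -
    have "(\<Sum>z | r z \<noteq> 0. fscale (r z) (e z)) = (\<Sum>z\<in>{x, y, w}. fscale (r z) (e z))"
      by (rule supp) (auto simp: r basis_vec_apply)
    also have "\<dots> = (\<Sum>z\<in>{x, y, w}. fscale (basis_vec x z) (e z)) -
        (\<Sum>z\<in>{x, y, w}. fscale (basis_vec y z) (e z)) - (\<Sum>z\<in>{x, y, w}. fscale (basis_vec w z) (e z))"
      by (simp only: r minus_apply fv.scale_left_diff_distrib sum_subtractf)
    also have "\<dots> = e x - e y - e w" by (subst (1 2 3) single) auto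
    finally show ?thesis .
  qed
  show "(\<Sum>z | r z \<noteq> 0. fscale (r z) (e z)) = e x - fscale c (e y)"
    if r: "r = basis_vec x - fscale c (basis_vec y)"
  proof -
    have "(\<Sum>z | r z \<noteq> 0. fscale (r z) (e z)) = (\<Sum>z\<in>{x, y}. fscale (r z) (e z))"
      by (rule supp) (auto simp: r basis_vec_apply)
    also have "\<dots> = (\<Sum>z\<in>{x, y}. fscale (basis_vec x z) (e z)) -
        fscale c (\<Sum>z\<in>{x, y}. fscale (basis_vec y z) (e z))"
      by (simp only: r minus_apply fscale_apply fv.scale_left_diff_distrib sum_subtractf
        fv.scale_scale[symmetric] fv.scale_sum_right)
    also have "\<dots> = e x - fscale c (e y)" by (subst (1 2) single) auto
    finally show ?thesis .
  qed
qed

lemma bilinear_rels_alt: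
  fixes V :: "('f::field, 'v, 'g) fg_module" and W :: "('f, 'w, 'h) fg_module"
  shows "bilinear_rels V W =
    {basis_vec (v \<oplus>\<^bsub>V\<^esub> v', w) - basis_vec (v, w) - basis_vec (v', w) | v v' w.
      v \<in> carrier V \<and> v' \<in> carrier V \<and> w \<in> carrier W} \<union>
    {basis_vec (v, w \<oplus>\<^bsub>W\<^esub> w') - basis_vec (v, w) - basis_vec (v, w') | v w w'.
      v \<in> carrier V \<and> w \<in> carrier W \<and> w' \<in> carrier W} \<union>
    {basis_vec (c \<odot>\<^bsub>V\<^esub> v, w) - fscale c (basis_vec (v, w)) | c v w. v \<in> carrier V \<and> w \<in> carrier W} \<union>
    {basis_vec (v, c \<odot>\<^bsub>W\<^esub> w) - fscale c (basis_vec (v, w)) | c v w. v \<in> carrier V \<and> w \<in> carrier W}"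
proof -
  have "(\<lambda>z. basis_vec x z - basis_vec y z - basis_vec w z) = basis_vec x - basis_vec y - (basis_vec w :: _ \<Rightarrow> 'f)"
    "(\<lambda>z. basis_vec x z - c * basis_vec y z) = basis_vec x - fscale c (basis_vec y :: _ \<Rightarrow> 'f)"
    for x y w :: "'v \<times> 'w" and c
    by (simp_all add: fun_eq_iff)
  then show ?thesis by (simp only: bilinear_rels_def)
qed

lemma bilinear_relsE:
  assumes "r \<in> bilinear_rels V W"
  obtains (add_left) v v' w where
      "r = basis_vec (v \<oplus>\<^bsub>V\<^esub> v', w) - basis_vec (v, w) - basis_vec (v', w)"
      "v \<in> carrier V" "v' \<in> carrier V" "w \<in> carrier W"
    | (add_right) v w w' where
      "r = basis_vec (v, w \<oplus>\<^bsub>W\<^esub> w') - basis_vec (v, w) - basis_vec (v, w')"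
      "v \<in> carrier V" "w \<in> carrier W" "w' \<in> carrier W"
    | (scale_left) c v w where
      "r = basis_vec (c \<odot>\<^bsub>V\<^esub> v, w) - fscale c (basis_vec (v, w))" "v \<in> carrier V" "w \<in> carrier W"
    | (scale_right) c v w where
      "r = basis_vec (v, c \<odot>\<^bsub>W\<^esub> w) - fscale c (basis_vec (v, w))" "v \<in> carrier V" "w \<in> carrier W"
  using assms unfolding bilinear_rels_alt Un_iff mem_Collect_eq
  by (elim disjE exE conjE) (rule add_left add_right scale_left scale_right; assumption)+

lemma trivial_rep_simps [simp]:
  "carrier trivial_rep = UNIV" "x \<oplus>\<^bsub>trivial_rep\<^esub> y = x + y" "c \<odot>\<^bsub>trivial_rep\<^esub> x = c * x"
  "act trivial_rep g x = x"
  by (simp_all add: trivial_rep_def)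

lemma span_cancel: "x - z \<in> fv.span R \<Longrightarrow> y - z \<in> fv.span R \<Longrightarrow> x - y \<in> fv.span R"
  by (drule (1) fv.span_diff) (simp only: diff_diff_eq2 diff_add_cancel)

text \<open>One half of the universal property of the tensor product: the linear extension of a
  bilinear \<open>e\<close> kills the relations.\<close>

lemma bilinear_rels_kernel:
  fixes V :: "('f::field, 'v, 'g) fg_module" and W :: "('f, 'w, 'h) fg_module" and e :: "'v \<times> 'w \<Rightarrow> 'y \<Rightarrow> 'f"
  assumes V: "\<And>v v'. v \<in> carrier V \<Longrightarrow> v' \<in> carrier V \<Longrightarrow> v \<oplus>\<^bsub>V\<^esub> v' \<in> carrier V"
      "\<And>c v. v \<in> carrier V \<Longrightarrow> c \<odot>\<^bsub>V\<^esub> v \<in> carrier V"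
    and W: "\<And>w w'. w \<in> carrier W \<Longrightarrow> w' \<in> carrier W \<Longrightarrow> w \<oplus>\<^bsub>W\<^esub> w' \<in> carrier W"
      "\<And>c w. w \<in> carrier W \<Longrightarrow> c \<odot>\<^bsub>W\<^esub> w \<in> carrier W"
    and e: "\<And>v v' w. v \<in> carrier V \<Longrightarrow> v' \<in> carrier V \<Longrightarrow> w \<in> carrier W \<Longrightarrow>
        e (v \<oplus>\<^bsub>V\<^esub> v', w) = e (v, w) + e (v', w)"
      "\<And>v w w'. v \<in> carrier V \<Longrightarrow> w \<in> carrier W \<Longrightarrow> w' \<in> carrier W \<Longrightarrow>
        e (v, w \<oplus>\<^bsub>W\<^esub> w') = e (v, w) + e (v, w')"
      "\<And>c v w. v \<in> carrier V \<Longrightarrow> w \<in> carrier W \<Longrightarrow> e (c \<odot>\<^bsub>V\<^esub> v, w) = fscale c (e (v, w))"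
      "\<And>c v w. v \<in> carrier V \<Longrightarrow> w \<in> carrier W \<Longrightarrow> e (v, c \<odot>\<^bsub>W\<^esub> w) = fscale c (e (v, w))"
    and r: "r \<in> bilinear_rels V W"
  shows "finite {x. r x \<noteq> 0} \<and> {x. r x \<noteq> 0} \<subseteq> carrier V \<times> carrier W"
    and "(\<Sum>x | r x \<noteq> 0. fscale (r x) (e x)) = 0"
proof -
  let ?I = "carrier V \<times> carrier W"
  let ?F = "{f :: 'v \<times> 'w \<Rightarrow> 'f. finite {x. f x \<noteq> 0} \<and> {x. f x \<noteq> 0} \<subseteq> ?I}"
  have sum3: "r \<in> ?F \<and> (\<Sum>x | r x \<noteq> 0. fscale (r x) (e x)) = 0"
    if "r = basis_vec x - basis_vec y - basis_vec z" "x \<in> ?I" "y \<in> ?I" "z \<in> ?I" "e x = e y + e z" for x y z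
  proof
    show "r \<in> ?F" unfolding that(1)
      by (intro fv.subspace_diff[OF subspace_fin_supp] fin_supp_basis that)
    show "(\<Sum>x | r x \<noteq> 0. fscale (r x) (e x)) = 0" unfolding free_sum_linear(1)[OF that(1)] that(5) by simp
  qed
  have sum2: "r \<in> ?F \<and> (\<Sum>x | r x \<noteq> 0. fscale (r x) (e x)) = 0"
    if "r = basis_vec x - fscale c (basis_vec y)" "x \<in> ?I" "y \<in> ?I" "e x = fscale c (e y)" for c x y
  proof
    show "r \<in> ?F" unfolding that(1)
      by (intro fv.subspace_diff[OF subspace_fin_supp] fv.subspace_scale[OF subspace_fin_supp] fin_supp_basis that)
    show "(\<Sum>x | r x \<noteq> 0. fscale (r x) (e x)) = 0" unfolding free_sum_linear(2)[OF that(1)] that(4) by simp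
  qed
  have "r \<in> ?F \<and> (\<Sum>x | r x \<noteq> 0. fscale (r x) (e x)) = 0"
    using r
  proof (cases rule: bilinear_relsE)
    case (add_left v v' w)
    then show ?thesis by (intro sum3[OF add_left(1)]) (simp_all add: V e)
  next
    case (add_right v w w')
    then show ?thesis by (intro sum3[OF add_right(1)]) (simp_all add: W e)
  next
    case (scale_left c v w)
    then show ?thesis by (intro sum2[OF scale_left(1)]) (simp_all add: V e)
  next
    case (scale_right c v w)
    then show ?thesis by (intro sum2[OF scale_right(1)]) (simp_all add: W e)
  qed
  then show "finite {x. r x \<noteq> 0} \<and> {x. r x \<noteq> 0} \<subseteq> ?I" "(\<Sum>x | r x \<noteq> 0. fscale (r x) (e x)) = 0"
    by simp_all
qed

text \<open>The pure tensor of v and c corresponds to c times the image of v, with the section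
  sending w to the tensor of its preimage and 1. \<open>H\<close> may be any group whose elements
  have first component in \<open>G\<close>, which covers restrictions to subgroups of a direct
  product.\<close>

lemma outer_tensor_trivial_right:
  fixes V :: "('f::field, 'v, 'g) fg_module" and H :: "('g \<times> 'h, 'z) monoid_scheme"
  assumes V: "module coeff_ring V" and C: "fv.subspace C"
    and closed: "\<And>g x. g \<in> carrier G \<Longrightarrow> x \<in> carrier V \<Longrightarrow> act V g x \<in> carrier V"
    and iso: "isomorphic_rep G V (frep C b)"
    and b: "\<And>g v w. b g (v + w) = b g v + b g w" "\<And>g c v. b g (fscale c v) = fscale c (b g v)"
    and H: "carrier H \<subseteq> carrier G \<times> UNIV"
  shows "closed_rep H (V \<boxtimes> (trivial_rep :: ('f, 'f, 'h) fg_module))" and "isomorphic_rep H (V \<boxtimes> (trivial_rep :: ('f, 'f, 'h) fg_module)) (frep C (\<lambda>(g, h). b g))"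
proof -
  interpret V: module coeff_ring V by fact
  let ?T = "trivial_rep :: ('f, 'f, 'h) fg_module"
  let ?I = "carrier V \<times> (UNIV :: 'f set)"
  let ?F = "perm_rep ?I (\<lambda>(g, h) (v, c). (act V g v, c)) :: ('f, _, 'g \<times> 'h) fg_module"
  let ?R = "bilinear_rels V ?T :: (_ \<Rightarrow> 'f) set"
  obtain \<phi> where \<phi>: "linear_bij V (frep C b) \<phi>"
    and act: "\<And>g x. g \<in> carrier G \<Longrightarrow> x \<in> carrier V \<Longrightarrow> \<phi> (act V g x) = b g (\<phi> x)"
    using iso by (rule isomorphic_repE) auto
  note add = linear_bijD(2)[OF \<phi>, unfolded frep_simps] and smult = linear_bijD(3)[OF \<phi>, unfolded frep_simps]
    and im = linear_bijD(4)[OF \<phi>, unfolded frep_simps]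
  obtain \<psi> where \<psi>: "linear_bij (frep C b) V \<psi>" "\<And>x. x \<in> carrier V \<Longrightarrow> \<psi> (\<phi> x) = x"
    "\<And>y. y \<in> carrier (frep C b) \<Longrightarrow> \<phi> (\<psi> y) = y"
    by (rule linear_bij_inv[OF \<phi> V.M.add.m_closed V.smult_closed]) auto
  note psi = linear_bijD(4)[OF \<psi>(1), unfolded frep_simps] \<psi>(3)[unfolded frep_simps] and psi' = \<psi>(2)
    and padd = linear_bijD(2)[OF \<psi>(1), unfolded frep_simps] and pscale = linear_bijD(3)[OF \<psi>(1), unfolded frep_simps]
  let ?e = "\<lambda>(v, c). fscale c (\<phi> v)"
  let ?s = "\<lambda>w. (\<psi> w, 1)"
  note rels = bilinear_rels_alt trivial_rep_simps
  have rel1: "basis_vec (v \<oplus>\<^bsub>V\<^esub> v', c) - basis_vec (v, c) - basis_vec (v', c) \<in> ?R"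
    if "v \<in> carrier V" "v' \<in> carrier V" for v v' c
    using that unfolding rels by blast
  have rel3: "basis_vec (d \<odot>\<^bsub>V\<^esub> v, c) - fscale d (basis_vec (v, c)) \<in> ?R" if "v \<in> carrier V" for v c d
    using that unfolding rels by blast
  have rel4: "basis_vec (v, d * c) - fscale d (basis_vec (v, c)) \<in> ?R" if "v \<in> carrier V" for v c d
    using that unfolding rels by blast
  have T: "V \<boxtimes> ?T = quot_rep ?F (lin_span ?F ?R)"
    by (simp add: outer_tensor_def Let_def trivial_rep_def)
  have ker: "(finite {x. r x \<noteq> 0} \<and> {x. r x \<noteq> 0} \<subseteq> carrier V \<times> carrier ?T) \<and>
      (\<Sum>x | r x \<noteq> 0. fscale (r x) (?e x)) = 0" if r: "r \<in> ?R" for r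
    by (intro conjI bilinear_rels_kernel[where e = ?e, OF _ _ _ _ _ _ _ _ r])
      (simp_all add: add smult fv.scale_left_distrib fv.scale_right_distrib mult.commute)
  then have supp: "finite {x. r x \<noteq> 0} \<and> {x. r x \<noteq> 0} \<subseteq> ?I"
    and zero: "(\<Sum>x | r x \<noteq> 0. fscale (r x) (?e x)) = 0" if "r \<in> ?R" for r
    using that unfolding trivial_rep_simps by blast+
  \<comment> \<open>Modulo the relations, v tensor c equals c times (v tensor 1), and this in turn
    equals (c v) tensor 1.\<close>
  have red: "basis_vec x - basis_vec (?s (?e x)) \<in> fv.span ?R" if xI: "x \<in> ?I" for x
  proof -
    obtain v c where x: "x = (v, c)" "v \<in> carrier V" using xI by auto
    have "?s (?e x) = (c \<odot>\<^bsub>V\<^esub> v, 1)" using x by (simp add: smult[symmetric] psi')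
    moreover have "basis_vec (v, c) - fscale c (basis_vec (v, 1)) \<in> fv.span ?R"
      "basis_vec (c \<odot>\<^bsub>V\<^esub> v, 1) - fscale c (basis_vec (v, 1)) \<in> fv.span ?R"
      using rel4[OF x(2), of c 1] rel3[OF x(2), of c 1] by (auto intro: fv.span_base)
    then have "basis_vec (v, c) - basis_vec (c \<odot>\<^bsub>V\<^esub> v, 1) \<in> fv.span ?R"
      by (rule span_cancel)
    ultimately show ?thesis by (simp add: x)
  qed
  note fq = free_module_quotient[where I = ?I and C = C and R = ?R and e = ?e and s = ?s and G = H
      and a = "\<lambda>(g, h) (v, c). (act V g v, c)" and b = "\<lambda>(g, h). b g", OF C _ _ _ supp zero red, folded T]
  have addr: "basis_vec (?s (v + w)) - basis_vec (?s v) - basis_vec (?s w) \<in> fv.span ?R"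
    if "v \<in> C" "w \<in> C" for v w
    using rel1[of "\<psi> v" "\<psi> w" 1] psi that by (auto simp: padd intro: fv.span_base)
  have scr: "basis_vec (?s (fscale c v)) - fscale c (basis_vec (?s v)) \<in> fv.span ?R" if "v \<in> C" for c v
    using rel3[of "\<psi> v" c 1] psi that by (auto simp: pscale intro: fv.span_base)
  show "closed_rep H (V \<boxtimes> ?T)"
    by (rule fq(1)) (use H in \<open>auto simp: im psi C fv.subspace_scale addr scr closed act b\<close>)
  show "isomorphic_rep H (V \<boxtimes> ?T) (frep C (\<lambda>(g, h). b g))"
    by (rule fq(2)) (use H in \<open>auto simp: im psi C fv.subspace_scale addr scr closed act b\<close>)
qed

text \<open>Mirror image of the preceding case, with the section sending w to the tensor of 1 and
  its preimage.\<close>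

lemma outer_tensor_trivial_left:
  fixes V :: "('f::field, 'v, 'g) fg_module" and H :: "('h \<times> 'g, 'z) monoid_scheme"
  assumes V: "module coeff_ring V" and C: "fv.subspace C"
    and closed: "\<And>g x. g \<in> carrier G \<Longrightarrow> x \<in> carrier V \<Longrightarrow> act V g x \<in> carrier V"
    and iso: "isomorphic_rep G V (frep C b)"
    and b: "\<And>g v w. b g (v + w) = b g v + b g w" "\<And>g c v. b g (fscale c v) = fscale c (b g v)"
    and H: "carrier H \<subseteq> UNIV \<times> carrier G"
  shows "closed_rep H ((trivial_rep :: ('f, 'f, 'h) fg_module) \<boxtimes> V)" and "isomorphic_rep H ((trivial_rep :: ('f, 'f, 'h) fg_module) \<boxtimes> V) (frep C (\<lambda>(h, g). b g))"
proof -
  interpret V: module coeff_ring V by fact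
  let ?T = "trivial_rep :: ('f, 'f, 'h) fg_module"
  let ?I = "(UNIV :: 'f set) \<times> carrier V"
  let ?F = "perm_rep ?I (\<lambda>(h, g) (c, v). (c, act V g v)) :: ('f, _, 'h \<times> 'g) fg_module"
  let ?R = "bilinear_rels ?T V :: (_ \<Rightarrow> 'f) set"
  obtain \<phi> where \<phi>: "linear_bij V (frep C b) \<phi>"
    and act: "\<And>g x. g \<in> carrier G \<Longrightarrow> x \<in> carrier V \<Longrightarrow> \<phi> (act V g x) = b g (\<phi> x)"
    using iso by (rule isomorphic_repE) auto
  note add = linear_bijD(2)[OF \<phi>, unfolded frep_simps] and smult = linear_bijD(3)[OF \<phi>, unfolded frep_simps]
    and im = linear_bijD(4)[OF \<phi>, unfolded frep_simps]
  obtain \<psi> where \<psi>: "linear_bij (frep C b) V \<psi>" "\<And>x. x \<in> carrier V \<Longrightarrow> \<psi> (\<phi> x) = x"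
    "\<And>y. y \<in> carrier (frep C b) \<Longrightarrow> \<phi> (\<psi> y) = y"
    by (rule linear_bij_inv[OF \<phi> V.M.add.m_closed V.smult_closed]) auto
  note psi = linear_bijD(4)[OF \<psi>(1), unfolded frep_simps] \<psi>(3)[unfolded frep_simps] and psi' = \<psi>(2)
    and padd = linear_bijD(2)[OF \<psi>(1), unfolded frep_simps] and pscale = linear_bijD(3)[OF \<psi>(1), unfolded frep_simps]
  let ?e = "\<lambda>(c, v). fscale c (\<phi> v)"
  let ?s = "\<lambda>w. (1, \<psi> w)"
  note rels = bilinear_rels_alt trivial_rep_simps
  have rel1: "basis_vec (c, v \<oplus>\<^bsub>V\<^esub> v') - basis_vec (c, v) - basis_vec (c, v') \<in> ?R"
    if "v \<in> carrier V" "v' \<in> carrier V" for v v' c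
    using that unfolding rels by blast
  have rel3: "basis_vec (c, d \<odot>\<^bsub>V\<^esub> v) - fscale d (basis_vec (c, v)) \<in> ?R" if "v \<in> carrier V" for v c d
    using that unfolding rels by blast
  have rel4: "basis_vec (d * c, v) - fscale d (basis_vec (c, v)) \<in> ?R" if "v \<in> carrier V" for v c d
    using that unfolding rels by blast
  have T: "?T \<boxtimes> V = quot_rep ?F (lin_span ?F ?R)"
    by (simp add: outer_tensor_def Let_def trivial_rep_def)
  have ker: "(finite {x. r x \<noteq> 0} \<and> {x. r x \<noteq> 0} \<subseteq> carrier ?T \<times> carrier V) \<and>
      (\<Sum>x | r x \<noteq> 0. fscale (r x) (?e x)) = 0" if r: "r \<in> ?R" for r
    by (intro conjI bilinear_rels_kernel[where e = ?e, OF _ _ _ _ _ _ _ _ r])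
      (simp_all add: add smult fv.scale_left_distrib fv.scale_right_distrib mult.commute)
  then have supp: "finite {x. r x \<noteq> 0} \<and> {x. r x \<noteq> 0} \<subseteq> ?I"
    and zero: "(\<Sum>x | r x \<noteq> 0. fscale (r x) (?e x)) = 0" if "r \<in> ?R" for r
    using that unfolding trivial_rep_simps by blast+
  have red: "basis_vec x - basis_vec (?s (?e x)) \<in> fv.span ?R" if xI: "x \<in> ?I" for x
  proof -
    obtain v c where x: "x = (c, v)" "v \<in> carrier V" using xI by auto
    have "?s (?e x) = (1, c \<odot>\<^bsub>V\<^esub> v)" using x by (simp add: smult[symmetric] psi')
    moreover have "basis_vec (c, v) - fscale c (basis_vec (1, v)) \<in> fv.span ?R"
      "basis_vec (1, c \<odot>\<^bsub>V\<^esub> v) - fscale c (basis_vec (1, v)) \<in> fv.span ?R"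
      using rel4[OF x(2), of c 1] rel3[OF x(2), of 1 c] by (auto intro: fv.span_base)
    then have "basis_vec (c, v) - basis_vec (1, c \<odot>\<^bsub>V\<^esub> v) \<in> fv.span ?R"
      by (rule span_cancel)
    ultimately show ?thesis by (simp add: x)
  qed
  note fq = free_module_quotient[where I = ?I and C = C and R = ?R and e = ?e and s = ?s and G = H
      and a = "\<lambda>(h, g) (c, v). (c, act V g v)" and b = "\<lambda>(h, g). b g", OF C _ _ _ supp zero red, folded T]
  have addr: "basis_vec (?s (v + w)) - basis_vec (?s v) - basis_vec (?s w) \<in> fv.span ?R"
    if "v \<in> C" "w \<in> C" for v w
    using rel1[of "\<psi> v" "\<psi> w" 1] psi that by (auto simp: padd intro: fv.span_base)
  have scr: "basis_vec (?s (fscale c v)) - fscale c (basis_vec (?s v)) \<in> fv.span ?R" if "v \<in> C" for c v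
    using rel3[of "\<psi> v" 1 c] psi that by (auto simp: pscale intro: fv.span_base)
  show "closed_rep H (?T \<boxtimes> V)"
    by (rule fq(1)) (use H in \<open>auto simp: im psi C fv.subspace_scale addr scr closed act b\<close>)
  show "isomorphic_rep H (?T \<boxtimes> V) (frep C (\<lambda>(h, g). b g))"
    by (rule fq(2)) (use H in \<open>auto simp: im psi C fv.subspace_scale addr scr closed act b\<close>)
qed

section \<open>Schur's lemma and 2-transitivity\<close>

definition poly_op :: "(('x \<Rightarrow> 'f) \<Rightarrow> 'x \<Rightarrow> 'f) \<Rightarrow> 'f::field poly \<Rightarrow> ('x \<Rightarrow> 'f) \<Rightarrow> 'x \<Rightarrow> 'f"
  where "poly_op T p x = fold_coeffs (\<lambda>a y. fscale a x + T y) p 0"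

lemma in_span_basis_vec:
  assumes A: "finite A" and f: "\<And>x. x \<notin> A \<Longrightarrow> f x = 0"
  shows "f \<in> fv.span (basis_vec ` A)"
proof -
  have "f = (\<Sum>x\<in>A. fscale (f x) (basis_vec x))"
  proof
    fix y
    have "(\<Sum>x\<in>A. fscale (f x) (basis_vec x)) y = (\<Sum>x\<in>A. if x = y then f y else 0)"
      unfolding sum_fun_apply by (intro sum.cong) (auto simp: basis_vec_def)
    then show "f y = (\<Sum>x\<in>A. fscale (f x) (basis_vec x)) y" using A f by simp
  qed
  moreover have "(\<Sum>x\<in>A. fscale (f x) (basis_vec x)) \<in> fv.span (basis_vec ` A)"
    by (intro fv.span_sum fv.span_scale fv.span_base) blast
  ultimately show ?thesis by simp
qed

text \<open>Linearity is asked on \<open>U\<close> only, as befits operators built from an abstract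
  isomorphism whose values elsewhere are arbitrary.\<close>

locale subspace_endo =
  fixes U :: "('x \<Rightarrow> 'f::field) set" and T :: "('x \<Rightarrow> 'f) \<Rightarrow> 'x \<Rightarrow> 'f"
  assumes U: "fv.subspace U"
    and closed: "f \<in> U \<Longrightarrow> T f \<in> U"
    and add: "f \<in> U \<Longrightarrow> h \<in> U \<Longrightarrow> T (f + h) = T f + T h"
    and scale: "f \<in> U \<Longrightarrow> T (fscale c f) = fscale c (T f)"
begin

lemma zero: "T 0 = 0"
  using scale[of 0 0] fv.subspace_0[OF U] by simp

lemma poly_op_0 [simp]: "poly_op T 0 x = 0"
  by (simp add: poly_op_def)

text \<open>Horner's rule. For the zero polynomial \<open>fold_coeffs\<close> takes no step, and the
  equation rests on \<open>T 0 = 0\<close>.\<close>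

lemma poly_op_pCons: "poly_op T (pCons a p) x = fscale a x + T (poly_op T p x)"
proof (cases "a = 0 \<and> p = 0")
  case True
  then show ?thesis using zero by simp
next
  case False
  then have "poly_op T (pCons a p) x = ((\<lambda>a y. fscale a x + T y) a \<circ> fold_coeffs (\<lambda>a y. fscale a x + T y) p) 0"
    unfolding poly_op_def
    by (cases "a = 0") (simp_all only: fold_coeffs_pCons_not_0_0_eq fold_coeffs_pCons_coeff_not_0_eq simp_thms not_False_eq_True)
  then show ?thesis by (simp only: comp_apply poly_op_def)
qed

lemma poly_op_closed: "x \<in> U \<Longrightarrow> poly_op T p x \<in> U"
proof (induction p)
  case 0
  show ?case using fv.subspace_0[OF U] by (simp only: poly_op_0)
next
  case (pCons a p)
  then show ?case
    unfolding poly_op_pCons by (intro fv.subspace_add[OF U] fv.subspace_scale[OF U] closed)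
qed

lemma poly_op_add: "x \<in> U \<Longrightarrow> poly_op T (p + q) x = poly_op T p x + poly_op T q x"
proof (induction p q rule: poly_induct2)
  case (pCons a p b q)
  then have IH: "poly_op T (p + q) x = poly_op T p x + poly_op T q x" by blast
  show ?case
    unfolding add_pCons poly_op_pCons IH
      add[OF poly_op_closed[OF pCons.prems] poly_op_closed[OF pCons.prems]] fv.scale_left_distrib
    by (simp only: ac_simps)
qed (simp only: poly_op_0 add_0_left)

lemma poly_op_smult: "x \<in> U \<Longrightarrow> poly_op T (smult c p) x = fscale c (poly_op T p x)"
proof (induction p)
  case (pCons a p)
  then have IH: "poly_op T (smult c p) x = fscale c (poly_op T p x)" by blast
  show ?case
    unfolding smult_pCons poly_op_pCons IH scale[OF poly_op_closed[OF pCons.prems]]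
      fv.scale_right_distrib fv.scale_scale ..
qed (simp only: smult_0_right poly_op_0 fv.scale_zero_right)

text \<open>If the left-hand side vanishes, then \<open>poly_op T q x\<close> is either zero or an
  eigenvector for c.\<close>

lemma poly_op_linear_factor:
  assumes x: "x \<in> U"
  shows "poly_op T ([:- c, 1:] * q) x = T (poly_op T q x) - fscale c (poly_op T q x)"
proof -
  have "[:- c, 1:] * q = pCons 0 q + smult (- c) q" by simp
  then show ?thesis
    by (simp only: poly_op_add[OF x] poly_op_smult[OF x] poly_op_pCons fv.scale_zero_left
      fv.scale_minus_left add_0_left diff_conv_add_uminus)
qed

lemma poly_op_monom: "x \<in> U \<Longrightarrow> poly_op T (monom c i) x = fscale c ((T ^^ i) x)"
proof (induction i)
  case 0
  then show ?case by (simp only: monom_0 poly_op_pCons poly_op_0 zero funpow_0 add_0_right)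
next
  case (Suc i)
  then have IH: "poly_op T (monom c i) x = fscale c ((T ^^ i) x)" by blast
  have "(T ^^ i) x \<in> U" using Suc.prems closed by (induction i) auto
  then show ?case
    by (simp only: monom_Suc poly_op_pCons IH scale fv.scale_zero_left add_0_left funpow.simps comp_apply)
qed

lemma poly_op_sum: "x \<in> U \<Longrightarrow> poly_op T (\<Sum>i\<in>I. p i) x = (\<Sum>i\<in>I. poly_op T (p i) x)"
  by (induction I rule: infinite_finite_induct)
    (simp_all only: sum.infinite sum.empty sum.insert poly_op_0 poly_op_add not_False_eq_True)

text \<open>The first \<open>card A + 1\<close> iterates of x lie in a space spanned by
  \<open>card A\<close> basis vectors, so they satisfy a linear relation, whose coefficients form
  the polynomial.\<close>

lemma annihilator_exists:
  assumes A: "finite A" "\<And>f y. f \<in> U \<Longrightarrow> y \<notin> A \<Longrightarrow> f y = 0" and x: "x \<in> U"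
  shows "\<exists>p. p \<noteq> 0 \<and> poly_op T p x = 0"
proof -
  define v where "v i = (T ^^ i) x" for i
  let ?N = "{..card A}"
  have vU: "v i \<in> U" for i unfolding v_def using x closed by (induction i) auto
  show ?thesis
  proof (cases "inj_on v ?N")
    \<comment> \<open>Coinciding iterates are invisible to linear dependence of a set of vectors,
      but they give an annihilator directly: the difference of two powers.\<close>
    case False
    then obtain i j where ij: "i \<noteq> j" "v i = v j" by (auto simp: inj_on_def)
    have "poly_op T (monom 1 i + monom (-1) j) x = fscale 1 (v i) + fscale (-1) (v j)"
      by (simp only: poly_op_add[OF x] poly_op_monom[OF x] v_def)
    also have "\<dots> = 0" using ij by simp
    finally have "poly_op T (monom 1 i + monom (-1) j) x = 0" .
    moreover have "coeff (monom 1 i + monom (-1) j :: 'f poly) i \<noteq> 0" using ij by simp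
    then have "monom 1 i + monom (-1) j \<noteq> (0 :: 'f poly)" by (metis coeff_0)
    ultimately show ?thesis by blast
  next
    case True
    have "v ` ?N \<subseteq> fv.span (basis_vec ` A)"
      using in_span_basis_vec[OF A(1)] A(2) vU by blast
    moreover have "card (basis_vec ` A :: ('x \<Rightarrow> 'f) set) < card (v ` ?N)"
      using card_image_le[OF A(1), of "basis_vec :: 'x \<Rightarrow> 'x \<Rightarrow> 'f"] card_image[OF True] by simp
    ultimately have "fv.dependent (v ` ?N)"
      using fv.independent_span_bound[of "basis_vec ` A" "v ` ?N"] A(1) by auto
    then obtain u k where u: "k \<in> ?N" "u (v k) \<noteq> 0" "(\<Sum>w\<in>v ` ?N. fscale (u w) w) = 0"
      by (auto simp: fv.dependent_finite)
    define p where "p = (\<Sum>i\<in>?N. monom (u (v i)) i)"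
    have "poly_op T p x = (\<Sum>i\<in>?N. fscale (u (v i)) (v i))"
      by (simp only: p_def poly_op_sum[OF x] poly_op_monom[OF x] v_def)
    also have "\<dots> = 0" using u(3) by (subst (asm) sum.reindex[OF True]) (simp only: o_def)
    finally have "poly_op T p x = 0" .
    moreover have "coeff p k = u (v k)"
      using u(1) by (simp add: p_def coeff_sum)
    then have "p \<noteq> 0" using u(2) by auto
    ultimately show ?thesis by blast
  qed
qed

end

text \<open>Split off a root c, so that p = (X - c) q. Either q(T) x is nonzero and an eigenvector,
  or q is an annihilator of smaller degree. Degree 0 cannot occur, as x is nonzero.\<close>

lemma (in subspace_endo) eigenvector_from_annihilator:
  assumes roots: "\<And>q :: 'f poly. degree q > 0 \<Longrightarrow> \<exists>c. poly q c = 0"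
    and x: "x \<in> U" "x \<noteq> 0"
  shows "p \<noteq> 0 \<Longrightarrow> poly_op T p x = 0 \<Longrightarrow> \<exists>c f. f \<in> U \<and> f \<noteq> 0 \<and> T f = fscale c f"
proof (induction "degree p" arbitrary: p rule: less_induct)
  case less
  show ?case
  proof (cases "degree p = 0")
    case True
    then obtain a where a: "p = [:a:]" by (rule degree_eq_zeroE)
    have "fscale a x = 0" using less.prems(2) unfolding a poly_op_pCons poly_op_0 zero by simp
    then show ?thesis using less.prems(1) a x(2) by simp
  next
    case False
    then obtain c where "poly p c = 0" using roots[of p] by auto
    then obtain q where q: "p = [:- c, 1:] * q" unfolding poly_eq_0_iff_dvd by (rule dvdE)
    have eq: "T (poly_op T q x) = fscale c (poly_op T q x)"
      using less.prems(2) unfolding q poly_op_linear_factor[OF x(1)] by (simp only: right_minus_eq)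
    have q0: "q \<noteq> 0" using less.prems(1) q by auto
    show ?thesis
    proof (cases "poly_op T q x = 0")
      case True
      have "degree p = Suc (degree q)" unfolding q using q0 by (subst degree_mult_eq) auto
      then show ?thesis using less.hyps[of q] q0 True by simp
    next
      case False
      then show ?thesis using eq poly_op_closed[OF x(1)] by blast
    qed
  qed
qed

section \<open>Simplicity under a set of permutations, and Schur's lemma\<close>

definition simple_under :: "(nat \<Rightarrow> nat) set \<Rightarrow> (nat \<Rightarrow> 'f::field) set \<Rightarrow> bool"
  where "simple_under P U \<longleftrightarrow> U \<noteq> {0} \<and>
    (\<forall>U'. U' \<subseteq> U \<longrightarrow> fv.subspace U' \<longrightarrow> (\<forall>p\<in>P. \<forall>f\<in>U'. pact p f \<in> U') \<longrightarrow> U' = {0} \<or> U' = U)"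

lemma simple_underD:
  assumes "simple_under P U" "U' \<subseteq> U" "fv.subspace U'" "\<And>p f. p \<in> P \<Longrightarrow> f \<in> U' \<Longrightarrow> pact p f \<in> U'"
  shows "U' = {0} \<or> U' = U"
  using assms unfolding simple_under_def by blast

lemma irreducible_rep_pact:
  assumes "subgroup P (sym_group n)" "fv.subspace U" "\<And>p f. p \<in> P \<Longrightarrow> f \<in> U \<Longrightarrow> pact p f \<in> U"
  shows "irreducible_rep ((sym_group n)\<lparr>carrier := P\<rparr>) (frep U pact) \<longleftrightarrow> simple_under P U"
  using irreducible_rep_frep[OF rep_pact[OF assms] assms(2)] by (simp add: simple_under_def)

text \<open>An eigenspace of \<open>T\<close> is invariant and nonzero, hence all of
  \<open>U\<close>. The common finite support \<open>A\<close> provides finite dimension and thereby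
  an eigenvector.\<close>

lemma schur:
  fixes U :: "(nat \<Rightarrow> 'f::alg_closed_field) set"
  assumes U: "fv.subspace U" "simple_under P U" "\<And>p f. p \<in> P \<Longrightarrow> f \<in> U \<Longrightarrow> pact p f \<in> U"
    and A: "finite A" "\<And>f y. f \<in> U \<Longrightarrow> y \<notin> A \<Longrightarrow> f y = 0"
    and T: "\<And>f. f \<in> U \<Longrightarrow> T f \<in> U" "\<And>f h. f \<in> U \<Longrightarrow> h \<in> U \<Longrightarrow> T (f + h) = T f + T h"
      "\<And>c f. f \<in> U \<Longrightarrow> T (fscale c f) = fscale c (T f)"
      "\<And>p f. p \<in> P \<Longrightarrow> f \<in> U \<Longrightarrow> T (pact p f) = pact p (T f)"
  shows "\<exists>c. \<forall>f\<in>U. T f = fscale c f"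
proof -
  interpret endo: subspace_endo U T by unfold_locales (use U T in auto)
  have "U \<noteq> {0}" using U(2) by (simp add: simple_under_def)
  then obtain x where x: "x \<in> U" "x \<noteq> 0" using fv.subspace_0[OF U(1)] by blast
  obtain p where "p \<noteq> 0" "poly_op T p x = 0" using endo.annihilator_exists[of A x] A x(1) by blast
  then obtain c f where f: "f \<in> U" "f \<noteq> 0" "T f = fscale c f"
    using endo.eigenvector_from_annihilator[OF alg_closed_imp_poly_has_root x] by blast
  define W where "W = {f \<in> U. T f = fscale c f}"
  have "W = {0} \<or> W = U"
  proof (rule simple_underD[OF U(2)])
    show "W \<subseteq> U" by (auto simp: W_def)
    show "fv.subspace W"
      unfolding W_def fv.subspace_def using U(1)
      by (auto simp: fv.subspace_0 fv.subspace_add fv.subspace_scale T endo.zero fv.scale_right_distrib mult.commute)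
    show "pact p f \<in> W" if "p \<in> P" "f \<in> W" for p f
      using that U(3) T(4) by (simp add: W_def pact_scale)
  qed
  moreover have "f \<in> W" using f by (simp add: W_def)
  ultimately have "W = U" using f(2) by auto
  then show ?thesis unfolding W_def by blast
qed

lemma sym_subgroupD:
  assumes P: "subgroup P (sym_group m)"
  shows "p \<in> P \<Longrightarrow> p permutes {1..m}" and "p \<in> P \<Longrightarrow> q \<in> P \<Longrightarrow> p \<circ> q \<in> P"
    and "p \<in> P \<Longrightarrow> inv' p \<in> P" and "id \<in> P"
  using subgroup.subset[OF P] subgroup.m_closed[OF P] subgroup.m_inv_closed[OF P] subgroup.one_closed[OF P]
  by (auto simp: sym_group_carrier sym_group_mult sym_group_one subset_iff)

text \<open>If y is not in the orbit of x, a suitable combination of the indicator of that orbit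
  with a constant is a fixed zero-sum vector. It is nonzero because m is nonzero in the field, so it
  spans an invariant line; but with at least three letters the zero-sum space is not a line.\<close>

lemma simple_transitive:
  assumes P: "subgroup P (sym_group m)" and m: "m \<ge> 3" "of_nat m \<noteq> (0 :: 'f::field)"
    and simple: "simple_under P (zero_sum {1..m} :: (nat \<Rightarrow> 'f) set)"
    and xy: "x \<in> {1..m}" "y \<in> {1..m}"
  shows "\<exists>p\<in>P. p x = y"
proof (rule ccontr)
  assume contra: "\<not> (\<exists>p\<in>P. p x = y)"
  note perm = sym_subgroupD(1)[OF P] and comp = sym_subgroupD(2)[OF P] and inv = sym_subgroupD(3)[OF P] and one = sym_subgroupD(4)[OF P]
  define Orb where "Orb = (\<lambda>p. p x) ` P"
  have Orb: "Orb \<subseteq> {1..m}" "x \<in> Orb" "y \<notin> Orb"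
  proof -
    show "Orb \<subseteq> {1..m}" using permutes_in_image[OF perm] xy(1) unfolding Orb_def by blast
    show "x \<in> Orb" unfolding Orb_def using one by (intro image_eqI[of _ _ id]) auto
    show "y \<notin> Orb" using contra unfolding Orb_def by blast
  qed
  have Orb_inv: "p z \<in> Orb \<longleftrightarrow> z \<in> Orb" if p: "p \<in> P" for p z
  proof
    assume "z \<in> Orb"
    then obtain q where "q \<in> P" "z = q x" unfolding Orb_def by blast
    then show "p z \<in> Orb" using comp[OF p] unfolding Orb_def by (intro image_eqI[of _ _ "p \<circ> q"]) auto
  next
    assume "p z \<in> Orb"
    then obtain q where q: "q \<in> P" "p z = q x" unfolding Orb_def by blast
    have "z = (inv' p \<circ> q) x" using q permutes_inverses(2)[OF perm[OF p]] by (metis comp_apply)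
    then show "z \<in> Orb" using comp[OF inv[OF p] q(1)] unfolding Orb_def by blast
  qed
  \<comment> \<open>The orbit indicator is scaled by m and corrected by the orbit size, which makes
    the total zero without a division.\<close>
  define w :: "nat \<Rightarrow> 'f" where
    "w = (\<lambda>z. if z \<in> {1..m} then (if z \<in> Orb then of_nat m else 0) - of_nat (card Orb) else 0)"
  have "sum w {1..m} = (\<Sum>z\<in>{1..m}. (if z \<in> Orb then of_nat m else 0) - of_nat (card Orb))"
    by (simp add: w_def)
  also have "\<dots> = (\<Sum>z\<in>{1..m}. (if z \<in> Orb then of_nat m else 0)) - of_nat m * of_nat (card Orb)"
    by (simp add: sum_subtractf)
  also have "(\<Sum>z\<in>{1..m}. (if z \<in> Orb then of_nat m else 0)) = (\<Sum>z\<in>Orb. of_nat m :: 'f)"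
    using Orb(1) by (simp add: sum.If_cases Int_absorb1)
  finally have "sum w {1..m} = 0" by simp
  then have wZ: "w \<in> zero_sum {1..m}" by (simp add: zero_sum_def w_def)
  have w_inv: "pact p w = w" if p: "p \<in> P" for p
  proof
    fix z
    have "inv' p z \<in> {1..m} \<longleftrightarrow> z \<in> {1..m}" "inv' p z \<in> Orb \<longleftrightarrow> z \<in> Orb"
      using permutes_in_image[OF perm[OF inv[OF p]]] Orb_inv[OF inv[OF p]] by auto
    then show "pact p w z = w z" by (simp add: pact_def w_def)
  qed
  let ?U = "range (\<lambda>c. fscale c w)"
  have or: "?U = {0} \<or> ?U = zero_sum {1..m}"
  proof (rule simple_underD[OF simple])
    show "?U \<subseteq> zero_sum {1..m}" using wZ subspace_zero_sum[of "{1..m}"] by (auto intro: fv.subspace_scale)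
    have "fscale a w + fscale b w \<in> ?U" for a b by (rule range_eqI[of _ _ "a + b"]) (simp add: fv.scale_left_distrib)
    moreover have "0 \<in> ?U" by (rule range_eqI[of _ _ 0]) simp
    moreover have "fscale a (fscale b w) \<in> ?U" for a b by (rule range_eqI[of _ _ "a * b"]) simp
    ultimately show "fv.subspace ?U" unfolding fv.subspace_def by auto
    show "pact p f \<in> ?U" if "p \<in> P" "f \<in> ?U" for p f using that w_inv by (auto simp: pact_scale)
  qed
  have wx: "w x - w y \<noteq> 0" using Orb xy m by (simp add: w_def)
  have "w \<in> ?U" by (rule range_eqI[of _ _ 1]) simp
  moreover have "w \<noteq> 0" using wx by auto
  ultimately have "?U \<noteq> {0}" by blast
  with or have U: "?U = zero_sum {1..m}" by blast
  have "\<exists>z\<in>{1, 2, 3}. z \<noteq> x \<and> z \<noteq> y"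
    by (cases "x = 1 \<or> y = 1"; cases "x = 2 \<or> y = 2") auto
  then obtain z where "z \<in> {1, 2, 3}" and zxy: "z \<noteq> x" "z \<noteq> y" by blast
  then have "z \<in> {1..m}" using m(1) by auto
  note z = this zxy
  \<comment> \<open>All zero-sum functions would be multiples of \<open>w\<close>, which agrees at i
    and z. The difference for i and l takes the values 1 at i and 0 at z. One of x and y can serve
    as i, according to the side of the orbit on which z lies.\<close>
  have const: False if "i \<in> {1..m}" "i \<noteq> z" "(i \<in> Orb \<longleftrightarrow> z \<in> Orb)" "l \<in> {1..m}" "l \<noteq> i" "l \<noteq> z" for i l
  proof -
    have "basis_vec i - basis_vec l \<in> ?U" unfolding U using that by (intro basis_diff_in_zero_sum) auto
    then obtain c where "basis_vec i - basis_vec l = fscale c w" by blast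
    then have "(basis_vec i - basis_vec l) i = c * w i" "(basis_vec i - basis_vec l) z = c * w z" by simp_all
    moreover have "w i = w z" using that z by (simp add: w_def)
    ultimately show False using that by (simp add: basis_vec_def)
  qed
  show False using const[of x y] const[of y x] z xy Orb by (cases "z \<in> Orb") auto
qed

text \<open>If the operator of an orbital is a scalar on zero-sum functions, each row of its matrix
  is constant off the diagonal. So the orbital contains every pair (u, w) of distinct letters once
  it contains one with the same u, and transitivity handles the first entry.\<close>

lemma simple_two_transitive:
  fixes P :: "(nat \<Rightarrow> nat) set"
  assumes P: "subgroup P (sym_group m)" and m: "m \<ge> 3" "of_nat m \<noteq> (0 :: 'f::alg_closed_field)"
    and simple: "simple_under P (zero_sum {1..m} :: (nat \<Rightarrow> 'f) set)"
  shows "two_transitive_on P {1..m}"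
  unfolding two_transitive_on_def
proof (intro ballI impI)
  let ?\<Omega> = "{1..m}"
  fix x x' y y' assume xy: "x \<in> ?\<Omega>" "x' \<in> ?\<Omega>" "y \<in> ?\<Omega>" "y' \<in> ?\<Omega>" "x \<noteq> x'" "y \<noteq> y'"
  note perm = sym_subgroupD(1)[OF P] and comp = sym_subgroupD(2)[OF P] and inv = sym_subgroupD(3)[OF P] and one = sym_subgroupD(4)[OF P]
  define Orb where "Orb = (\<lambda>p. (p x, p x')) ` P"
  have Orb_inv: "(p u, p v) \<in> Orb" if p: "p \<in> P" and uv: "(u, v) \<in> Orb" for p u v
  proof -
    obtain q where "q \<in> P" "u = q x" "v = q x'" using uv unfolding Orb_def by blast
    then show ?thesis using comp[OF p] unfolding Orb_def by (intro image_eqI[of _ _ "p \<circ> q"]) auto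
  qed
  define a :: "nat \<Rightarrow> nat \<Rightarrow> 'f" where "a u v = (if (u, v) \<in> Orb then 1 else 0)" for u v
  have a_inv: "a (p u) (p v) = a u v" if p: "p \<in> P" for p u v
    using Orb_inv[OF p, of u v] Orb_inv[OF inv[OF p], of "p u" "p v"] permutes_inverses(2)[OF perm[OF p]]
    by (auto simp: a_def)
  define T where "T f = (\<lambda>u. if u \<in> ?\<Omega> then \<Sum>v\<in>?\<Omega>. a u v * f v else 0)" for f :: "nat \<Rightarrow> 'f"
  \<comment> \<open>Transitivity makes all column sums equal, and this is why \<open>T\<close>
    preserves the zero-sum functions.\<close>
  have col: "(\<Sum>u\<in>?\<Omega>. a u v) = (\<Sum>u\<in>?\<Omega>. a u x)" if v: "v \<in> ?\<Omega>" for v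
  proof -
    obtain p where p: "p \<in> P" "p x = v" using simple_transitive[OF P m simple xy(1) v] by blast
    have "(\<Sum>u\<in>?\<Omega>. a u v) = (\<Sum>u\<in>?\<Omega>. a (p u) v)" using sum.permute[OF perm[OF p(1)], of "\<lambda>u. a u v"] by simp
    also have "\<dots> = (\<Sum>u\<in>?\<Omega>. a u x)" using a_inv[OF p(1)] p(2) by (intro sum.cong) auto
    finally show ?thesis .
  qed
  have TZ: "T f \<in> zero_sum ?\<Omega>" if f: "f \<in> zero_sum ?\<Omega>" for f
  proof -
    have "sum (T f) ?\<Omega> = (\<Sum>u\<in>?\<Omega>. \<Sum>v\<in>?\<Omega>. a u v * f v)" by (simp add: T_def)
    also have "\<dots> = (\<Sum>v\<in>?\<Omega>. \<Sum>u\<in>?\<Omega>. a u v * f v)" by (rule sum.swap)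
    also have "\<dots> = (\<Sum>v\<in>?\<Omega>. (\<Sum>u\<in>?\<Omega>. a u v) * f v)" by (simp only: sum_distrib_right)
    also have "\<dots> = (\<Sum>v\<in>?\<Omega>. (\<Sum>u\<in>?\<Omega>. a u x) * f v)" by (rule sum.cong[OF refl]) (simp only: col)
    also have "\<dots> = (\<Sum>u\<in>?\<Omega>. a u x) * (\<Sum>v\<in>?\<Omega>. f v)" by (simp only: sum_distrib_left)
    also have "\<dots> = 0" using f by (simp add: zero_sum_def)
    finally show ?thesis by (simp add: zero_sum_def T_def)
  qed
  have Tact: "T (pact p f) = pact p (T f)" if p: "p \<in> P" for p f
  proof
    fix u
    have iu: "inv' p u \<in> ?\<Omega> \<longleftrightarrow> u \<in> ?\<Omega>" using permutes_in_image[OF perm[OF inv[OF p]]] .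
    have "(\<Sum>v\<in>?\<Omega>. a u v * f (inv' p v)) = (\<Sum>v\<in>?\<Omega>. a (inv' p u) (inv' p v) * f (inv' p v))"
      using a_inv[OF inv[OF p]] by simp
    also have "\<dots> = (\<Sum>v\<in>?\<Omega>. a (inv' p u) v * f v)"
      using sum.permute[OF perm[OF inv[OF p]], of "\<lambda>v. a (inv' p u) v * f v"] by (simp add: o_def)
    finally show "T (pact p f) u = pact p (T f) u" using iu by (simp add: T_def pact_def)
  qed
  have "\<exists>c. \<forall>f\<in>zero_sum ?\<Omega>. T f = fscale c f"
  proof (rule schur[OF subspace_zero_sum simple, where A = ?\<Omega>])
    show "pact p f \<in> zero_sum ?\<Omega>" if "p \<in> P" "f \<in> zero_sum ?\<Omega>" for p f
      using zero_sum_pact[OF permutes_bij[OF perm[OF that(1)]] that(2)] permutes_image[OF perm[OF that(1)]] by simp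
    show "f y = 0" if "f \<in> zero_sum ?\<Omega>" "y \<notin> ?\<Omega>" for f y using that by (simp add: zero_sum_def)
    show "T (f + h) = T f + T h" for f h by (auto simp: T_def fun_eq_iff algebra_simps sum.distrib)
    show "T (fscale c f) = fscale c (T f)" for c f by (auto simp: T_def fun_eq_iff algebra_simps sum_distrib_left)
  qed (simp_all only: TZ Tact finite_atLeastAtMost)
  then obtain c where c: "\<And>f. f \<in> zero_sum ?\<Omega> \<Longrightarrow> T f = fscale c f" by blast
  \<comment> \<open>For u outside {v, w} the scalar multiple of the difference of basis vectors
    vanishes at u, which equates the entries (u, v) and (u, w) of the matrix.\<close>
  have step: "(u, w) \<in> Orb" if "(u, v) \<in> Orb" "u \<in> ?\<Omega>" "v \<in> ?\<Omega>" "w \<in> ?\<Omega>" "u \<noteq> v" "u \<noteq> w" for u v w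
  proof -
    have "T (basis_vec v - basis_vec w) u = c * (basis_vec v - basis_vec w) u"
      using c[OF basis_diff_in_zero_sum[of ?\<Omega> v w]] that by simp
    then have "T (basis_vec v - basis_vec w) u = 0" using that by (simp add: basis_vec_def)
    moreover have "T (basis_vec v - basis_vec w) u = (\<Sum>z\<in>?\<Omega>. a u z * basis_vec v z) - (\<Sum>z\<in>?\<Omega>. a u z * basis_vec w z)"
      using that by (simp add: T_def algebra_simps sum_subtractf)
    moreover have "(\<Sum>z\<in>?\<Omega>. a u z * basis_vec v z) = a u v" if "v \<in> ?\<Omega>" for v
    proof -
      have "(\<Sum>z\<in>?\<Omega>. a u z * basis_vec v z) = (\<Sum>z\<in>?\<Omega>. if z = v then a u v else 0)"
        by (intro sum.cong) (auto simp: basis_vec_def)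
      then show ?thesis using that by simp
    qed
    ultimately have "a u v = a u w" using that by simp
    then show ?thesis using that(1) by (simp add: a_def split: if_splits)
  qed
  have xx: "(x, x') \<in> Orb" unfolding Orb_def using one by (intro image_eqI[of _ _ id]) auto
  obtain h where h: "h \<in> P" "h x = y" using simple_transitive[OF P m simple xy(1,3)] by blast
  \<comment> \<open>The pair (y, y') is the image under h of (x, z), so only the second entry of the
    base pair has to be changed.\<close>
  define z where "z = inv' h y'"
  have hz: "h z = y'" using permutes_inverses(1)[OF perm[OF h(1)]] by (simp add: z_def)
  have "z \<in> ?\<Omega>" using permutes_in_image[OF perm[OF inv[OF h(1)]]] xy(4) unfolding z_def by blast
  moreover have "x \<noteq> z" using hz h(2) xy(6) by auto
  ultimately have "(x, z) \<in> Orb" using step[OF xx] xy by blast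
  then have "(y, y') \<in> Orb" using Orb_inv[OF h(1)] h(2) hz by metis
  then show "\<exists>h\<in>P. h x = y \<and> h x' = y'" unfolding Orb_def by auto
qed

section \<open>Groups preserving two blocks\<close>

definition restr :: "nat set \<Rightarrow> (nat \<Rightarrow> 'f::field) \<Rightarrow> nat \<Rightarrow> 'f"
  where "restr A f = (\<lambda>x. if x \<in> A then f x else 0)"

lemma restr_add: "restr A (f + h) = restr A f + restr A h"
  and restr_scale: "restr A (fscale c f) = fscale c (restr A f)"
  and restr_0: "restr A 0 = 0"
  by (auto simp: restr_def fun_eq_iff)

lemma restr_pact: "bij g \<Longrightarrow> pact g (restr A f) = restr (g ` A) (pact g f)"
proof
  fix x assume g: "bij g"
  have "inv' g x \<in> A \<longleftrightarrow> x \<in> g ` A"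
  proof
    assume "x \<in> g ` A"
    then obtain a where "a \<in> A" "x = g a" by blast
    then show "inv' g x \<in> A" using g by (simp add: bij_is_inj)
  next
    assume "inv' g x \<in> A"
    moreover have "g (inv' g x) = x" using g by (simp add: bij_is_surj surj_f_inv_f)
    ultimately show "x \<in> g ` A" by (metis imageI)
  qed
  then show "pact g (restr A f) x = restr (g ` A) (pact g f) x" by (simp add: restr_def pact_def)
qed

lemma subspace_image_restr: "fv.subspace U \<Longrightarrow> fv.subspace (restr A ` U)"
  unfolding fv.subspace_def
proof (intro conjI ballI allI)
  assume U: "0 \<in> U \<and> (\<forall>x\<in>U. \<forall>y\<in>U. x + y \<in> U) \<and> (\<forall>c. \<forall>x\<in>U. fscale c x \<in> U)"
  show "0 \<in> restr A ` U" using U restr_0 by (metis image_eqI)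
  show "f + h \<in> restr A ` U" if "f \<in> restr A ` U" "h \<in> restr A ` U" for f h
    using that U by (auto simp: restr_add[symmetric])
  show "fscale c f \<in> restr A ` U" if "f \<in> restr A ` U" for c f
    using that U by (auto simp: restr_scale[symmetric])
qed

lemma pact_inv:
  assumes "bij g"
  shows "pact (inv' g) (pact g f) = f" and "pact g (pact (inv' g) f) = f"
proof -
  show "pact (inv' g) (pact g f) = f"
    using pact_comp[of "inv' g" g f] assms by (simp add: bij_imp_bij_inv bij_is_inj)
  show "pact g (pact (inv' g) f) = f"
    using pact_comp[of g "inv' g" f] assms by (simp add: bij_imp_bij_inv bij_is_surj surj_iff[THEN iffD1])
qed

lemma pact_comp3: "bij p \<Longrightarrow> bij q \<Longrightarrow> bij r \<Longrightarrow> pact (p \<circ> q \<circ> r) f = pact p (pact q (pact r f))"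
  using pact_comp[OF bij_comp[of q p], of r f] pact_comp[of p q "pact r f"] by simp

text \<open>The two sets enter symmetrically, which permits the interchange of the blocks by a
  sublocale further down.\<close>

locale two_blocks =
  fixes n :: nat and G :: "(nat \<Rightarrow> nat) set" and A B :: "nat set"
  assumes G: "subgroup G (sym_group n)"
    and AB: "finite A" "finite B" "A \<inter> B = {}"
    and blocks: "g \<in> G \<Longrightarrow> (g ` A = A \<and> g ` B = B) \<or> (g ` A = B \<and> g ` B = A)"
begin

definition K where "K = {g \<in> G. g ` A = A \<and> g ` B = B}"

definition E :: "(nat \<Rightarrow> 'f::field) set"
  where "E = {f. (\<forall>x. x \<notin> A \<union> B \<longrightarrow> f x = 0) \<and> sum f A = 0 \<and> sum f B = 0}"

lemmas perm = sym_subgroupD(1)[OF G] and comp = sym_subgroupD(2)[OF G]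
  and inv = sym_subgroupD(3)[OF G] and one = sym_subgroupD(4)[OF G]

lemma bij: "g \<in> G \<Longrightarrow> bij g"
  using perm permutes_bij by blast

lemma inv_image: "g \<in> G \<Longrightarrow> g ` S = T \<Longrightarrow> inv' g ` T = S"
  by (metis bij bij_is_inj image_inv_f_f)

lemma subgroup_K: "subgroup K (sym_group n)"
proof (rule group.subgroupI[OF sym_group_is_group])
  show "K \<subseteq> carrier (sym_group n)" using subgroup.subset[OF G] by (auto simp: K_def)
  show "K \<noteq> {}" using one unfolding K_def by (auto intro!: exI[of _ id])
  show "inv\<^bsub>sym_group n\<^esub> g \<in> K" if "g \<in> K" for g
  proof -
    have "g \<in> G" using that by (simp add: K_def)
    moreover from this have "g \<in> carrier (sym_group n)" using subgroup.subset[OF G] by blast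
    ultimately show ?thesis
      using inv inv_image[of g A A] inv_image[of g B B] that by (simp add: K_def)
  qed
  show "g \<otimes>\<^bsub>sym_group n\<^esub> h \<in> K" if "g \<in> K" "h \<in> K" for g h
    using that comp unfolding K_def mem_Collect_eq sym_group_mult image_comp[symmetric] by simp
qed

lemma K_G: "k \<in> K \<Longrightarrow> k \<in> G"
  by (simp add: K_def)

lemma K_blocks: "k \<in> K \<Longrightarrow> f \<in> zero_sum A \<Longrightarrow> pact k f \<in> zero_sum A"
  "k \<in> K \<Longrightarrow> f \<in> zero_sum B \<Longrightarrow> pact k f \<in> zero_sum B"
  using zero_sum_pact[OF bij[OF K_G]] unfolding K_def by (metis (mono_tags, lifting) mem_Collect_eq)+

lemma subspace_E: "fv.subspace E"
  by (auto simp: fv.subspace_def E_def sum.distrib sum_distrib_left[symmetric])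

lemma zero_sum_E: "zero_sum A \<subseteq> E" "zero_sum B \<subseteq> E"
proof -
  have "sum f B = 0" if "f \<in> zero_sum A" for f :: "nat \<Rightarrow> 'f::field"
    using that AB by (intro sum.neutral) (auto simp: zero_sum_def)
  then show "zero_sum A \<subseteq> (E :: (nat \<Rightarrow> 'f::field) set)" by (auto simp: E_def zero_sum_def)
  have "sum f A = 0" if "f \<in> zero_sum B" for f :: "nat \<Rightarrow> 'f::field"
    using that AB by (intro sum.neutral) (auto simp: zero_sum_def)
  then show "zero_sum B \<subseteq> (E :: (nat \<Rightarrow> 'f::field) set)" by (auto simp: E_def zero_sum_def)
qed

lemma restr_E: "f \<in> E \<Longrightarrow> restr A f \<in> zero_sum A" "f \<in> E \<Longrightarrow> restr B f \<in> zero_sum B"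
  by (auto simp: E_def restr_def zero_sum_def)

lemma E_decomp: "f \<in> E \<Longrightarrow> f = restr A f + restr B f"
  using AB(3) by (auto simp: E_def restr_def fun_eq_iff)

lemma E_subset_iff:
  fixes U :: "(nat \<Rightarrow> 'f::field) set"
  shows "fv.subspace U \<Longrightarrow> E \<subseteq> U \<longleftrightarrow> zero_sum A \<subseteq> U \<and> zero_sum B \<subseteq> U"
proof
  assume U: "fv.subspace U" "zero_sum A \<subseteq> U \<and> zero_sum B \<subseteq> U"
  show "E \<subseteq> U"
  proof
    fix f :: "nat \<Rightarrow> 'f" assume f: "f \<in> E"
    have "restr A f + restr B f \<in> U" using restr_E[OF f] U by (intro fv.subspace_add) auto
    then show "f \<in> U" using E_decomp[OF f] by simp
  qed
qed (use zero_sum_E in blast)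

lemma restr_sum: "f \<in> zero_sum A \<Longrightarrow> h \<in> zero_sum B \<Longrightarrow> restr A (f + h) = f \<and> restr B (f + h) = h"
  using AB(3) by (auto simp: restr_def zero_sum_def fun_eq_iff)

lemma E_pact: "g \<in> G \<Longrightarrow> f \<in> E \<Longrightarrow> pact g f \<in> E"
proof -
  assume g: "g \<in> G" and f: "f \<in> E"
  have "pact g (restr A f) \<in> zero_sum (g ` A)" "pact g (restr B f) \<in> zero_sum (g ` B)"
    using zero_sum_pact[OF bij[OF g]] restr_E[OF f] by auto
  then have "pact g (restr A f) \<in> E" "pact g (restr B f) \<in> E"
    using blocks[OF g] zero_sum_E by auto
  then have "pact g (restr A f) + pact g (restr B f) \<in> E" by (rule fv.subspace_add[OF subspace_E])
  then show ?thesis using E_decomp[OF f] by (metis pact_add)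
qed

text \<open>A swap g normalizes \<open>K\<close>, every other block-swapping element lies in the
  coset of g, and the square of g falls into \<open>K\<close>. These facts reduce invariance under
  \<open>G\<close> to invariance under \<open>K\<close> and g.\<close>

lemma swap_conj:
  assumes g: "g \<in> G" "g ` A = B" "g ` B = A"
  shows "k \<in> K \<Longrightarrow> g \<circ> k \<circ> inv' g \<in> K" and "k \<in> K \<Longrightarrow> inv' g \<circ> k \<circ> g \<in> K"
    and "h \<in> G \<Longrightarrow> h \<notin> K \<Longrightarrow> inv' g \<circ> h \<in> K" and "g \<circ> g \<in> K"
    and "inv' g ` A = B" and "inv' g ` B = A"
proof -
  show 1: "inv' g ` A = B" and 2: "inv' g ` B = A" by (rule inv_image[OF g(1,3)], rule inv_image[OF g(1,2)])
  show "g \<circ> k \<circ> inv' g \<in> K" "inv' g \<circ> k \<circ> g \<in> K" if "k \<in> K"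
    using that g 1 2 comp inv unfolding K_def mem_Collect_eq image_comp[symmetric] by simp_all
  show "g \<circ> g \<in> K" using g comp unfolding K_def mem_Collect_eq image_comp[symmetric] by simp
  show "inv' g \<circ> h \<in> K" if "h \<in> G" "h \<notin> K"
  proof -
    have "h ` A = B" "h ` B = A" using blocks[OF that(1)] that by (auto simp: K_def)
    then show ?thesis using that g 1 2 comp inv unfolding K_def mem_Collect_eq image_comp[symmetric] by simp
  qed
qed

abbreviation KK where "KK \<equiv> (sym_group n)\<lparr>carrier := K\<rparr>"

lemma closed_rep_frep:
  assumes "fv.subspace U" "\<And>k f. k \<in> K \<Longrightarrow> f \<in> U \<Longrightarrow> pact k f \<in> U"
  shows "closed_rep KK (frep U pact)"
  using assms by (auto simp: closed_rep_def fv.subspace_def)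

text \<open>If \<open>U\<close> meets both blocks trivially, it is the graph of an isomorphism between them.\<close>

lemma graph_isomorphic:
  fixes U :: "(nat \<Rightarrow> 'f::field) set"
  assumes A: "simple_under K (zero_sum A :: (nat \<Rightarrow> 'f) set)"
    and U: "fv.subspace U" "U \<subseteq> E" "\<And>k f. k \<in> K \<Longrightarrow> f \<in> U \<Longrightarrow> pact k f \<in> U" "U \<noteq> {0}"
    and meet: "U \<inter> zero_sum A = {0}" "U \<inter> zero_sum B = {0}"
  shows "isomorphic_rep KK (frep U pact) (frep (zero_sum A) pact)"
proof (rule isomorphic_repI[of _ _ "restr A"])
  \<comment> \<open>An element that vanishes on \<open>A\<close> lies in the zero-sum space of
    \<open>B\<close>, which \<open>U\<close> meets trivially; so restriction to \<open>A\<close> is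
    injective on \<open>U\<close>.\<close>
  have zero: "f = 0" if "f \<in> U" "restr A f = 0" for f
  proof -
    have "f \<in> E" using that U(2) by blast
    then have "f = restr B f" "restr B f \<in> zero_sum B" using E_decomp[of f] restr_E[of f] that(2) by auto
    then show ?thesis using meet(2) that(1) by auto
  qed
  have "inj_on (restr A) U"
  proof (rule inj_onI)
    fix f h assume fh: "f \<in> U" "h \<in> U" "restr A f = restr A h"
    have "restr A (f - h) = 0" using fh(3) by (auto simp: restr_def fun_eq_iff split: if_splits)
    moreover have "f - h \<in> U" using fh U(1) by (intro fv.subspace_diff)
    ultimately show "f = h" using zero[of "f - h"] by simp
  qed
  moreover have "restr A ` U = {0} \<or> restr A ` U = zero_sum A"
  proof (rule simple_underD[OF A])
    show "restr A ` U \<subseteq> zero_sum A" using U(2) restr_E by blast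
    show "fv.subspace (restr A ` U)" by (rule subspace_image_restr[OF U(1)])
    show "pact k f \<in> restr A ` U" if k: "k \<in> K" and f: "f \<in> restr A ` U" for k f
    proof -
      obtain u where u: "u \<in> U" "f = restr A u" using f by blast
      have "pact k f = restr A (pact k u)"
        using restr_pact[OF bij[OF K_G[OF k]], of A u] k u by (simp add: K_def)
      then show ?thesis using U(3)[OF k u(1)] by blast
    qed
  qed
  moreover have "restr A ` U \<noteq> {0}"
  proof
    assume "restr A ` U = {0}"
    then have "U \<subseteq> {0}" using zero by blast
    then show False using U(4) fv.subspace_0[OF U(1)] by blast
  qed
  ultimately show "linear_bij (frep U pact) (frep (zero_sum A) pact) (restr A)"
    by (simp add: linear_bij_def bij_betw_def restr_add restr_scale)
  show "restr A (act (frep U pact) g x) = act (frep (zero_sum A) pact) g (restr A x)" if "g \<in> carrier KK" for g x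
    using restr_pact[OF bij[OF K_G], of g A x] that by (simp add: K_def)
qed

end

text \<open>\<open>K\<close> and \<open>E\<close> are symmetric in the blocks, so each result about
  \<open>A\<close> yields the one about \<open>B\<close> under the prefix
  \<open>flip\<close>.\<close>

sublocale two_blocks \<subseteq> flip: two_blocks n G B A
  rewrites "two_blocks.K G B A = K" and "two_blocks.E B A = E"
proof -
  show "two_blocks n G B A"
  proof (rule two_blocks.intro)
    show "B \<inter> A = {}" using AB(3) by blast
    show "g ` B = B \<and> g ` A = A \<or> g ` B = A \<and> g ` A = B" if "g \<in> G" for g
      using blocks[OF that] by blast
  qed (fact G AB)+
  then interpret f: two_blocks n G B A .
  show "f.K = K" by (auto simp: K_def f.K_def)
  show "f.E = E" by (auto simp: E_def f.E_def)
qed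

section \<open>Simplicity over \<open>G\<close> compared with simplicity over the block
  stabilizer\<close>

context two_blocks
begin

text \<open>A submodule containing one block contains the other by the swap, hence is
  \<open>E\<close>. One containing neither meets both trivially by simplicity, and if nonzero it
  projects isomorphically onto each, so the blocks would be isomorphic.\<close>

lemma simple_if_blocks:
  assumes A: "simple_under K (zero_sum A :: (nat \<Rightarrow> 'f::field) set)"
    and B: "simple_under K (zero_sum B :: (nat \<Rightarrow> 'f) set)"
    and g: "g \<in> G" "g ` A = B" "g ` B = A"
    and noniso: "\<not> isomorphic_rep KK (frep (zero_sum A :: (nat \<Rightarrow> 'f) set) pact) (frep (zero_sum B) pact)"
  shows "simple_under G (E :: (nat \<Rightarrow> 'f) set)"
  unfolding simple_under_def
proof (intro conjI allI impI)
  show "E \<noteq> ({0} :: (nat \<Rightarrow> 'f) set)"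
  proof
    assume "E = ({0} :: (nat \<Rightarrow> 'f) set)"
    then have "zero_sum A \<subseteq> ({0} :: (nat \<Rightarrow> 'f) set)" using zero_sum_E by blast
    then show False
      using A fv.subspace_0[OF subspace_zero_sum[of A]] unfolding simple_under_def by blast
  qed
  fix U :: "(nat \<Rightarrow> 'f) set"
  assume U: "U \<subseteq> E" "fv.subspace U" "\<forall>p\<in>G. \<forall>f\<in>U. pact p f \<in> U"
  have UK: "pact k f \<in> U" if "k \<in> K" "f \<in> U" for k f using that U(3) K_G by blast
  have swap: "zero_sum (h ` C) \<subseteq> U" if h: "h \<in> G" and C: "zero_sum C \<subseteq> U" for h C
  proof
    fix f :: "nat \<Rightarrow> 'f" assume "f \<in> zero_sum (h ` C)"
    then have "pact (inv' h) f \<in> zero_sum (inv' h ` h ` C)" using zero_sum_pact[OF bij[OF inv[OF h]]] by blast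
    also have "inv' h ` h ` C = C" by (rule inv_image[OF h refl])
    finally have "pact h (pact (inv' h) f) \<in> U" using U(3) C h by blast
    then show "f \<in> U" by (simp add: pact_inv[OF bij[OF h]])
  qed
  have meetA: "U \<inter> zero_sum A = {0} \<or> U \<inter> zero_sum A = zero_sum A"
    by (rule simple_underD[OF A]) (simp_all add: UK K_blocks U(2) subspace_zero_sum fv.subspace_inter)
  have meetB: "U \<inter> zero_sum B = {0} \<or> U \<inter> zero_sum B = zero_sum B"
    by (rule simple_underD[OF B]) (simp_all add: UK K_blocks U(2) subspace_zero_sum fv.subspace_inter)
  show "U = {0} \<or> U = E"
  proof (cases "zero_sum A \<subseteq> U \<or> zero_sum B \<subseteq> U")
    case True
    then have "zero_sum A \<subseteq> U \<and> zero_sum B \<subseteq> U" using swap[OF g(1), of A] swap[OF g(1), of B] g by auto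
    then show ?thesis using E_subset_iff[OF U(2)] U(1) by blast
  next
    case False
    then have meet: "U \<inter> zero_sum A = {0}" "U \<inter> zero_sum B = {0}" using meetA meetB by blast+
    show ?thesis
    proof (rule ccontr)
      assume "\<not> ?thesis"
      then have ne: "U \<noteq> {0}" by blast
      have "isomorphic_rep KK (frep U pact) (frep (zero_sum A) pact)"
        by (rule graph_isomorphic[OF A U(2,1) UK ne meet])
      moreover have "isomorphic_rep KK (frep U pact) (frep (zero_sum B) pact)"
        by (rule flip.graph_isomorphic[OF B U(2,1) UK ne meet(2,1)])
      ultimately show False
        using noniso isomorphic_rep_sym[OF closed_rep_frep[OF U(2) UK]] isomorphic_rep_trans by blast
    qed
  qed
qed

text \<open>Without a swap \<open>G\<close> equals \<open>K\<close>, and a single block would be a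
  proper nonzero submodule of \<open>E\<close>.\<close>

lemma swap_exists:
  assumes E: "simple_under G (E :: (nat \<Rightarrow> 'f::field) set)"
    and ne: "zero_sum A \<noteq> ({0} :: (nat \<Rightarrow> 'f) set)" "zero_sum B \<noteq> ({0} :: (nat \<Rightarrow> 'f) set)"
  shows "\<exists>g\<in>G. g ` A = B \<and> g ` B = A"
proof (rule ccontr)
  assume "\<not> ?thesis"
  then have K: "g \<in> K" if "g \<in> G" for g using blocks[OF that] that by (auto simp: K_def)
  have "zero_sum A = ({0} :: (nat \<Rightarrow> 'f) set) \<or> zero_sum A = (E :: (nat \<Rightarrow> 'f) set)"
    by (rule simple_underD[OF E zero_sum_E(1) subspace_zero_sum]) (use K K_blocks in blast)
  then have "zero_sum B \<subseteq> (zero_sum A :: (nat \<Rightarrow> 'f) set)" using ne zero_sum_E by blast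
  moreover have "f = 0" if "f \<in> zero_sum A" "f \<in> zero_sum B" for f :: "nat \<Rightarrow> 'f"
    using that AB(3) by (auto simp: zero_sum_def fun_eq_iff)
  ultimately have "zero_sum B \<subseteq> ({0} :: (nat \<Rightarrow> 'f) set)" by blast
  then show False using ne(2) fv.subspace_0[OF subspace_zero_sum[of B]] by blast
qed

text \<open>For a \<open>K\<close>-submodule \<open>U\<close> of one block, the sum of
  \<open>U\<close> and its translate by the swap is a \<open>G\<close>-submodule of
  \<open>E\<close>. Its component in the block is \<open>U\<close> again, so \<open>U\<close>
  inherits the alternative of being zero or everything.\<close>

lemma simple_block:
  assumes E: "simple_under G (E :: (nat \<Rightarrow> 'f::field) set)"
    and ne: "zero_sum A \<noteq> ({0} :: (nat \<Rightarrow> 'f) set)"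
    and g: "g \<in> G" "g ` A = B" "g ` B = A"
  shows "simple_under K (zero_sum A :: (nat \<Rightarrow> 'f) set)"
  unfolding simple_under_def
proof (intro conjI allI impI ne)
  fix U :: "(nat \<Rightarrow> 'f) set"
  assume U: "U \<subseteq> zero_sum A" "fv.subspace U" "\<forall>k\<in>K. \<forall>f\<in>U. pact k f \<in> U"
  let ?W = "{u + pact g v | u v. u \<in> U \<and> v \<in> U}"
  have gB: "pact g v \<in> zero_sum B" if "v \<in> U" for v
    using zero_sum_pact[OF bij[OF g(1)]] that U(1) g(2) by blast
  have "?W = {0} \<or> ?W = E"
  proof (rule simple_underD[OF E])
    show "?W \<subseteq> E"
      using U(1) gB zero_sum_E fv.subspace_add[OF subspace_E] by blast
    show "fv.subspace ?W"
      unfolding fv.subspace_def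
    proof (intro conjI ballI allI)
      have "0 + pact g 0 \<in> ?W" using fv.subspace_0[OF U(2)] by blast
      then show "0 \<in> ?W" by simp
      show "w + w' \<in> ?W" if *: "w \<in> ?W" "w' \<in> ?W" for w w'
      proof -
        obtain u v u' v' where uv: "u \<in> U" "v \<in> U" "u' \<in> U" "v' \<in> U"
          and w: "w = u + pact g v" "w' = u' + pact g v'" using * by blast
        have "w + w' = (u + u') + pact g (v + v')" by (simp only: w pact_add ac_simps)
        then show ?thesis using uv fv.subspace_add[OF U(2)] by blast
      qed
      show "fscale c w \<in> ?W" if *: "w \<in> ?W" for c w
      proof -
        obtain u v where uv: "u \<in> U" "v \<in> U" and w: "w = u + pact g v" using * by blast
        have "fscale c w = fscale c u + pact g (fscale c v)" by (simp only: w pact_scale fv.scale_right_distrib)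
        then show ?thesis using uv fv.subspace_scale[OF U(2)] by blast
      qed
    qed
    show "pact h w \<in> ?W" if h: "h \<in> G" and w: "w \<in> ?W" for h w
    proof -
      obtain u v where uv: "u \<in> U" "v \<in> U" and w: "w = u + pact g v" using w by blast
      have kW: "pact k w \<in> ?W" if k: "k \<in> K" for k
      proof -
        \<comment> \<open>Moving \<open>k\<close> past \<open>g\<close> replaces it by a conjugate,
          which still preserves the blocks and hence \<open>U\<close>.\<close>
        have "pact k (pact g v) = pact g (pact (inv' g \<circ> k \<circ> g) v)"
          using bij[OF g(1)] bij[OF K_G[OF k]] bij[OF inv[OF g(1)]]
          by (simp only: pact_comp3 pact_inv)
        then have "pact k w = pact k u + pact g (pact (inv' g \<circ> k \<circ> g) v)" by (simp only: w pact_add)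
        then show ?thesis using U(3) uv k swap_conj(2)[OF g k] by blast
      qed
      have gW: "pact g w' \<in> ?W" if *: "w' \<in> ?W" for w'
      proof -
        obtain u v where uv: "u \<in> U" "v \<in> U" and w: "w' = u + pact g v" using * by blast
        \<comment> \<open>Applying the swap exchanges the two components; the one translated twice
          returns to \<open>U\<close> because the square of g lies in \<open>K\<close>.\<close>
        have "pact g w' = pact (g \<circ> g) v + pact g u"
          using bij[OF g(1)] by (simp only: w pact_add pact_comp ac_simps)
        then show ?thesis using U(3) uv swap_conj(4)[OF g] by blast
      qed
      show ?thesis
      proof (cases "h \<in> K")
        \<comment> \<open>Here h is g followed on the right by \<open>inv' g \<circ> h\<close>, an
          element of \<open>K\<close>.\<close>
        case False
        then have "pact g (pact (inv' g \<circ> h) w) \<in> ?W" using kW gW swap_conj(3)[OF g h] by blast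
        moreover have "pact g (pact (inv' g \<circ> h) w) = pact h w"
          using bij[OF g(1)] bij[OF h] bij[OF inv[OF g(1)]] by (simp only: pact_comp pact_inv)
        ultimately show ?thesis by simp
      qed (rule kW)
    qed
  qed
  then show "U = {0} \<or> U = zero_sum A"
  proof
    assume W: "?W = {0}"
    have "u = 0" if "u \<in> U" for u
    proof -
      have "u + pact g 0 \<in> ?W" using that fv.subspace_0[OF U(2)] by blast
      then show ?thesis using W by simp
    qed
    then show ?thesis using fv.subspace_0[OF U(2)] by blast
  next
    assume W: "?W = E"
    have "f \<in> U" if f: "f \<in> zero_sum A" for f
    proof -
      have "f \<in> ?W" using f W zero_sum_E by blast
      then obtain u v where uv: "u \<in> U" "v \<in> U" and w: "f = u + pact g v" by blast
      have "restr A (f + 0) = f" using f fv.subspace_0[OF subspace_zero_sum[of B]] restr_sum by blast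
      moreover have "restr A f = u" unfolding w using uv U(1) gB restr_sum by blast
      ultimately show ?thesis using uv by simp
    qed
    then show ?thesis using U(1) by blast
  qed
qed

text \<open>With \<open>\<phi>\<close> the isomorphism, \<open>\<theta> = g\<inverse> \<phi> g \<phi>\<close> is a scalar \<open>l\<close> by Schur; since \<open>l\<close> has an
  inverse square root \<open>c\<close>, the graph of \<open>c \<phi>\<close> is invariant under the swap \<open>g\<close> as well.\<close>

lemma not_isomorphic_blocks:
  assumes E: "simple_under G (E :: (nat \<Rightarrow> 'f::alg_closed_field) set)"
    and A: "simple_under K (zero_sum A :: (nat \<Rightarrow> 'f) set)"
    and g: "g \<in> G" "g ` A = B" "g ` B = A"
  shows "\<not> isomorphic_rep KK (frep (zero_sum A :: (nat \<Rightarrow> 'f) set) pact) (frep (zero_sum B) pact)"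
proof
  let ?A = "zero_sum A :: (nat \<Rightarrow> 'f) set" and ?B = "zero_sum B :: (nat \<Rightarrow> 'f) set"
  assume "isomorphic_rep KK (frep ?A pact) (frep ?B pact)"
  then obtain \<phi> where lin: "linear_bij (frep ?A pact) (frep ?B pact) \<phi>"
    and phi_act: "\<And>k x. k \<in> K \<Longrightarrow> x \<in> ?A \<Longrightarrow> \<phi> (pact k x) = pact k (\<phi> x)"
    by (rule isomorphic_repE) auto
  note phi_add = linear_bijD(2)[OF lin, unfolded frep_simps] and phi_scale = linear_bijD(3)[OF lin, unfolded frep_simps]
    and phi = linear_bijD(4)[OF lin, unfolded frep_simps] and phi_inj = linear_bijD(5)[OF lin, unfolded frep_simps]
  have zA: "0 \<in> ?A" by (rule fv.subspace_0[OF subspace_zero_sum])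
  have phi_zero: "\<phi> 0 = 0" using phi_scale[OF zA, of 0] by simp
  have gB: "pact g x \<in> ?A" if "x \<in> ?B" for x using zero_sum_pact[OF bij[OF g(1)] that] g(3) by simp
  have giB: "pact (inv' g) x \<in> ?A" if "x \<in> ?B" for x
    using zero_sum_pact[OF bij[OF inv[OF g(1)]] that] swap_conj(6)[OF g] by simp
  define \<theta> where "\<theta> x = pact (inv' g) (\<phi> (pact g (\<phi> x)))" for x
  have theta: "\<theta> x \<in> ?A" if "x \<in> ?A" for x using that phi gB giB by (simp add: \<theta>_def)
  have "\<exists>l. \<forall>f\<in>?A. \<theta> f = fscale l f"
  proof (rule schur[OF subspace_zero_sum A, where A = A])
    show "\<theta> (f + h) = \<theta> f + \<theta> h" if "f \<in> ?A" "h \<in> ?A" for f h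
      using that by (simp only: \<theta>_def phi_add pact_add phi gB)
    show "\<theta> (fscale c f) = fscale c (\<theta> f)" if "f \<in> ?A" for c f
      using that by (simp only: \<theta>_def phi_scale pact_scale phi gB)
    show "\<theta> (pact k f) = pact k (\<theta> f)" if k: "k \<in> K" and f: "f \<in> ?A" for k f
    proof -
      \<comment> \<open>Passing k through \<open>g\<close> conjugates it, \<open>\<phi>\<close>
        commutes with the conjugate, and \<open>inv' g\<close> undoes the conjugation.\<close>
      let ?k = "g \<circ> k \<circ> inv' g"
      have k': "?k \<in> K" by (rule swap_conj(1)[OF g k])
      have bb: "bij g" "bij k" "bij (inv' g)" "bij ?k"
        using bij[OF g(1)] bij[OF K_G[OF k]] bij[OF inv[OF g(1)]] bij[OF K_G[OF k']] by auto
      have eq: "pact g (pact k x) = pact ?k (pact g x)" for x :: "nat \<Rightarrow> 'f"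
        using bb by (simp only: pact_comp3 pact_inv)
      have eq': "pact (inv' g) (pact ?k x) = pact k (pact (inv' g) x)" for x :: "nat \<Rightarrow> 'f"
        using bb by (simp only: pact_comp3 pact_inv)
      have "\<phi> (pact g (\<phi> (pact k f))) = pact ?k (\<phi> (pact g (\<phi> f)))"
        by (simp only: phi_act[OF k f] eq phi_act[OF k' gB[OF phi[OF f]]])
      then show ?thesis by (simp only: \<theta>_def eq')
    qed
  qed (use theta K_blocks AB in \<open>auto simp: zero_sum_def\<close>)
  then obtain l where l: "\<And>f. f \<in> ?A \<Longrightarrow> \<theta> f = fscale l f" by blast
  obtain x0 where x0: "x0 \<in> ?A" "x0 \<noteq> 0"
    using A zA unfolding simple_under_def by blast
  \<comment> \<open>All four maps composed in \<open>\<theta>\<close> are injective, so it cannot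
    kill \<open>x0\<close>.\<close>
  have "l \<noteq> 0"
  proof
    assume "l = 0"
    then have "\<theta> x0 = 0" using l[OF x0(1)] by simp
    then have "pact g (\<theta> x0) = 0" by simp
    then have "\<phi> (pact g (\<phi> x0)) = \<phi> 0" by (simp add: \<theta>_def pact_inv[OF bij[OF g(1)]] phi_zero)
    then have "pact g (\<phi> x0) = 0" using phi_inj gB phi x0 zA by blast
    then have "pact (inv' g) (pact g (\<phi> x0)) = 0" by simp
    then have "\<phi> x0 = \<phi> 0" by (simp add: pact_inv[OF bij[OF g(1)]] phi_zero)
    then show False using phi_inj x0 zA by blast
  qed
  obtain c where "c ^ 2 = inverse l" using nth_root_exists[of 2 "inverse l"] by auto
  then have c: "c * c * l = 1" "c \<noteq> 0" using \<open>l \<noteq> 0\<close> by (auto simp: power2_eq_square)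
  let ?U = "(\<lambda>x. x + fscale c (\<phi> x)) ` ?A"
  have UE: "?U \<subseteq> E"
    using phi zero_sum_E fv.subspace_add[OF subspace_E] fv.subspace_scale[OF subspace_E] by blast
  have "?U = {0} \<or> ?U = E"
  proof (rule simple_underD[OF E UE])
    show "fv.subspace ?U"
      unfolding fv.subspace_def
    proof (intro conjI ballI allI)
      show "0 \<in> ?U" using zA phi_zero by (intro image_eqI[of _ _ 0]) auto
      show "w + w' \<in> ?U" if *: "w \<in> ?U" "w' \<in> ?U" for w w'
      proof -
        obtain x x' where x: "x \<in> ?A" "x' \<in> ?A" "w = x + fscale c (\<phi> x)" "w' = x' + fscale c (\<phi> x')"
          using * by blast
        have "w + w' = (x + x') + fscale c (\<phi> (x + x'))"
          unfolding phi_add[OF x(1,2)] x(3,4) by (simp only: fv.scale_right_distrib ac_simps)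
        then show ?thesis using fv.subspace_add[OF subspace_zero_sum x(1,2)] by blast
      qed
      show "fscale d w \<in> ?U" if *: "w \<in> ?U" for d w
      proof -
        obtain x where x: "x \<in> ?A" "w = x + fscale c (\<phi> x)" using * by blast
        have "fscale d w = fscale d x + fscale c (\<phi> (fscale d x))"
          by (simp only: x phi_scale[OF x(1)] fv.scale_right_distrib fv.scale_scale mult.commute)
        then show ?thesis using fv.subspace_scale[OF subspace_zero_sum x(1)] by blast
      qed
    qed
    show "pact h w \<in> ?U" if h: "h \<in> G" and w: "w \<in> ?U" for h w
    proof -
      have *: "pact k w' \<in> ?U" if k: "k \<in> K" and w': "w' \<in> ?U" for k w'
      proof -
        obtain x where x: "x \<in> ?A" "w' = x + fscale c (\<phi> x)" using w' by blast
        have "pact k w' = pact k x + fscale c (\<phi> (pact k x))"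
          by (simp only: x pact_add pact_scale phi_act[OF k x(1)])
        then show ?thesis using K_blocks(1)[OF k x(1)] by blast
      qed
      have **: "pact g w' \<in> ?U" if w': "w' \<in> ?U" for w'
      proof -
        obtain x where x: "x \<in> ?A" "w' = x + fscale c (\<phi> x)" using w' by blast
        \<comment> \<open>The swap turns x + c \<open>\<phi>\<close> x into y + g x. Here c
          \<open>\<phi>\<close> y is c c l times g x, which is g x by the choice of c, so the result
          lies in the graph over y.\<close>
        define y where "y = fscale c (pact g (\<phi> x))"
        have gphi: "pact g (\<phi> x) \<in> ?A" using x phi gB by blast
        then have y: "y \<in> ?A" unfolding y_def by (intro fv.subspace_scale[OF subspace_zero_sum])
        have "pact g (\<theta> x) = \<phi> (pact g (\<phi> x))" by (simp add: \<theta>_def pact_inv[OF bij[OF g(1)]])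
        then have "\<phi> (pact g (\<phi> x)) = fscale l (pact g x)" by (simp only: l[OF x(1)] pact_scale)
        then have "fscale c (\<phi> y) = fscale (c * c * l) (pact g x)"
          by (simp only: y_def phi_scale[OF gphi] fv.scale_scale mult.assoc)
        then have "fscale c (\<phi> y) = pact g x" using c(1) by simp
        then have "pact g w' = y + fscale c (\<phi> y)"
          by (simp only: x pact_add pact_scale y_def[symmetric] add.commute)
        then show ?thesis using y by blast
      qed
      show ?thesis
      proof (cases "h \<in> K")
        case False
        then have "pact g (pact (inv' g \<circ> h) w) \<in> ?U" using * ** w swap_conj(3)[OF g h] by blast
        moreover have "pact g (pact (inv' g \<circ> h) w) = pact h w"
          using bij[OF g(1)] bij[OF h] bij[OF inv[OF g(1)]] by (simp only: pact_comp pact_inv)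
        ultimately show ?thesis by simp
      qed (use * w in blast)
    qed
  qed
  moreover have restr_U: "restr A (x + fscale c (\<phi> x)) = x" "restr B (x + fscale c (\<phi> x)) = fscale c (\<phi> x)" if "x \<in> ?A" for x
    using restr_sum[OF that fv.subspace_scale[OF subspace_zero_sum phi[OF that]]] by auto
  have "?U \<noteq> {0}"
  proof
    assume "?U = {0}"
    then have "x0 + fscale c (\<phi> x0) = 0" using x0 by blast
    then show False using restr_U(1)[OF x0(1)] x0(2) restr_0[of A] by metis
  qed
  \<comment> \<open>A graph contains no nonzero element of the first block, whereas \<open>E\<close>
    contains \<open>x0\<close>.\<close>
  moreover have "?U \<noteq> E"
  proof
    assume "?U = E"
    then obtain x where x: "x \<in> ?A" "x0 = x + fscale c (\<phi> x)" using x0 zero_sum_E by blast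
    have "restr B (x0 + 0) = 0" using restr_sum[OF x0(1) fv.subspace_0[OF subspace_zero_sum]] by blast
    then have "fscale c (\<phi> x) = 0" using restr_U(2)[OF x(1)] x(2) by simp
    then have "\<phi> x = \<phi> 0" using c(2) phi_zero by simp
    then have "x = 0" using phi_inj x(1) zA by blast
    then show False using x(2) x0(2) phi_zero by simp
  qed
  ultimately show False by blast
qed

end

section \<open>The wreath product\<close>

declare One_nat_def [simp del]

lemma irreducible_rep_iso:
  fixes V :: "('f::field, 'v, 'g) fg_module" and W :: "('f, 'w, 'g) fg_module"
  assumes "rep G V" "rep G W" "isomorphic_rep G V W"
  shows "irreducible_rep G V \<longleftrightarrow> irreducible_rep G W"
proof -
  obtain \<phi> where \<phi>: "linear_bij V W \<phi>"
    and act: "\<And>g x. g \<in> carrier G \<Longrightarrow> x \<in> carrier V \<Longrightarrow> \<phi> (act V g x) = act W g (\<phi> x)"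
    using assms(3) by (rule isomorphic_repE) blast
  show ?thesis
    by (rule irreducible_rep_cong[OF assms(1,2) \<phi>]) (use act in blast)+
qed

lemma zero_sum_invariant: "p permutes A \<Longrightarrow> f \<in> zero_sum A \<Longrightarrow> pact p f \<in> zero_sum A"
  using zero_sum_pact[OF permutes_bij] permutes_image by metis

text \<open>A zero-sum function with constant value v satisfies m v = 0, hence v = 0. So the radical
  is zero and the identity serves as \<open>\<theta>\<close>.\<close>

lemma james_D_odd:
  fixes G :: "(nat \<Rightarrow> nat) set"
  assumes m: "m \<ge> 3" "of_nat m \<noteq> (0 :: 'f::field)" and G: "subgroup G (sym_group m)"
  defines "D \<equiv> (james_D [m - 1, 1] :: ('f, _, _) fg_module)" and "H \<equiv> (sym_group m)\<lparr>carrier := G\<rparr>"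
  shows "rep H D" and "isomorphic_rep H D (frep (zero_sum {1..m}) pact)"
    and "irreducible_rep H D \<longleftrightarrow> simple_under G (zero_sum {1..m} :: (nat \<Rightarrow> 'f) set)"
proof -
  have k: "m - 1 \<ge> 2" "Suc (m - 1) = m" using m by auto
  have inv: "pact g f \<in> zero_sum {1..m}" if "g \<in> G" "f \<in> zero_sum {1..m}" for g and f :: "nat \<Rightarrow> 'f"
    using that subgroup.subset[OF G] zero_sum_invariant by (auto simp: sym_group_def)
  have ker: "f = 0 \<longleftrightarrow> (\<forall>i\<in>{1..m}. \<forall>j\<in>{1..m}. f i = f j)" if f: "f \<in> zero_sum {1..m}" for f :: "nat \<Rightarrow> 'f"
  proof
    assume c: "\<forall>i\<in>{1..m}. \<forall>j\<in>{1..m}. f i = f j"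
    have one: "1 \<in> {1..m}" using m by simp
    have c1: "f x = f 1" if "x \<in> {1..m}" for x using c that one by blast
    have "sum f {1..m} = (\<Sum>i\<in>{1..m}. f 1)" by (rule sum.cong[OF refl c1])
    then have "f 1 = 0" using f m by (simp add: zero_sum_def)
    show "f = 0"
    proof
      fix x
      show "f x = 0 x"
      proof (cases "x \<in> {1..m}")
        case True
        then show ?thesis using c1 \<open>f 1 = 0\<close> by simp
      next
        case False
        then have "f x = 0" using f unfolding zero_sum_def by blast
        then show ?thesis by simp
      qed
    qed
  qed simp
  note J = james_D_hook[where \<theta> = "\<lambda>f :: nat \<Rightarrow> 'f. f" and k = "m - 1" and C = "zero_sum {1..m}" and G = G,
    unfolded k(2), folded D_def H_def, OF k(1) G subspace_zero_sum inv refl refl image_ident ker refl]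
  show 1: "rep H D" and 2: "isomorphic_rep H D (frep (zero_sum {1..m}) pact)" by (rule J; assumption)+
  have 3: "rep H (frep (zero_sum {1..m} :: (nat \<Rightarrow> 'f) set) pact)" by (rule J; assumption)
  show "irreducible_rep H D \<longleftrightarrow> simple_under G (zero_sum {1..m} :: (nat \<Rightarrow> 'f) set)"
    unfolding irreducible_rep_iso[OF 1 3 2] unfolding H_def
    by (rule irreducible_rep_pact[OF G subspace_zero_sum inv])
qed

section \<open>Subgroups of the wreath product and the module of even degree\<close>

locale wreath_subgroup =
  fixes m :: nat and G :: "(nat \<Rightarrow> nat) set"
  assumes m: "m \<ge> 3" and G: "subgroup G (sym_group (2 * m))" and wreath: "G \<subseteq> wreath_S2 m"

sublocale wreath_subgroup \<subseteq> two_blocks "2 * m" G "{1..m}" "{m + 1..2 * m}"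
proof (rule two_blocks.intro)
  fix g assume "g \<in> G"
  then have "g \<in> wreath_S2 m" using wreath by blast
  then have "(`) g ` {{1..m}, {m + 1..2 * m}} = {{1..m}, {m + 1..2 * m}}"
    unfolding wreath_S2_def mem_Collect_eq by (rule conjunct2)
  then have g: "{g ` {1..m}, g ` {m + 1..2 * m}} = {{1..m}, {m + 1..2 * m}}"
    by (simp only: image_insert image_empty)
  then show "g ` {1..m} = {1..m} \<and> g ` {m + 1..2 * m} = {m + 1..2 * m} \<or>
      g ` {1..m} = {m + 1..2 * m} \<and> g ` {m + 1..2 * m} = {1..m}"
    by (simp only: doubleton_eq_iff)
qed (use G in auto)

context wreath_subgroup
begin

abbreviation L where "L \<equiv> {1..m}"
abbreviation R where "R \<equiv> {m + 1..2 * m}"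

lemma K_eq: "K = G \<inter> base_subgroup m"
  using subgroup.subset[OF G] by (auto simp: K_def base_subgroup_def)

lemma R_eq: "R = (+) m ` L"
proof -
  have "x \<in> (+) m ` L" if "x \<in> R" for x
    using that by (intro image_eqI[of _ _ "x - m"]) auto
  then show ?thesis by auto
qed

text \<open>The quotient of the zero-sum functions by the constants is realized inside
  \<open>E\<close> by subtracting the sum over the first block. Oddness of m makes this a projection
  that kills exactly the constants, and characteristic 2 makes it independent of the block
  chosen.\<close>

lemma james_D_even:
  assumes char: "CHAR('f::field) = 2" and odd: "odd m"
  defines "D \<equiv> (james_D [2 * m - 1, 1] :: ('f, _, _) fg_module)"
  shows "irreducible_rep ((sym_group (2 * m))\<lparr>carrier := G\<rparr>) D \<longleftrightarrow> simple_under G (E :: (nat \<Rightarrow> 'f) set)"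
proof -
  have two: "x + x = (0 :: 'f)" for x
  proof -
    have "of_nat 2 = (0 :: 'f)" using char by (metis of_nat_CHAR)
    then show ?thesis by (metis mult_2 mult_zero_left of_nat_numeral)
  qed
  then have neg: "- x = (x :: 'f)" for x by (metis add_eq_0_iff)
  have om: "of_nat m = (1 :: 'f)"
  proof -
    obtain j where "m = 2 * j + 1" using odd by (elim oddE)
    then show ?thesis using two[of "of_nat j"] by simp
  qed
  let ?n = "2 * m"
  have k: "?n - 1 \<ge> 2" "Suc (?n - 1) = ?n" using m by auto
  have N: "{1..?n} = L \<union> R" "L \<inter> R = {}" "finite L" "finite R" by auto
  have cR: "card R = m" by simp
  define \<theta> where "\<theta> f = (\<lambda>x. if x \<in> {1..?n} then f x - sum f L else 0)" for f :: "nat \<Rightarrow> 'f"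
  \<comment> \<open>The two block sums add up to zero, and in characteristic 2 this means that they
    are equal.\<close>
  have eqLR: "sum f R = sum f L" if "f \<in> zero_sum {1..?n}" for f :: "nat \<Rightarrow> 'f"
  proof -
    have "sum f L + sum f R = 0" using that sum.union_disjoint[OF N(3,4,2), of f] N(1) by (simp add: zero_sum_def)
    then show ?thesis using neg by (metis add_eq_0_iff)
  qed
  have sumL: "sum (\<theta> f) L = 0" for f
  proof -
    have "sum (\<theta> f) L = (\<Sum>x\<in>L. f x - sum f L)" by (intro sum.cong) (auto simp: \<theta>_def)
    then show ?thesis by (simp add: sum_subtractf om)
  qed
  have sumR: "sum (\<theta> f) R = 0" if "f \<in> zero_sum {1..?n}" for f
  proof -
    have "sum (\<theta> f) R = (\<Sum>x\<in>R. f x - sum f L)" by (intro sum.cong) (auto simp: \<theta>_def)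
    also have "\<dots> = sum f R - of_nat (card R) * sum f L" by (simp only: sum_subtractf sum_constant)
    finally show ?thesis unfolding cR om eqLR[OF that] by simp
  qed
  have im: "\<theta> ` zero_sum {1..?n} = E"
  proof
    show "\<theta> ` zero_sum {1..?n} \<subseteq> E"
    proof -
      have "\<theta> f x = 0" if "x \<notin> L \<union> R" for f x
        using that unfolding N(1)[symmetric] \<theta>_def by (simp only: if_False)
      then show ?thesis using sumL sumR unfolding E_def by blast
    qed
    show "E \<subseteq> \<theta> ` zero_sum {1..?n}"
    proof
      fix f :: "nat \<Rightarrow> 'f" assume f: "f \<in> E"
      have out: "f x = 0" if "x \<notin> {1..?n}" for x using that f unfolding N(1) E_def by blast
      \<comment> \<open>On \<open>E\<close> the subtracted sum is zero, so every element is its own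
        preimage.\<close>
      have "f = \<theta> f" using f out by (auto simp: E_def \<theta>_def fun_eq_iff)
      moreover have "sum f {1..?n} = 0" using f sum.union_disjoint[OF N(3,4,2), of f] N(1) by (simp add: E_def)
      then have "f \<in> zero_sum {1..?n}" using out unfolding zero_sum_def by blast
      ultimately show "f \<in> \<theta> ` zero_sum {1..?n}" by (rule image_eqI)
    qed
  qed
  have ker: "\<theta> f = 0 \<longleftrightarrow> (\<forall>i\<in>{1..?n}. \<forall>j\<in>{1..?n}. f i = f j)" if f: "f \<in> zero_sum {1..?n}" for f
  proof
    assume z: "\<theta> f = 0"
    have "f i = sum f L" if "i \<in> {1..?n}" for i
      using fun_cong[OF z, of i] that by (simp add: \<theta>_def)
    then show "\<forall>i\<in>{1..?n}. \<forall>j\<in>{1..?n}. f i = f j" by metis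
  next
    assume c: "\<forall>i\<in>{1..?n}. \<forall>j\<in>{1..?n}. f i = f j"
    have "sum f L = f i" if i: "i \<in> {1..?n}" for i
    proof -
      have "sum f L = (\<Sum>j\<in>L. f i)" by (rule sum.cong[OF refl]) (use c i N(1) in blast)
      then show ?thesis using om by simp
    qed
    then show "\<theta> f = 0" by (auto simp: \<theta>_def fun_eq_iff)
  qed
  \<comment> \<open>An element of \<open>G\<close> may exchange the blocks, but both block sums
    agree, so the subtracted constant does not change.\<close>
  have act: "\<theta> (pact g f) = pact g (\<theta> f)" if g: "g \<in> G" and f: "f \<in> zero_sum {1..?n}" for g f
  proof -
    have "sum (pact g f) L = sum f L"
    proof -
      have "inv' g ` L = L \<or> inv' g ` L = R" using blocks[OF inv[OF g]] by blast
      moreover have "g ` (inv' g ` L) = L" using bij[OF g] by (simp add: bij_is_surj image_f_inv_f)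
      then have "sum (pact g f) L = sum f (inv' g ` L)" using sum_pact[OF bij[OF g], of f "inv' g ` L"] by simp
      ultimately show ?thesis using eqLR[OF f] by auto
    qed
    moreover have "inv' g x \<in> {1..?n} \<longleftrightarrow> x \<in> {1..?n}" for x
      using permutes_in_image[OF perm[OF inv[OF g]]] .
    ultimately show ?thesis by (simp only: \<theta>_def pact_def comp_def)
  qed
  note J = james_D_hook[where \<theta> = \<theta> and k = "?n - 1" and C = E and G = G,
    unfolded k(2), folded D_def, OF k(1) G subspace_E E_pact _ _ im ker act]
  let ?H = "(sym_group (2 * m))\<lparr>carrier := G\<rparr>"
  have "rep ?H D" "rep ?H (frep (E :: (nat \<Rightarrow> 'f) set) pact)"
    "isomorphic_rep ?H D (frep E pact)"
    by (rule J; (assumption | auto simp: \<theta>_def fun_eq_iff sum.distrib sum_distrib_left algebra_simps))+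
  then show ?thesis
    using irreducible_rep_iso irreducible_rep_pact[OF G subspace_E E_pact] by blast
qed

section \<open>Projections of the base part onto the two symmetric groups\<close>

abbreviation fst_factor :: "(nat \<Rightarrow> nat) \<Rightarrow> nat \<Rightarrow> nat"
  where "fst_factor k \<equiv> fst (base_factors m k)"

abbreviation snd_factor :: "(nat \<Rightarrow> nat) \<Rightarrow> nat \<Rightarrow> nat"
  where "snd_factor k \<equiv> snd (base_factors m k)"

lemma factor_apply:
  assumes k: "k \<in> K"
  shows "i \<in> L \<Longrightarrow> fst_factor k i = k i" "i \<in> L \<Longrightarrow> m + snd_factor k i = k (m + i)"
    "i \<notin> L \<Longrightarrow> fst_factor k i = i" "i \<notin> L \<Longrightarrow> snd_factor k i = i"
proof -
  show "m + snd_factor k i = k (m + i)" if "i \<in> L"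
  proof -
    have "m + i \<in> R" using that by auto
    then have "k (m + i) \<in> R" using k unfolding K_def by blast
    then show ?thesis using that by (auto simp: base_factors_def)
  qed
qed (auto simp: base_factors_def)

lemma factor_permutes:
  assumes k: "k \<in> K"
  shows "fst_factor k permutes L" and "snd_factor k permutes L"
proof -
  have inj: "inj k" using bij[OF K_G[OF k]] by (simp add: bij_is_inj)
  have "fst_factor k ` L = k ` L" by (rule image_cong[OF refl factor_apply(1)[OF k]])
  also have "\<dots> = L" using k unfolding K_def by blast
  finally have "fst_factor k ` L = L" .
  moreover have "inj_on (fst_factor k) L"
    using inj factor_apply(1)[OF k] by (auto simp: inj_on_def inj_def)
  ultimately show "fst_factor k permutes L"
    using factor_apply(3)[OF k] by (intro bij_imp_permutes) (auto simp: bij_betw_def)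
  have kR: "k ` R = R" using k unfolding K_def by blast
  \<comment> \<open>The image of the second projection is determined after shifting into the second
    block, where k acts; injectivity of the shift brings the equation back.\<close>
  have "(+) m ` snd_factor k ` L = (\<lambda>i. m + snd_factor k i) ` L" by (simp only: image_image)
  also have "\<dots> = (\<lambda>i. k (m + i)) ` L" by (rule image_cong[OF refl factor_apply(2)[OF k]])
  also have "\<dots> = k ` (+) m ` L" by (simp only: image_image)
  also have "k ` (+) m ` L = (+) m ` L" using kR unfolding R_eq .
  finally have eq: "(+) m ` snd_factor k ` L = (+) m ` L" .
  have "inj ((+) m)" by (simp add: inj_def)
  from iffD1[OF inj_image_eq_iff[OF this] eq] have "snd_factor k ` L = L" .
  moreover have "inj_on (snd_factor k) L"
  proof (rule inj_onI)
    fix i j assume ij: "i \<in> L" "j \<in> L" "snd_factor k i = snd_factor k j"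
    then have "k (m + i) = k (m + j)" using factor_apply(2)[OF k] by metis
    from injD[OF inj this] show "i = j" by simp
  qed
  ultimately show "snd_factor k permutes L"
    using factor_apply(4)[OF k] by (intro bij_imp_permutes) (auto simp: bij_betw_def)
qed

lemma factor_comp:
  assumes k: "k \<in> K" and l: "l \<in> K"
  shows "fst_factor (k \<circ> l) = fst_factor k \<circ> fst_factor l"
    and "snd_factor (k \<circ> l) = snd_factor k \<circ> snd_factor l"
proof -
  have kl: "k \<circ> l \<in> K" using subgroup.m_closed[OF subgroup_K k l] by (simp add: sym_group_def)
  show "fst_factor (k \<circ> l) = fst_factor k \<circ> fst_factor l"
  proof
    fix i
    show "fst_factor (k \<circ> l) i = (fst_factor k \<circ> fst_factor l) i"
    proof (cases "i \<in> L")
      case True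
      moreover from this have "fst_factor l i \<in> L" using permutes_in_image[OF factor_permutes(1)[OF l]] by blast
      ultimately show ?thesis
        using factor_apply(1)[OF kl] factor_apply(1)[OF k] factor_apply(1)[OF l] by simp
    next
      case False
      then show ?thesis by (simp only: factor_apply[OF kl] factor_apply[OF k] factor_apply[OF l] comp_apply not_False_eq_True)
    qed
  qed
  show "snd_factor (k \<circ> l) = snd_factor k \<circ> snd_factor l"
  proof
    fix i
    show "snd_factor (k \<circ> l) i = (snd_factor k \<circ> snd_factor l) i"
    proof (cases "i \<in> L")
      case True
      moreover from this have "snd_factor l i \<in> L" using permutes_in_image[OF factor_permutes(2)[OF l]] by blast
      ultimately have "m + snd_factor (k \<circ> l) i = m + snd_factor k (snd_factor l i)"
        using factor_apply(2)[OF kl] factor_apply(2)[OF k] factor_apply(2)[OF l] by simp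
      then show ?thesis by simp
    next
      case False
      then show ?thesis by (simp only: factor_apply[OF kl] factor_apply[OF k] factor_apply[OF l] comp_apply not_False_eq_True)
    qed
  qed
qed

definition H where "H = base_factors m ` K"

lemma subgroup_factors: "subgroup (fst ` H) (sym_group m)" "subgroup (snd ` H) (sym_group m)"
proof -
  have KK: "group KK" by (rule group.subgroup_imp_group[OF sym_group_is_group subgroup_K])
  have "fst_factor \<in> hom KK (sym_group m)" "snd_factor \<in> hom KK (sym_group m)"
    using factor_permutes factor_comp by (auto simp: hom_def sym_group_def)
  then have "group_hom KK (sym_group m) fst_factor" "group_hom KK (sym_group m) snd_factor"
    using KK sym_group_is_group by (auto simp: group_hom_def group_hom_axioms_def)
  from this[THEN group_hom.img_is_subgroup]
  show "subgroup (fst ` H) (sym_group m)" "subgroup (snd ` H) (sym_group m)"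
    by (simp_all add: H_def image_image)
qed

section \<open>Moving functions on the second block to the first\<close>

definition shift :: "(nat \<Rightarrow> 'f::field) \<Rightarrow> nat \<Rightarrow> 'f"
  where "shift f i = (if i \<in> L then f (m + i) else 0)"

definition unshift :: "(nat \<Rightarrow> 'f::field) \<Rightarrow> nat \<Rightarrow> 'f"
  where "unshift f x = (if x \<in> R then f (x - m) else 0)"

lemma shift_linear: "shift (f + h) = shift f + shift h" "shift (fscale c f) = fscale c (shift f)"
  "unshift (f + h) = unshift f + unshift h" "unshift (fscale c f) = fscale c (unshift f)"
  by (auto simp: shift_def unshift_def fun_eq_iff)

lemma sum_shift: "sum (shift f) L = sum f R"
  unfolding R_eq by (subst sum.reindex) (auto simp: shift_def)

lemma shift_zero_sum: "f \<in> zero_sum R \<Longrightarrow> shift f \<in> zero_sum L" "f \<in> zero_sum R \<Longrightarrow> unshift (shift f) = f"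
  using sum_shift[of f] by (auto simp: zero_sum_def shift_def unshift_def fun_eq_iff)

lemma unshift_zero_sum: "f \<in> zero_sum L \<Longrightarrow> unshift f \<in> zero_sum R" "f \<in> zero_sum L \<Longrightarrow> shift (unshift f) = f"
proof -
  assume f: "f \<in> zero_sum L"
  show 1: "shift (unshift f) = f" using f by (auto simp: zero_sum_def shift_def unshift_def fun_eq_iff)
  have "sum (unshift f) R = 0" using sum_shift[of "unshift f"] f unfolding 1 by (simp add: zero_sum_def)
  then show "unshift f \<in> zero_sum R" by (auto simp: zero_sum_def unshift_def)
qed

lemma bij_shift: "bij_betw shift (zero_sum R) (zero_sum L)"
  by (rule bij_betw_byWitness[where f' = unshift]) (auto simp: shift_zero_sum unshift_zero_sum)

lemma bij_unshift: "bij_betw unshift (zero_sum L) (zero_sum R)"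
  by (rule bij_betw_byWitness[where f' = shift]) (auto simp: shift_zero_sum unshift_zero_sum)

text \<open>The permutations agree on the first block, and both keep the function supported
  there.\<close>

lemma pact_fst_factor:
  assumes k: "k \<in> K" and f: "f \<in> zero_sum L"
  shows "pact (fst_factor k) f = pact k f"
proof
  fix x
  have p: "fst_factor k permutes L" by (rule factor_permutes[OF k])
  show "pact (fst_factor k) f x = pact k f x"
  proof (cases "x \<in> L")
    case True
    then obtain y where y: "y \<in> L" "x = fst_factor k y" using permutes_image[OF p] by blast
    have "pact (fst_factor k) f (fst_factor k y) = f y" by (rule pact_apply[OF permutes_bij[OF p]])
    moreover have "pact k f (k y) = f y" by (rule pact_apply[OF bij[OF K_G[OF k]]])
    ultimately show ?thesis using y factor_apply(1)[OF k y(1)] by simp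
  next
    case False
    then have "pact (fst_factor k) f x = 0" "pact k f x = 0"
      using zero_sum_invariant[OF p f] K_blocks(1)[OF k f] unfolding zero_sum_def by blast+
    then show ?thesis by simp
  qed
qed

lemma shift_pact:
  assumes k: "k \<in> K"
  shows "shift (pact k f) = pact (snd_factor k) (shift f)"
proof
  fix i
  have p: "snd_factor k permutes L" by (rule factor_permutes[OF k])
  obtain j where j: "i = snd_factor k j" using permutes_surj[OF p] by (metis surjD)
  have r: "pact (snd_factor k) (shift f) i = shift f j" unfolding j by (rule pact_apply[OF permutes_bij[OF p]])
  have ij: "i \<in> L \<longleftrightarrow> j \<in> L" unfolding j by (rule permutes_in_image[OF p])
  show "shift (pact k f) i = pact (snd_factor k) (shift f) i"
  proof (cases "j \<in> L")
    case True
    have "pact k f (m + i) = f (m + j)"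
      unfolding j factor_apply(2)[OF k True] by (rule pact_apply[OF bij[OF K_G[OF k]]])
    then show ?thesis using True ij r by (simp add: shift_def)
  next
    case False
    then have "i \<notin> L" using ij by blast
    then show ?thesis unfolding r shift_def using False by (simp only: if_False)
  qed
qed

lemma unshift_pact:
  assumes k: "k \<in> K" and f: "f \<in> zero_sum L"
  shows "unshift (pact (snd_factor k) f) = pact k (unshift f)"
proof -
  have "pact (snd_factor k) f = shift (pact k (unshift f))"
    by (simp only: shift_pact[OF k] unshift_zero_sum[OF f])
  then show ?thesis
    by (simp only: shift_zero_sum(2)[OF K_blocks(2)[OF k unshift_zero_sum(1)[OF f]]])
qed

text \<open>\<open>K\<close> and its projections are different groups, but they induce the same
  operators on a block, up to the shift in the case of the second; this is all that
  \<open>irreducible_rep_cong\<close> compares.\<close>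

lemma simple_factors:
  shows "simple_under (fst ` H) (zero_sum L :: (nat \<Rightarrow> 'f::field) set) \<longleftrightarrow> simple_under K (zero_sum L :: (nat \<Rightarrow> 'f) set)"
    and "simple_under (snd ` H) (zero_sum L :: (nat \<Rightarrow> 'f::field) set) \<longleftrightarrow> simple_under K (zero_sum R :: (nat \<Rightarrow> 'f) set)"
proof -
  let ?L = "zero_sum L :: (nat \<Rightarrow> 'f) set" and ?R = "zero_sum R :: (nat \<Rightarrow> 'f) set"
  have fstH: "p \<in> fst ` H \<longleftrightarrow> (\<exists>k\<in>K. p = fst_factor k)" and sndH: "p \<in> snd ` H \<longleftrightarrow> (\<exists>k\<in>K. p = snd_factor k)" for p
    by (auto simp: H_def)
  have inv1: "pact p f \<in> zero_sum L" if "p \<in> fst ` H" "f \<in> zero_sum L" for p and f :: "nat \<Rightarrow> 'f"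
    using that factor_permutes zero_sum_invariant unfolding fstH by blast
  have inv2: "pact p f \<in> zero_sum L" if "p \<in> snd ` H" "f \<in> zero_sum L" for p and f :: "nat \<Rightarrow> 'f"
    using that factor_permutes zero_sum_invariant unfolding sndH by blast
  note rP = irreducible_rep_pact[OF subgroup_factors(1) subspace_zero_sum inv1]
    irreducible_rep_pact[OF subgroup_factors(2) subspace_zero_sum inv2]
  note rK = irreducible_rep_pact[OF subgroup_K subspace_zero_sum K_blocks(1)]
    irreducible_rep_pact[OF subgroup_K subspace_zero_sum K_blocks(2)]
  have "irreducible_rep KK (frep ?L pact) \<longleftrightarrow>
      irreducible_rep ((sym_group m)\<lparr>carrier := fst ` H\<rparr>) (frep ?L pact)"
  proof (rule irreducible_rep_cong[of _ _ _ _ "\<lambda>f. f"])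
    show "rep KK (frep ?L pact)"
      by (rule rep_pact[OF subgroup_K subspace_zero_sum K_blocks(1)])
    show "rep ((sym_group m)\<lparr>carrier := fst ` H\<rparr>) (frep ?L pact)"
      by (rule rep_pact[OF subgroup_factors(1) subspace_zero_sum inv1])
    show "\<exists>h\<in>carrier ((sym_group m)\<lparr>carrier := fst ` H\<rparr>). \<forall>f\<in>carrier (frep ?L pact).
        act (frep ?L pact) k f = act (frep ?L pact) h f" if "k \<in> carrier KK" for k
      using that by (intro bexI[of _ "fst_factor k"]) (simp_all add: pact_fst_factor H_def)
    show "\<exists>k\<in>carrier KK. \<forall>f\<in>carrier (frep ?L pact). act (frep ?L pact) k f = act (frep ?L pact) h f"
      if h: "h \<in> carrier ((sym_group m)\<lparr>carrier := fst ` H\<rparr>)" for h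
    proof -
      obtain k where "k \<in> K" "h = fst_factor k" using h by (auto simp: fstH)
      then show ?thesis by (intro bexI[of _ k]) (simp_all add: pact_fst_factor)
    qed
  qed (simp_all add: linear_bij_def bij_betw_def)
  then show "simple_under (fst ` H) ?L \<longleftrightarrow> simple_under K ?L"
    using rP(1) rK(1) by blast
  have "irreducible_rep KK (frep ?R pact) \<longleftrightarrow>
      irreducible_rep ((sym_group m)\<lparr>carrier := snd ` H\<rparr>) (frep ?L pact)"
  proof (rule irreducible_rep_cong[of _ _ _ _ shift])
    show "rep KK (frep ?R pact)"
      by (rule rep_pact[OF subgroup_K subspace_zero_sum K_blocks(2)])
    show "rep ((sym_group m)\<lparr>carrier := snd ` H\<rparr>) (frep ?L pact)"
      by (rule rep_pact[OF subgroup_factors(2) subspace_zero_sum inv2])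
    show "\<exists>h\<in>carrier ((sym_group m)\<lparr>carrier := snd ` H\<rparr>). \<forall>f\<in>carrier (frep ?R pact).
        shift (act (frep ?R pact) k f) = act (frep ?L pact) h (shift f)" if "k \<in> carrier KK" for k
      using that by (intro bexI[of _ "snd_factor k"]) (simp_all add: shift_pact H_def)
    show "\<exists>k\<in>carrier KK. \<forall>f\<in>carrier (frep ?R pact).
        shift (act (frep ?R pact) k f) = act (frep ?L pact) h (shift f)"
      if h: "h \<in> carrier ((sym_group m)\<lparr>carrier := snd ` H\<rparr>)" for h
    proof -
      obtain k where "k \<in> K" "h = snd_factor k" using h by (auto simp: sndH)
      then show ?thesis by (intro bexI[of _ k]) (simp_all add: shift_pact)
    qed
  qed (simp_all add: linear_bij_def shift_linear bij_shift)
  then show "simple_under (snd ` H) ?L \<longleftrightarrow> simple_under K ?R"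
    using rP(2) rK(2) by blast
qed

text \<open>Every element of \<open>H\<close> comes from some k in \<open>K\<close>, whose
  components act on the two copies of the first block as k acts on the two blocks. So an
  intertwining map for one pair becomes one for the other by composition with the shift or its
  inverse.\<close>

lemma isomorphic_factors:
  assumes HH: "carrier HH = H"
  shows "isomorphic_rep HH (frep (zero_sum L :: (nat \<Rightarrow> 'f::field) set) (\<lambda>(p, q). pact p)) (frep (zero_sum L) (\<lambda>(p, q). pact q)) \<longleftrightarrow>
    isomorphic_rep KK (frep (zero_sum L :: (nat \<Rightarrow> 'f) set) pact) (frep (zero_sum R) pact)"
proof
  let ?L = "zero_sum L :: (nat \<Rightarrow> 'f) set" and ?R = "zero_sum R :: (nat \<Rightarrow> 'f) set"
  let ?V = "frep ?L (\<lambda>(p, q). pact p) :: ('f, _, (nat \<Rightarrow> nat) \<times> (nat \<Rightarrow> nat)) fg_module"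
    and ?W = "frep ?L (\<lambda>(p, q). pact q) :: ('f, _, (nat \<Rightarrow> nat) \<times> (nat \<Rightarrow> nat)) fg_module"
  assume "isomorphic_rep HH (?V) (?W)"
  then obtain \<phi> where \<phi>: "linear_bij (?V) (?W) \<phi>"
    and act': "\<And>h x. h \<in> carrier HH \<Longrightarrow> x \<in> carrier ?V \<Longrightarrow> \<phi> (act ?V h x) = act ?W h (\<phi> x)"
    by (rule isomorphic_repE) blast
  have act: "\<phi> (pact (fst_factor k) x) = pact (snd_factor k) (\<phi> x)" if "k \<in> K" "x \<in> ?L" for k x
    using act'[of "base_factors m k" x] that by (simp add: HH H_def split_beta)
  have im: "\<phi> x \<in> ?L" if "x \<in> ?L" for x using linear_bijD(4)[OF \<phi>] that by simp
  show "isomorphic_rep KK (frep ?L pact) (frep ?R pact)"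
  proof (rule isomorphic_repI[of _ _ "unshift \<circ> \<phi>"])
    show "linear_bij (frep ?L pact) (frep ?R pact) (unshift \<circ> \<phi>)"
      using \<phi> bij_betw_trans[of \<phi> ?L ?L unshift ?R] bij_unshift by (simp add: linear_bij_def shift_linear)
    show "(unshift \<circ> \<phi>) (act (frep ?L pact) g x) = act (frep ?R pact) g ((unshift \<circ> \<phi>) x)"
      if "g \<in> carrier KK" "x \<in> carrier (frep ?L pact)" for g x
      using that act[of g x] pact_fst_factor[of g x] unshift_pact[OF _ im, of g x] by simp
  qed
next
  let ?L = "zero_sum L :: (nat \<Rightarrow> 'f) set" and ?R = "zero_sum R :: (nat \<Rightarrow> 'f) set"
  let ?V = "frep ?L (\<lambda>(p, q). pact p) :: ('f, _, (nat \<Rightarrow> nat) \<times> (nat \<Rightarrow> nat)) fg_module"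
    and ?W = "frep ?L (\<lambda>(p, q). pact q) :: ('f, _, (nat \<Rightarrow> nat) \<times> (nat \<Rightarrow> nat)) fg_module"
  assume "isomorphic_rep KK (frep ?L pact) (frep ?R pact)"
  then obtain \<phi> where \<phi>: "linear_bij (frep ?L pact) (frep ?R pact) \<phi>"
    and act: "\<And>k x. k \<in> K \<Longrightarrow> x \<in> ?L \<Longrightarrow> \<phi> (pact k x) = pact k (\<phi> x)"
    by (rule isomorphic_repE) auto
  show "isomorphic_rep HH (?V) (?W)"
  proof (rule isomorphic_repI[of _ _ "shift \<circ> \<phi>"])
    show "linear_bij (?V) (?W) (shift \<circ> \<phi>)"
      using \<phi> bij_betw_trans[of \<phi> ?L ?R shift ?L] bij_shift by (simp add: linear_bij_def shift_linear)
    fix g x assume g: "g \<in> carrier HH" and x: "x \<in> carrier (?V)"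
    obtain k where k: "k \<in> K" "g = base_factors m k" using g by (auto simp: HH H_def)
    show "(shift \<circ> \<phi>) (act (?V) g x) = act (?W) g ((shift \<circ> \<phi>) x)"
      using x k act[of k x] pact_fst_factor[of k x] shift_pact[of k] by (simp add: split_beta)
  qed
qed

text \<open>The two tensor products are the zero-sum functions on the first block, acted on by the
  first and the second component respectively.\<close>

lemma isomorphic_tensors:
  assumes om: "of_nat m \<noteq> (0 :: 'f::field)" and HH: "carrier HH = H"
  defines "D \<equiv> (james_D [m - 1, 1] :: ('f, _, _) fg_module)"
  shows "isomorphic_rep HH (D \<boxtimes> (trivial_rep :: ('f, 'f, nat \<Rightarrow> nat) fg_module)) (trivial_rep \<boxtimes> D) \<longleftrightarrow>
    isomorphic_rep KK (frep (zero_sum L :: (nat \<Rightarrow> 'f) set) pact) (frep (zero_sum R) pact)"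
proof -
  let ?S = "sym_group m" and ?L = "zero_sum L :: (nat \<Rightarrow> 'f) set"
  have S: "?S\<lparr>carrier := carrier ?S\<rparr> = ?S" by simp
  note J = james_D_odd[OF m om group.subgroup_self[OF sym_group_is_group], unfolded S, folded D_def]
  interpret D: rep ?S D by (rule J(1))
  have Hsub: "carrier HH \<subseteq> carrier ?S \<times> UNIV" "carrier HH \<subseteq> UNIV \<times> carrier ?S"
  proof -
    have "fst h \<in> carrier ?S" "snd h \<in> carrier ?S" if "h \<in> H" for h
      using that subgroup.subset[OF subgroup_factors(1)] subgroup.subset[OF subgroup_factors(2)] by blast+
    then show "carrier HH \<subseteq> carrier ?S \<times> UNIV" "carrier HH \<subseteq> UNIV \<times> carrier ?S"
      unfolding HH by force+
  qed
  note right = outer_tensor_trivial_right[OF D.V.module_axioms subspace_zero_sum D.act_closed J(2) pact_add pact_scale Hsub(1)]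
  note left = outer_tensor_trivial_left[OF D.V.module_axioms subspace_zero_sum D.act_closed J(2) pact_add pact_scale Hsub(2)]
  have "isomorphic_rep HH (D \<boxtimes> (trivial_rep :: ('f, 'f, nat \<Rightarrow> nat) fg_module)) (trivial_rep \<boxtimes> D) \<longleftrightarrow>
      isomorphic_rep HH (frep ?L (\<lambda>(p, q). pact p)) (frep ?L (\<lambda>(p, q). pact q))"
    (is "isomorphic_rep HH ?A ?B \<longleftrightarrow> isomorphic_rep HH ?C ?D")
  proof
    assume "isomorphic_rep HH ?A ?B"
    from isomorphic_rep_trans[OF isomorphic_rep_trans[OF isomorphic_rep_sym[OF right] this] left(2)]
    show "isomorphic_rep HH ?C ?D" .
  next
    assume "isomorphic_rep HH ?C ?D"
    from isomorphic_rep_trans[OF isomorphic_rep_trans[OF right(2) this] isomorphic_rep_sym[OF left]]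
    show "isomorphic_rep HH ?A ?B" .
  qed
  then show ?thesis unfolding isomorphic_factors[OF HH] .
qed

section \<open>Transitivity and block swaps\<close>

lemma zero_sum_blocks_ne: "zero_sum L \<noteq> ({0} :: (nat \<Rightarrow> 'f::field) set)" "zero_sum R \<noteq> ({0} :: (nat \<Rightarrow> 'f) set)"
  using m zero_sum_ne[of L 1 2] zero_sum_ne[of R "m + 1" "m + 2"] by auto

text \<open>The projections give transitivity inside each block, and the swap leads from one block
  to the other.\<close>

lemma transitive_if_blocks:
  assumes g: "g \<in> G" "g ` L = R" "g ` R = L"
    and tr: "two_transitive_on (fst ` H) L" "two_transitive_on (snd ` H) L"
  shows "transitive_on G {1..2 * m}"
proof -
  have two: "\<exists>p\<in>P. p x = y" if "two_transitive_on P L" "x \<in> L" "y \<in> L" for P x y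
  proof -
    have other: "\<exists>z\<in>L. z \<noteq> x" for x
    proof -
      have "1 \<in> L" "2 \<in> L" using m by auto
      moreover have "1 \<noteq> x \<or> 2 \<noteq> x" by auto
      ultimately show ?thesis by blast
    qed
    \<comment> \<open>2-transitivity speaks of pairs of distinct letters, so x and y are completed
      by arbitrary partners.\<close>
    obtain x' y' where "x' \<in> L" "x' \<noteq> x" "y' \<in> L" "y' \<noteq> y" using other[of x] other[of y] by blast
    then show ?thesis using that unfolding two_transitive_on_def by metis
  qed
  have LL: "\<exists>k\<in>G. k x = y" if xy: "x \<in> L" "y \<in> L" for x y
  proof -
    obtain k where "k \<in> K" "fst_factor k x = y" using two[OF tr(1) xy] by (auto simp: H_def)
    then show ?thesis using factor_apply(1)[OF _ xy(1)] K_G by metis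
  qed
  have RR: "\<exists>k\<in>G. k x = y" if xy: "x \<in> R" "y \<in> R" for x y
  proof -
    have xm: "x - m \<in> L" "y - m \<in> L" using xy by auto
    then obtain k where k: "k \<in> K" "snd_factor k (x - m) = y - m" using two[OF tr(2)] by (auto simp: H_def)
    have "k x = y" using factor_apply(2)[OF k(1) xm(1)] k(2) xy by simp
    then show ?thesis using k K_G by blast
  qed
  have LR: "L \<union> R = {1..2 * m}" by auto
  have "\<exists>k\<in>G. k x = y" if xy: "x \<in> L \<union> R" "y \<in> L \<union> R" for x y
  proof (cases "(x \<in> L \<longleftrightarrow> y \<in> L)")
    case True
    then show ?thesis using LL RR xy by blast
  next
    case False
    then have "(g x \<in> L \<and> y \<in> L) \<or> (g x \<in> R \<and> y \<in> R)" using xy g by blast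
    then obtain k where "k \<in> G" "k (g x) = y" using LL RR by blast
    then show ?thesis using comp[OF _ g(1), of k] by (intro bexI[of _ "k \<circ> g"]) auto
  qed
  then show ?thesis unfolding transitive_on_def LR by blast
qed

text \<open>An element carrying 1 to \<open>m + 1\<close> cannot preserve the first block, so it
  exchanges the two.\<close>

lemma swap_if_transitive:
  assumes "transitive_on G {1..2 * m}"
  shows "\<exists>g\<in>G. g ` L = R \<and> g ` R = L"
proof -
  have "1 \<in> {1..2 * m}" "m + 1 \<in> {1..2 * m}" using m by auto
  then obtain g where g: "g \<in> G" "g 1 = m + 1" using assms unfolding transitive_on_def by blast
  have "1 \<in> L" using m by simp
  then have "m + 1 \<in> g ` L" using g by (metis imageI)
  moreover have "m + 1 \<notin> L" by simp
  ultimately have "g ` L \<noteq> L" by blast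
  then show ?thesis using blocks[OF g(1)] g(1) by blast
qed

end

theorem theorem2:
  fixes n :: nat and G :: "(nat \<Rightarrow> nat) set"
  defines "m \<equiv> n div 2"
  defines "D_n \<equiv> (james_D [n - 1, 1] :: ('f::alg_closed_field, _, _) fg_module)"
    and "D_m \<equiv> (james_D [m - 1, 1] :: ('f, _, _) fg_module)"
    and "H \<equiv> base_factors m ` (G \<inter> base_subgroup m)"
  assumes "CHAR('f) = 2"
    and "n \<ge> 6" and "n mod 4 = 2"
    and "subgroup G (sym_group n)" and "G \<subseteq> wreath_S2 m"
  shows "irreducible_rep ((sym_group n)\<lparr>carrier := G\<rparr>) D_n \<longleftrightarrow>
    transitive_on G {1..n} \<and>
    ((\<forall>P \<in> {fst ` H, snd ` H}.
        two_transitive_on P {1..m} \<and> irreducible_rep ((sym_group m)\<lparr>carrier := P\<rparr>) D_m) \<and>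
     \<not> isomorphic_rep ((sym_group m \<times>\<times> sym_group m)\<lparr>carrier := H\<rparr>)
         (D_m \<boxtimes> trivial_rep) (trivial_rep \<boxtimes> D_m))"
proof -
  have n: "n = 2 * m" and odd: "odd m" and m3: "m \<ge> 3"
    using assms(6,7) unfolding m_def by presburger+
  interpret wreath_subgroup m G
  proof (rule wreath_subgroup.intro[OF m3 _ assms(9)])
    show "subgroup G (sym_group (2 * m))" using assms(8) unfolding n .
  qed
  have H: "H = wreath_subgroup.H m G" unfolding H_def assms(4) K_eq ..
  have om: "of_nat m \<noteq> (0 :: 'f)"
    using odd assms(5) by (simp add: of_nat_eq_0_iff_char_dvd)
  have irr_n: "irreducible_rep ((sym_group n)\<lparr>carrier := G\<rparr>) D_n \<longleftrightarrow> simple_under G (E :: (nat \<Rightarrow> 'f) set)"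
    unfolding D_n_def n by (rule james_D_even[OF assms(5) odd])
  note D1 = james_D_odd(3)[OF m3 om subgroup_factors(1), folded D_m_def, unfolded simple_factors, folded H]
  note D2 = james_D_odd(3)[OF m3 om subgroup_factors(2), folded D_m_def, unfolded simple_factors, folded H]
  have iso: "isomorphic_rep ((sym_group m \<times>\<times> sym_group m)\<lparr>carrier := H\<rparr>) (D_m \<boxtimes> trivial_rep) (trivial_rep \<boxtimes> D_m) \<longleftrightarrow>
      isomorphic_rep KK (frep (zero_sum L :: (nat \<Rightarrow> 'f) set) pact) (frep (zero_sum R) pact)"
    unfolding D_m_def by (rule isomorphic_tensors[OF om]) (simp add: H)
  show ?thesis (is "?lhs \<longleftrightarrow> ?rhs")
  proof
    assume ?lhs
    then have E: "simple_under G (E :: (nat \<Rightarrow> 'f) set)" using irr_n by blast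
    obtain g where g: "g \<in> G" "g ` L = R" "g ` R = L"
      using swap_exists[OF E zero_sum_blocks_ne] by blast
    have sL: "simple_under K (zero_sum L :: (nat \<Rightarrow> 'f) set)"
      by (rule simple_block[OF E zero_sum_blocks_ne(1) g])
    \<comment> \<open>The same swap serves for the other block, with its two image equations
      exchanged.\<close>
    have sR: "simple_under K (zero_sum R :: (nat \<Rightarrow> 'f) set)"
      by (rule flip.simple_block[OF E zero_sum_blocks_ne(2) g(1,3,2)])
    have tr: "two_transitive_on (fst ` H) L" "two_transitive_on (snd ` H) L"
      unfolding H
      using simple_two_transitive[OF subgroup_factors(1) m3 om] simple_two_transitive[OF subgroup_factors(2) m3 om]
        sL sR unfolding simple_factors by blast+
    \<comment> \<open>Condition (i) is recovered from 2-transitivity of the projections together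
      with the swap.\<close>
    show ?rhs
      using transitive_if_blocks[OF g tr[unfolded H]] tr D1 D2 sL sR iso not_isomorphic_blocks[OF E sL g]
      unfolding n by blast
  next
    assume R: ?rhs
    then have "transitive_on G {1..2 * m}" unfolding n by blast
    \<comment> \<open>Condition (i) supplies the swap that links the two blocks.\<close>
    then obtain g where g: "g \<in> G" "g ` L = R" "g ` R = L" using swap_if_transitive by blast
    have "simple_under G (E :: (nat \<Rightarrow> 'f) set)"
      by (rule simple_if_blocks[OF _ _ g]) (use R D1 D2 iso in blast)+
    then show ?lhs using irr_n by blast
  qed
qed

end
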